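(* Let $\epsilon\in\mathbb{C}\setminus i\mathbb{R}$. For $1\le r\le p_+$, $1\le s\le p_-$ and $n\in\mathbb{Z}$, the modular $S$-transformation of the characters of the modules $\mathcal{I}_{r,s;n}$ is $$\mathrm{ch}[\mathcal{I}^\epsilon_{r,s;n}]\left(-\tfrac1\tau\right)=n\,\delta_{n\ge0}\sum_{(r',s')\in\mathcal{T}_{p_+,p_-}}(-1)^{n(p_+s'+p_-r')}S^{\mathrm{Vir}}_{(r,s),(r',s')}\,\mathrm{ch}[\mathcal{L}_{r',s'}](\tau)+\int_{\mathbb{R}}S^\epsilon_{r,s;n}(x)\,\mathrm{ch}[\mathcal{F}^\epsilon_{x+\alpha_0/2}](\tau)\,dx+\frac{1-\operatorname{sgn}(\operatorname{Re}(\epsilon))}{2}\,Y^\epsilon_{r,s;n}(\tau),$$ with $S$-kernel $$S^\epsilon_{r,s;n}(x)=-e^{-2\pi\epsilon x}e^{-\pi i n\sqrt{2p_+p_-}(x+i\epsilon)}\frac{\sin\left(2\pi rp_-\frac{x+i\epsilon}{\sqrt{2p_+p_-}}\right)\sin\left(2\pi sp_+\frac{x+i\epsilon}{\sqrt{2p_+p_-}}\right)}{\sin\left(\pi\sqrt{2p_+p_-}(x+i\epsilon)\right)^2},$$ and with correction term, writing $E_m(\epsilon,\tau)=q^{-\epsilon^2/2}\,\theta_{p_+p_-,m}(i\sqrt{2p_+p_-}\,\epsilon\tau,\tau)/\eta(\tau)$, $$\begin{aligned}Y^\epsilon_{r,s;n}(\tau)={}&\frac{1}{4\pi p_+p_-}\frac{d}{d\epsilon}\sum_{m=0}^{2p_+p_--1}(-1)^{mn}\sin\left(\tfrac{\pi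 rm}{p_+}\right)\sin\left(\tfrac{\pi sm}{p_-}\right)E_m(\epsilon,\tau)\\&-\frac{n}{\sqrt{2p_+p_-}}\sum_{m=0}^{2p_+p_--1}(-1)^{mn}\sin\left(\tfrac{\pi rm}{p_+}\right)\sin\left(\tfrac{\pi sm}{p_-}\right)E_m(\epsilon,\tau)\\&+\frac{ri}{p_+}\frac{1}{\sqrt{2p_+p_-}}\sum_{m=0}^{2p_+p_--1}(-1)^{mn}\cos\left(\tfrac{\pi rm}{p_+}\right)\sin\left(\tfrac{\pi sm}{p_-}\right)E_m(\epsilon,\tau)\\&+\frac{si}{p_-}\frac{1}{\sqrt{2p_+p_-}}\sum_{m=0}^{2p_+p_--1}(-1)^{mn}\sin\left(\tfrac{\pi rm}{p_+}\right)\cos\left(\tfrac{\pi sm}{p_-}\right)E_m(\epsilon,\tau).\end{aligned}$$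
   Context: Let $p_+,p_-\ge1$ be coprime integers with $p_+\neq p_-$, $\alpha_+=\sqrt{2p_-/p_+}$, $\alpha_-=-\sqrt{2p_+/p_-}$, $\alpha_0=\alpha_++\alpha_-$, $\alpha=\sqrt{2p_+p_-}$, and $\alpha_{r,s;n}=\frac{1-r}{2}\alpha_++\frac{1-s}{2}\alpha_-+\frac n2\alpha$. Let $\tau$ lie in the upper half-plane, $q=e^{2\pi i\tau}$ (with $q^x:=e^{2\pi i\tau x}$), $\eta$ the Dedekind eta function, $\theta_{a,b}(u,\tau)=\sum_{k\in\mathbb{Z}}e^{2\pi iu(k+\frac b{2a})}q^{a(k+\frac{b}{2a})^2}$, $\theta_{a,b}(\tau)=\theta_{a,b}(0,\tau)$; $\delta_{n\ge0}=1$ if $n\ge0$ and $0$ otherwise; $\delta_{n\text{ even}}$, $\delta_{n\text{ odd}}$ are the indicators of the parity of $n$. The modules are modules over the singlet vertex operator algebra: Fock modules $\mathcal{F}_\lambda$, their submodules $\mathcal{I}_{r,s;n}$ (intersections of images of screening operators), and Virasoro minimal model modules $\mathcal{L}_{r,s}$. Their regularised characters, with complex parameter $\epsilon$, are as follows. Fock modules: $\mathrm{ch}[\mathcal{F}^\epsilon_\lambda](\tau)=e^{2\pi\epsilon(\lambda-\alpha_0/2)}q^{(\lambda-\alpha_0/2)^2/2}/\eta(\tau)$; write $\mathcal{F}^\epsilon_{r,s;n}$ for $\mathcal{F}^\epsilon_{\alpha_{r,s;n}}$. Minimal models (not regularised), for $1\le r<p_+$, $1\le s<p_-$: $\mathrm{ch}[\mathcal{L}_{r,s}](\tau)=\bigl(\theta_{p_+p_-,rp_--sp_+}(\tau)-\theta_{p_+p_-,rp_-+sp_+}(\tau)\bigr)/\eta(\tau)$.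 For $1\le r<p_+$, $1\le s<p_-$, the regularised character of $\mathcal{I}_{r,s;n}$ is defined by replacing Fock characters by regularised ones in its resolution: $\mathrm{ch}[\mathcal{I}^\epsilon_{r,s;n}]=n\,\delta_{n\ge0}\bigl(\delta_{n\text{ even}}\mathrm{ch}[\mathcal{L}_{r,s}]-\delta_{n\text{ odd}}\mathrm{ch}[\mathcal{L}_{r,p_--s}]\bigr)+\sum_{k\ge0}(k+1)\bigl(\mathrm{ch}[\mathcal{F}^\epsilon_{p_+-r,s;n-2k-1}]+\mathrm{ch}[\mathcal{F}^\epsilon_{r,p_--s;n-2k-3}]-\mathrm{ch}[\mathcal{F}^\epsilon_{r,s;n-2k-2}]-\mathrm{ch}[\mathcal{F}^\epsilon_{p_+-r,p_--s;n-2k-2}]\bigr)$. Border cases: for $1\le r<p_+$, $\mathrm{ch}[\mathcal{I}^\epsilon_{r,p_-;n}]=\sum_{k\ge0}\bigl(\mathrm{ch}[\mathcal{F}^\epsilon_{p_+-r,p_-;n-2k-1}]-\mathrm{ch}[\mathcal{F}^\epsilon_{r,p_-;n-2k-2}]\bigr)$; for $1\le s<p_-$, $\mathrm{ch}[\mathcal{I}^\epsilon_{p_+,s;n}]=\sum_{k\ge0}\bigl(\mathrm{ch}[\mathcal{F}^\epsilon_{p_+,s;n-2k}]-\mathrm{ch}[\mathcal{F}^\epsilon_{p_+,p_--s;n-2k-1}]\bigr)$; and $\mathrm{ch}[\mathcal{I}^\epsilon_{p_+,p_-;n}]=\mathrm{ch}[\mathcal{F}^\epsilon_{p_+,p_-;n}]$.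 $\mathcal{T}_{p_+,p_-}=\{(r,s)\in\mathbb{Z}^2: 1\le r<p_+,\ 1\le s<p_-,\ sp_+>rp_-\}$, and $$S^{\mathrm{Vir}}_{(r,s),(r',s')}=(-1)^{(r+s)(r'+s')}\sqrt{\tfrac{8}{p_+p_-}}\,\sin\left(\tfrac{\pi rr'(p_--p_+)}{p_+}\right)\sin\left(\tfrac{\pi ss'(p_--p_+)}{p_-}\right).$$
   Formalization: The printed formula is false; here the S-kernel has overall sign + instead of −, and in Y the first coefficient is 4 times (1/(πp₊p₋)) and the other three are twice the printed ones (2n/√(2p₊p₋), 2ri/(p₊√(2p₊p₋)), 2si/(p₋√(2p₊p₋))). *)

theory Defs
  imports "HOL-Analysis.Analysis"
begin

text \<open>
  Throughout, \<open>p\<close> and \<open>q\<close> stand for $p_+$ and $p_-$. The nome is not given a name of its own: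
  the power $q^x$ of the nome $e^{2 \pi i \tau}$ is \<open>nome_pow \<tau> x\<close>, which fixes the branch.
\<close>

definition nome_pow :: "complex \<Rightarrow> complex \<Rightarrow> complex" where
  "nome_pow \<tau> x = exp (2 * of_real pi * \<i> * \<tau> * x)"

definition dedekind_eta :: "complex \<Rightarrow> complex" where
  "dedekind_eta \<tau> = nome_pow \<tau> (1 / 24) * (\<Prod>k. 1 - nome_pow \<tau> (of_nat (Suc k)))"

definition theta :: "int \<Rightarrow> int \<Rightarrow> complex \<Rightarrow> complex \<Rightarrow> complex" where
  "theta a b u \<tau> = (\<Sum>\<^sub>\<infinity>k::int.
     exp (2 * of_real pi * \<i> * u * (of_int k + of_int b / (2 * of_int a))) *
     nome_pow \<tau> (of_int a * (of_int k + of_int b / (2 * of_int a))\<^sup>2))"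

definition alpha_plus :: "int \<Rightarrow> int \<Rightarrow> real" where
  "alpha_plus p q = sqrt (2 * of_int q / of_int p)"

definition alpha_minus :: "int \<Rightarrow> int \<Rightarrow> real" where
  "alpha_minus p q = - sqrt (2 * of_int p / of_int q)"

definition alpha_zero :: "int \<Rightarrow> int \<Rightarrow> real" where
  "alpha_zero p q = alpha_plus p q + alpha_minus p q"

definition alpha :: "int \<Rightarrow> int \<Rightarrow> real" where
  "alpha p q = sqrt (2 * of_int p * of_int q)"

definition alpha_weight :: "int \<Rightarrow> int \<Rightarrow> int \<Rightarrow> int \<Rightarrow> int \<Rightarrow> real" where
  "alpha_weight p q r s n =
     (1 - of_int r) / 2 * alpha_plus p q + (1 - of_int s) / 2 * alpha_minus p q
       + of_int n / 2 * alpha p q"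

definition ch_Fock :: "int \<Rightarrow> int \<Rightarrow> complex \<Rightarrow> complex \<Rightarrow> complex \<Rightarrow> complex" where
  "ch_Fock p q \<epsilon> l \<tau> =
     exp (2 * of_real pi * \<epsilon> * (l - of_real (alpha_zero p q) / 2)) *
     nome_pow \<tau> ((l - of_real (alpha_zero p q) / 2)\<^sup>2 / 2) / dedekind_eta \<tau>"

definition ch_F :: "int \<Rightarrow> int \<Rightarrow> complex \<Rightarrow> int \<Rightarrow> int \<Rightarrow> int \<Rightarrow> complex \<Rightarrow> complex" where
  "ch_F p q \<epsilon> r s n \<tau> = ch_Fock p q \<epsilon> (of_real (alpha_weight p q r s n)) \<tau>"

definition ch_L :: "int \<Rightarrow> int \<Rightarrow> int \<Rightarrow> int \<Rightarrow> complex \<Rightarrow> complex" where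
  "ch_L p q r s \<tau> =
     (theta (p * q) (r * q - s * p) 0 \<tau> - theta (p * q) (r * q + s * p) 0 \<tau>) / dedekind_eta \<tau>"

text \<open>Only meaningful for \<open>1 \<le> r \<le> p\<close> and \<open>1 \<le> s \<le> q\<close>; the last three branches are
  the border cases \<open>s = q\<close>, \<open>r = p\<close>, and both.\<close>

definition ch_I :: "int \<Rightarrow> int \<Rightarrow> complex \<Rightarrow> int \<Rightarrow> int \<Rightarrow> int \<Rightarrow> complex \<Rightarrow> complex" where
  "ch_I p q \<epsilon> r s n \<tau> =
     (if r < p \<and> s < q then
        of_int n * of_bool (n \<ge> 0) *
          (of_bool (even n) * ch_L p q r s \<tau> - of_bool (odd n) * ch_L p q r (q - s) \<tau>)
        + (\<Sum>k::nat. of_nat (k + 1) *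
            (ch_F p q \<epsilon> (p - r) s (n - 2 * int k - 1) \<tau>
             + ch_F p q \<epsilon> r (q - s) (n - 2 * int k - 3) \<tau>
             - ch_F p q \<epsilon> r s (n - 2 * int k - 2) \<tau>
             - ch_F p q \<epsilon> (p - r) (q - s) (n - 2 * int k - 2) \<tau>))
      else if r < p then
        (\<Sum>k::nat. ch_F p q \<epsilon> (p - r) q (n - 2 * int k - 1) \<tau>
                    - ch_F p q \<epsilon> r q (n - 2 * int k - 2) \<tau>)
      else if s < q then
        (\<Sum>k::nat. ch_F p q \<epsilon> p s (n - 2 * int k) \<tau>
                    - ch_F p q \<epsilon> p (q - s) (n - 2 * int k - 1) \<tau>)
      else ch_F p q \<epsilon> p q n \<tau>)"

definition Kac_half :: "int \<Rightarrow> int \<Rightarrow> (int \<times> int) set" where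
  "Kac_half p q = {(r, s). 1 \<le> r \<and> r < p \<and> 1 \<le> s \<and> s < q \<and> s * p > r * q}"

definition S_Vir :: "int \<Rightarrow> int \<Rightarrow> int \<times> int \<Rightarrow> int \<times> int \<Rightarrow> real" where
  "S_Vir p q = (\<lambda>(r, s) (r', s').
     (-1) powi ((r + s) * (r' + s')) * sqrt (8 / (of_int p * of_int q)) *
     sin (pi * of_int r * of_int r' * of_int (q - p) / of_int p) *
     sin (pi * of_int s * of_int s' * of_int (q - p) / of_int q))"

text \<open>
  The overall sign of the kernel is \<open>+\<close>, not the printed \<open>-\<close>. For \<open>r = p\<close>, \<open>s = q\<close>, \<open>n = 0\<close> the
  quotient of sines is \<open>1\<close>, and at $\tau = i$ the transformation formula reads
  $1/\eta(i) = \pm \int e^{-\pi x^2}/\eta(i)\,dx = \pm 1/\eta(i)$ when $\mathrm{Re}\,\epsilon > 0$,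
  which forces the plus sign.
\<close>

definition S_kernel :: "int \<Rightarrow> int \<Rightarrow> complex \<Rightarrow> int \<Rightarrow> int \<Rightarrow> int \<Rightarrow> real \<Rightarrow> complex" where
  "S_kernel p q \<epsilon> r s n x =
     (let y = of_real x + \<i> * \<epsilon>; a = of_real (alpha p q) in
        exp (- 2 * of_real pi * \<epsilon> * of_real x) *
        exp (- of_real pi * \<i> * of_int n * a * y) *
        (sin (2 * of_real pi * of_int r * of_int q * y / a) *
         sin (2 * of_real pi * of_int s * of_int p * y / a)) /
        (sin (of_real pi * a * y))\<^sup>2)"

definition E_theta :: "int \<Rightarrow> int \<Rightarrow> int \<Rightarrow> complex \<Rightarrow> complex \<Rightarrow> complex" where
  "E_theta p q m \<epsilon> \<tau> =
     nome_pow \<tau> (- \<epsilon>\<^sup>2 / 2) * theta (p * q) m (\<i> * of_real (alpha p q) * \<epsilon> * \<tau>) \<tau>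
       / dedekind_eta \<tau>"

text \<open>
  The correction term is $2 \pi i$ times the sum of the residues of the integrand at the double
  poles $x + i \epsilon = m / \sqrt{2 p q}$. There $1/\sin(\pi \sqrt{2 p q}\, y)^2$ has leading
  coefficient $1/(2 \pi^2 p q)$, so each term carries the factor $i/(\pi p q)$ times a
  $y$-derivative. This gives the constants below: the first is 4 times and the other three are
  2 times the printed ones, which do not satisfy the formula.
\<close>

definition Y_corr :: "int \<Rightarrow> int \<Rightarrow> complex \<Rightarrow> int \<Rightarrow> int \<Rightarrow> int \<Rightarrow> complex \<Rightarrow> complex" where
  "Y_corr p q \<epsilon> r s n \<tau> =
     1 / (of_real pi * of_int p * of_int q) *
       deriv (\<lambda>e. \<Sum>m = 0..2 * p * q - 1. (-1) powi (m * n) *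
         of_real (sin (pi * of_int r * of_int m / of_int p)) *
         of_real (sin (pi * of_int s * of_int m / of_int q)) * E_theta p q m e \<tau>) \<epsilon>
     - 2 * of_int n / of_real (alpha p q) *
       (\<Sum>m = 0..2 * p * q - 1. (-1) powi (m * n) *
         of_real (sin (pi * of_int r * of_int m / of_int p)) *
         of_real (sin (pi * of_int s * of_int m / of_int q)) * E_theta p q m \<epsilon> \<tau>)
     + 2 * of_int r * \<i> / of_int p * (1 / of_real (alpha p q)) *
       (\<Sum>m = 0..2 * p * q - 1. (-1) powi (m * n) *
         of_real (cos (pi * of_int r * of_int m / of_int p)) *
         of_real (sin (pi * of_int s * of_int m / of_int q)) * E_theta p q m \<epsilon> \<tau>)
     + 2 * of_int s * \<i> / of_int q * (1 / of_real (alpha p q)) *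
       (\<Sum>m = 0..2 * p * q - 1. (-1) powi (m * n) *
         of_real (sin (pi * of_int r * of_int m / of_int p)) *
         of_real (cos (pi * of_int s * of_int m / of_int q)) * E_theta p q m \<epsilon> \<tau>)"

end

theory Submission
  imports Defs "HOL-Complex_Analysis.Complex_Analysis" "HOL-Probability.Distributions"
begin

text \<open>
  Put \<open>a = sqrt (2 p q)\<close> and \<open>\<phi> = \<pi> a (x + \<i> \<epsilon>)\<close>. The momenta \<open>\<lambda> - \<alpha>\<^sub>0 / 2\<close> of the Fock modules
  in the theorem are \<open>M / a\<close> with \<open>M\<close> an integer, namely \<open>M = n p q - r q + s p\<close> for
  \<open>\<F>\<close> at \<open>r, s; n\<close>. All characters are therefore sums of the terms \<open>lattice_fock\<close>, and
  the proof has three parts.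

  \<^item> \<^emph>\<open>The integral.\<close> The Gaussian integral with complex parameters (\<open>integral_gaussian\<close>) and
    the transformation of \<open>\<eta>\<close> (\<open>dedekind_eta_S\<close>) write the term of momentum \<open>M / a\<close> at
    \<open>- 1 / \<tau>\<close> as the integral of \<open>exp (- 2 \<pi> \<i> M (x + \<i> \<epsilon>) / a)\<close> against \<open>q\<close> to the
    power \<open>x\<^sup>2 / 2\<close>, divided by \<open>\<eta>(\<tau>)\<close>. The four Fock modules in one step of the resolution
    then contribute \<open>- 4 sin (r \<phi> / p) sin (s \<phi> / q) exp (- \<i> n \<phi>) z ^ j\<close> with \<open>z = exp (2 \<i> \<phi>)\<close> and
    \<open>j = k + 1\<close>, with weight \<open>j\<close>. The modulus of \<open>z\<close> does not depend on \<open>x\<close> and is below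
    \<open>1\<close> iff \<open>Re \<epsilon> > 0\<close>. In that case the sum over \<open>j \<ge> 1\<close> may be taken under the integral, and
    \<open>\<Sum> j z ^ j = - 1 / (4 sin \<phi> ^ 2)\<close> produces the S-kernel (\<open>fock_quad_sum_S\<close>).

  \<^item> \<^emph>\<open>The correction term.\<close> If \<open>Re \<epsilon> < 0\<close>, the terms with \<open>j \<le> - 1\<close> can be summed instead, and
    their sum is minus the same integral. Hence the sum over \<open>j \<ge> 1\<close> is the integral plus the sum
    over all integers \<open>j\<close>. The latter converges for every \<open>\<epsilon>\<close>, since the terms are Gaussian
    in \<open>j\<close>; it consists of theta series and their derivatives in \<open>\<epsilon>\<close>, and Poisson summation
    (\<open>lattice_theta_S\<close>) evaluates it to \<open>Y_corr\<close> (\<open>Y_corr_eq_infsum_fock_quad\<close>). The full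
    lattice sum takes the place of the residues that a shift of the contour would collect.

  \<^item> \<^emph>\<open>The minimal models.\<close> Poisson summation turns their characters into a sum over residues
    \<open>m\<close> modulo \<open>2 p q\<close> with coefficients \<open>\<plusminus> sin (\<pi> r m / p) sin (\<pi> s m / q)\<close>. These vanish if
    \<open>p\<close> or \<open>q\<close> divides \<open>m\<close>, and the other residues are \<open>\<plusminus> (r' q \<plusminus> s' p)\<close> with \<open>(r', s')\<close> in
    half of the Kac table, each occurring once (\<open>residue_sum_Kac\<close>). Collecting them gives the Virasoro
    S-matrix (\<open>vacuum_S\<close>).

  The border cases \<open>r = p\<close> and \<open>s = q\<close> need no separate treatment. There the minimal model
  characters vanish and the weights \<open>k + 1\<close> of the interior formula telescope to the border
  resolutions, so the interior formula holds for all \<open>r \<le> p\<close> and \<open>s \<le> q\<close> (\<open>ch_I_uniform\<close>).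
\<close>

section \<open>Sums over the integers\<close>

lemma summable_exp_quadratic:
  fixes b c :: real
  assumes "c > 0"
  shows "summable (\<lambda>k::nat. exp (b * real k - c * (real k)\<^sup>2))"
proof (rule summable_comparison_test)
  have "summable (\<lambda>k::nat. exp ((b + 1)\<^sup>2 / (4 * c)) * (exp (-1::real)) ^ k)"
    by (intro summable_mult summable_geometric) auto
  then show "summable (\<lambda>k::nat. exp ((b + 1)\<^sup>2 / (4 * c)) * exp (- real k))"
    by (simp add: exp_of_nat_mult[symmetric])
  have "b * x - c * x\<^sup>2 \<le> (b + 1)\<^sup>2 / (4 * c) - x" for x
  proof -
    have "(b + 1)\<^sup>2 / (4 * c) - x - (b * x - c * x\<^sup>2) = c * (x - (b + 1) / (2 * c))\<^sup>2"
      using assms by (simp add: field_simps power2_eq_square)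
    also have "\<dots> \<ge> 0"
      using assms by simp
    finally show ?thesis
      by simp
  qed
  from this[of "real _"] show "\<exists>N. \<forall>k\<ge>N. norm (exp (b * real k - c * (real k)\<^sup>2))
      \<le> exp ((b + 1)\<^sup>2 / (4 * c)) * exp (- real k)"
    by (intro exI[of _ 0]) (simp add: exp_add[symmetric])
qed

lemma summable_on_exp_quadratic_int:
  fixes b c :: real
  assumes "c > 0"
  shows "(\<lambda>k::int. exp (b * \<bar>of_int k\<bar> - c * (of_int k)\<^sup>2)) summable_on UNIV"
proof -
  let ?f = "\<lambda>k::int. exp (b * \<bar>of_int k\<bar> - c * (of_int k)\<^sup>2)"
  have nat: "(\<lambda>k::nat. exp (b * real k - c * (real k)\<^sup>2)) summable_on UNIV"
    by (rule norm_summable_imp_summable_on) (simp add: summable_exp_quadratic[OF assms])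
  have "?f summable_on range int"
    by (subst summable_on_reindex) (use nat in \<open>simp_all add: o_def\<close>)
  moreover have "?f summable_on range (\<lambda>k. - int k)"
    by (subst summable_on_reindex) (use nat in \<open>simp_all add: o_def inj_on_def\<close>)
  ultimately have "?f summable_on (range int \<union> range (\<lambda>k. - int k))"
    by (rule summable_on_union)
  moreover have "range int \<union> range (\<lambda>k. - int k) = UNIV"
    by (force intro: int_cases2)
  ultimately show ?thesis
    by simp
qed

lemma abs_summable_on_int_gaussian_bound:
  fixes f :: "int \<Rightarrow> complex"
  assumes "c > 0" and "\<And>k. norm (f k) \<le> M * exp (b * \<bar>of_int k\<bar> - c * (of_int k)\<^sup>2)"
  shows "(\<lambda>k. norm (f k)) summable_on UNIV"
  using summable_on_cmult_right[OF summable_on_exp_quadratic_int[OF assms(1)]]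
  by (rule summable_on_comparison_test) (use assms(2) in auto)

text \<open>
  A linear factor costs only one unit in the linear part of the exponent. It appears whenever a
  theta series is differentiated in its elliptic variable.
\<close>

lemma abs_summable_on_int_mult:
  fixes f :: "int \<Rightarrow> complex"
  assumes "c > 0" and bd: "\<And>k. norm (f k) \<le> M * exp (b * \<bar>of_int k\<bar> - c * (of_int k)\<^sup>2)"
  shows "(\<lambda>k. norm (of_int k * f k)) summable_on UNIV"
proof (rule abs_summable_on_int_gaussian_bound[OF assms(1)])
  fix k :: int
  have "\<bar>of_int k\<bar> \<le> exp \<bar>real_of_int k\<bar>"
    using exp_ge_add_one_self[of "\<bar>real_of_int k\<bar>"] by linarith
  then have "norm (of_int k * f k)
      \<le> exp \<bar>real_of_int k\<bar> * (M * exp (b * \<bar>of_int k\<bar> - c * (of_int k)\<^sup>2))"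
    unfolding norm_mult by (intro mult_mono bd) auto
  also have "\<dots> = M * exp ((b + 1) * \<bar>of_int k\<bar> - c * (of_int k)\<^sup>2)"
    by (simp add: exp_add[symmetric] algebra_simps flip: exp_add)
  finally show "norm (of_int k * f k) \<le> M * exp ((b + 1) * \<bar>of_int k\<bar> - c * (of_int k)\<^sup>2)" .
qed

lemma bij_int_decode: "bij int_decode"
  by (simp add: bij_def inj_int_decode surj_int_decode)

lemma infsum_int_eq_suminf:
  fixes f :: "int \<Rightarrow> complex"
  assumes "(\<lambda>k. norm (f k)) summable_on UNIV"
  shows "summable (\<lambda>n. norm (f (int_decode n)))"
    and "(\<Sum>\<^sub>\<infinity>k. f k) = (\<Sum>n. f (int_decode n))"
proof -
  have *: "(\<lambda>n. norm (f (int_decode n))) summable_on UNIV"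
    using summable_on_reindex_bij_betw[OF bij_int_decode, of "\<lambda>k. norm (f k)"] assms by simp
  then show s: "summable (\<lambda>n. norm (f (int_decode n)))"
    by (rule summable_on_imp_summable)
  have "(\<Sum>\<^sub>\<infinity>k. f k) = (\<Sum>\<^sub>\<infinity>n. f (int_decode n))"
    using infsum_reindex_bij_betw[OF bij_int_decode, of f] by simp
  also have "\<dots> = (\<Sum>n. f (int_decode n))"
    using abs_summable_summable[OF *] by (intro sums_unique has_sum_imp_sums) simp
  finally show "(\<Sum>\<^sub>\<infinity>k. f k) = (\<Sum>n. f (int_decode n))" .
qed

text \<open>
  After an enumeration of the integers this is dominated convergence for a series.
\<close>

lemma integral_infsum_int:
  fixes f :: "int \<Rightarrow> 'a \<Rightarrow> complex"
  assumes int: "\<And>k. integrable M (f k)"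
    and pt: "\<And>x. (\<lambda>k. norm (f k x)) summable_on UNIV"
    and bd: "\<And>k. (LINT x|M. norm (f k x)) \<le> B k" and B: "B summable_on UNIV"
  shows "integrable M (\<lambda>x. \<Sum>\<^sub>\<infinity>k. f k x)"
    and "(LINT x|M. (\<Sum>\<^sub>\<infinity>k. f k x)) = (\<Sum>\<^sub>\<infinity>k. LINT x|M. f k x)"
proof -
  have eq: "(\<Sum>\<^sub>\<infinity>k. f k x) = (\<Sum>n. f (int_decode n) x)" for x
    by (rule infsum_int_eq_suminf(2)[OF pt])
  have "(\<lambda>n. B (int_decode n)) summable_on UNIV"
    using summable_on_reindex_bij_betw[OF bij_int_decode, of B] B by simp
  then have "summable (\<lambda>n. B (int_decode n))"
    by (rule summable_on_imp_summable)
  then have s: "summable (\<lambda>n. LINT x|M. norm (f (int_decode n) x))"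
    by (rule summable_comparison_test[rotated]) (use bd in auto)
  have AE: "AE x in M. summable (\<lambda>n. norm (f (int_decode n) x))"
    by (intro AE_I2 infsum_int_eq_suminf(1)[OF pt])
  show "integrable M (\<lambda>x. \<Sum>\<^sub>\<infinity>k. f k x)"
    unfolding eq by (rule integrable_suminf[OF int AE s])
  have "norm (LINT x|M. f k x) \<le> B k" for k
    using integral_norm_bound[of M "f k"] bd[of k] by linarith
  then have "(\<lambda>k. norm (LINT x|M. f k x)) summable_on UNIV"
    by (intro summable_on_comparison_test[OF B]) auto
  from infsum_int_eq_suminf(2)[OF this]
  show "(LINT x|M. (\<Sum>\<^sub>\<infinity>k. f k x)) = (\<Sum>\<^sub>\<infinity>k. LINT x|M. f k x)"
    unfolding eq integral_suminf[OF int AE s] by simp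
qed

lemma exp_pi_int: "exp (of_real pi * \<i> * of_int k) = (-1) powi k"
proof -
  have "exp (of_real pi * \<i>) powi k = exp (of_int k * (of_real pi * \<i>))"
    by (rule exp_power_int)
  then show ?thesis
    by (simp add: mult_ac)
qed

lemma infsum_int_residues:
  fixes f :: "int \<Rightarrow> complex"
  assumes f: "(\<lambda>m. norm (f m)) summable_on UNIV" and N: "N > 0"
  shows "(\<Sum>\<^sub>\<infinity>m. f m) = (\<Sum>j = 0..N - 1. \<Sum>\<^sub>\<infinity>k. f (N * k + j))"
proof -
  have bij: "bij_betw (\<lambda>(j, k). N * k + j) ({0..N - 1} \<times> UNIV) UNIV"
    by (rule bij_betwI[where g = "\<lambda>m. (m mod N, m div N)"]) (use N in auto)
  have "(\<lambda>(j, k). f (N * k + j)) summable_on ({0..N - 1} \<times> UNIV)"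
    using summable_on_reindex_bij_betw[OF bij, of f] abs_summable_summable[OF f]
    by (simp add: case_prod_unfold)
  then have "(\<Sum>\<^sub>\<infinity>j\<in>{0..N - 1}. \<Sum>\<^sub>\<infinity>k. f (N * k + j)) = (\<Sum>\<^sub>\<infinity>(j, k)\<in>{0..N - 1} \<times> UNIV. f (N * k + j))"
    by (rule infsum_Sigma'_banach)
  also have "\<dots> = (\<Sum>\<^sub>\<infinity>m. f m)"
    using infsum_reindex_bij_betw[OF bij, of f] by (simp add: case_prod_unfold)
  finally show ?thesis
    by simp
qed

lemma abs_summable_on_int_affine:
  fixes f :: "int \<Rightarrow> complex"
  assumes "(\<lambda>m. norm (f m)) summable_on UNIV" and "N \<noteq> 0"
  shows "(\<lambda>k. norm (f (N * k + j))) summable_on UNIV"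
proof -
  have "inj (\<lambda>k. N * k + j)"
    using assms(2) by (auto simp: inj_def)
  moreover have "(\<lambda>m. norm (f m)) summable_on range (\<lambda>k. N * k + j)"
    using assms(1) summable_on_subset by blast
  ultimately show ?thesis
    using summable_on_reindex[of "\<lambda>k. N * k + j" UNIV "\<lambda>m. norm (f m)"] by (simp add: o_def)
qed

lemma has_sum_int_symmetric_limit:
  fixes f :: "int \<Rightarrow> complex"
  assumes "(f has_sum s) UNIV"
  shows "(\<lambda>n. \<Sum>k = - int n..int n. f k) \<longlonglongrightarrow> s"
proof -
  have "filterlim (\<lambda>n. {- int n..int n}) (finite_subsets_at_top UNIV) sequentially"
    unfolding filterlim_finite_subsets_at_top
  proof (intro allI impI)
    fix X :: "int set" assume "finite X \<and> X \<subseteq> UNIV"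
    then obtain b where b: "\<And>x. x \<in> X \<Longrightarrow> \<bar>x\<bar> \<le> b"
      by (metis finite_abs_int_segment abs_ge_zero bdd_above.E bdd_above_finite finite_imageI image_eqI)
    have "X \<subseteq> {- int n..int n}" if "n \<ge> nat b" for n
      using b that by (force simp: abs_le_iff)
    then show "\<forall>\<^sub>F n in sequentially. finite {- int n..int n} \<and> X \<subseteq> {- int n..int n} \<and> {- int n..int n} \<subseteq> UNIV"
      unfolding eventually_sequentially by auto
  qed
  then show ?thesis
    using assms unfolding has_sum_def by (rule filterlim_compose[rotated])
qed

lemma infsum_int_split:
  fixes f :: "int \<Rightarrow> complex"
  assumes f: "(\<lambda>j. norm (f j)) summable_on UNIV"
  shows "summable (\<lambda>k::nat. norm (f (int k + 1)))" "summable (\<lambda>k::nat. norm (f (- (int k + 1))))"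
    and "(\<Sum>\<^sub>\<infinity>j. f j) = f 0 + (\<Sum>k. f (int k + 1)) + (\<Sum>k. f (- (int k + 1)))"
proof -
  have half: "summable (\<lambda>k::nat. norm (f (h k)))" "(\<Sum>\<^sub>\<infinity>j\<in>range h. f j) = (\<Sum>k. f (h k))" if "inj h" for h :: "nat \<Rightarrow> int"
  proof -
    have "(\<lambda>j. norm (f j)) summable_on range h"
      using f summable_on_subset by blast
    then have *: "(\<lambda>k. norm (f (h k))) summable_on UNIV"
      using summable_on_reindex[OF that, of "\<lambda>j. norm (f j)"] by (simp add: o_def)
    then show "summable (\<lambda>k. norm (f (h k)))"
      by (rule summable_on_imp_summable)
    have "(\<Sum>\<^sub>\<infinity>j\<in>range h. f j) = (\<Sum>\<^sub>\<infinity>k. f (h k))"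
      using infsum_reindex[OF that, of f] by (simp add: o_def)
    also have "\<dots> = (\<Sum>k. f (h k))"
      by (rule sums_unique[OF has_sum_imp_sums[OF has_sum_infsum[OF abs_summable_summable[OF *]]]])
    finally show "(\<Sum>\<^sub>\<infinity>j\<in>range h. f j) = (\<Sum>k. f (h k))" .
  qed
  define h1 h2 where "h1 = (\<lambda>k. int k + 1)" and "h2 = (\<lambda>k. - (int k + 1))"
  have inj: "inj h1" "inj h2"
    by (auto simp: h1_def h2_def inj_def)
  show "summable (\<lambda>k::nat. norm (f (int k + 1)))" "summable (\<lambda>k::nat. norm (f (- (int k + 1))))"
    using half(1)[OF inj(1)] half(1)[OF inj(2)] by (simp_all add: h1_def h2_def)
  have U: "UNIV = ({0} \<union> range h1) \<union> range h2"
  proof -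
    have "j \<in> ({0} \<union> range h1) \<union> range h2" for j
    proof -
      consider "j = 0" | "j > 0" | "j < 0" by linarith
      then show ?thesis
      proof cases
        case 2
        then have "j = h1 (nat (j - 1))" by (simp add: h1_def)
        then show ?thesis by blast
      next
        case 3
        then have "j = h2 (nat (- j - 1))" by (simp add: h2_def)
        then show ?thesis by blast
      qed simp
    qed
    then show ?thesis by blast
  qed
  have s: "f summable_on A" for A
    using summable_on_subset[OF abs_summable_summable[OF f]] by simp
  have "(\<Sum>\<^sub>\<infinity>j. f j) = infsum f ({0} \<union> range h1) + infsum f (range h2)"
    unfolding U by (rule infsum_Un_disjoint[OF s s]) (auto simp: h1_def h2_def)
  also have "infsum f ({0} \<union> range h1) = f 0 + infsum f (range h1)"
    by (subst infsum_Un_disjoint[OF s s]) (auto simp: h1_def)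
  finally show "(\<Sum>\<^sub>\<infinity>j. f j) = f 0 + (\<Sum>k. f (int k + 1)) + (\<Sum>k. f (- (int k + 1)))"
    using half(2)[OF inj(1)] half(2)[OF inj(2)] by (simp add: h1_def h2_def)
qed

section \<open>The Gaussian integral with complex parameters\<close>

lemma has_bochner_integral_gaussian_real:
  fixes b c :: real
  assumes "c > 0"
  shows "has_bochner_integral lborel (\<lambda>x. exp (- c * x\<^sup>2 + b * x)) (sqrt (pi / c) * exp (b\<^sup>2 / (4 * c)))"
proof -
  define \<sigma> where "\<sigma> = sqrt (1 / (2 * c))"
  define \<mu> where "\<mu> = b / (2 * c)"
  have s: "\<sigma> > 0" "\<sigma>\<^sup>2 = 1 / (2 * c)"
    using assms by (auto simp: \<sigma>_def)
  have "has_bochner_integral lborel (normal_density \<mu> \<sigma>) 1"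
    using s integral_normal_density[of \<sigma> \<mu>] integrable_normal_density[of \<sigma> \<mu>]
    by (simp add: has_bochner_integral_iff)
  then have "has_bochner_integral lborel
      (\<lambda>x. (sqrt (pi / c) * exp (b\<^sup>2 / (4 * c))) * normal_density \<mu> \<sigma> x)
      ((sqrt (pi / c) * exp (b\<^sup>2 / (4 * c))) * 1)"
    by (rule has_bochner_integral_mult_right)
  moreover have "(sqrt (pi / c) * exp (b\<^sup>2 / (4 * c))) * normal_density \<mu> \<sigma> x = exp (- c * x\<^sup>2 + b * x)" for x
  proof -
    have "b\<^sup>2 / (4 * c) + - ((x - \<mu>)\<^sup>2 / (2 * \<sigma>\<^sup>2)) = - c * x\<^sup>2 + b * x"
      unfolding s(2) \<mu>_def using assms by (simp add: field_simps power2_eq_square)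
    moreover have "sqrt (2 * pi * \<sigma>\<^sup>2) = sqrt (pi / c)"
      by (simp add: s)
    moreover have "sqrt (pi / c) > 0"
      using assms by simp
    ultimately show ?thesis
      using assms by (simp add: normal_density_def exp_add[symmetric])
  qed
  ultimately show ?thesis
    by simp
qed

text \<open>
  Expanding the exponential and integrating term by term gives a power series. The integrand
  of the hypothesis dominates all partial sums on the disc of radius \<open>r\<close>.
\<close>

lemma holomorphic_integral_exp:
  fixes g \<phi> :: "real \<Rightarrow> complex"
  assumes [measurable]: "g \<in> borel_measurable borel" "\<phi> \<in> borel_measurable borel"
    and int: "integrable lborel (\<lambda>x. norm (g x) * exp (r * norm (\<phi> x)))"
  shows "(\<lambda>s. LINT x|lborel. g x * exp (s * \<phi> x)) holomorphic_on ball 0 r"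
proof (rule power_series_holomorphic)
  fix s :: complex assume "s \<in> ball 0 r"
  then have sr: "norm s \<le> r"
    by simp
  define f where "f = (\<lambda>(n::nat) x. g x * (s * \<phi> x) ^ n / fact n)"
  have [measurable]: "f n \<in> borel_measurable lborel" for n
    unfolding f_def by measurable
  have nf: "norm (f n x) = norm (g x) * ((norm s * norm (\<phi> x)) ^ n /\<^sub>R fact n)" for n x
    by (simp add: f_def norm_mult norm_divide norm_power divide_simps)
  have sums: "(\<lambda>n. norm (f n x)) sums (norm (g x) * exp (norm s * norm (\<phi> x)))" for x
    unfolding nf by (intro sums_mult exp_converges)
  have le: "norm (g x) * exp (norm s * norm (\<phi> x)) \<le> norm (g x) * exp (r * norm (\<phi> x))" for x
    using sr by (intro mult_left_mono) (auto intro: mult_right_mono)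
  have intS: "integrable lborel (\<lambda>x. norm (g x) * exp (norm s * norm (\<phi> x)))"
    by (rule Bochner_Integration.integrable_bound[OF int]) (use le in auto)
  have intf: "integrable lborel (f n)" for n
  proof (rule Bochner_Integration.integrable_bound[OF intS])
    have "norm (f n x) \<le> norm (g x) * exp (norm s * norm (\<phi> x))" for x
      using sums_unique[OF sums[of x]] sum_le_suminf[OF sums_summable[OF sums[of x]], of "{n}"] by simp
    then show "AE x in lborel. norm (f n x) \<le> norm (norm (g x) * exp (norm s * norm (\<phi> x)))"
      by simp
  qed simp
  have sI: "summable (\<lambda>n. LINT x|lborel. norm (f n x))"
  proof (rule bounded_imp_summable)
    show "(LINT x|lborel. norm (f n x)) \<ge> 0" for n
      by simp
    show "(\<Sum>k\<le>n. LINT x|lborel. norm (f k x)) \<le> (LINT x|lborel. norm (g x) * exp (norm s * norm (\<phi> x)))" for n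
    proof -
      have "(\<Sum>k\<le>n. LINT x|lborel. norm (f k x)) = (LINT x|lborel. (\<Sum>k\<le>n. norm (f k x)))"
        using intf by (intro Bochner_Integration.integral_sum[symmetric]) auto
      also have "\<dots> \<le> (LINT x|lborel. norm (g x) * exp (norm s * norm (\<phi> x)))"
      proof (rule integral_mono)
        show "(\<Sum>k\<le>n. norm (f k x)) \<le> norm (g x) * exp (norm s * norm (\<phi> x))" for x
          using sum_le_suminf[OF sums_summable[OF sums[of x]], of "{..n}"] sums_unique[OF sums[of x]]
          by simp
      qed (use intf intS in auto)
      finally show ?thesis .
    qed
  qed
  have "(\<lambda>n. integral\<^sup>L lborel (f n)) sums (LINT x|lborel. (\<Sum>n. f n x))"
    using intf sI sums by (intro sums_integral AE_I2) (auto simp: sums_iff)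
  moreover have "(\<Sum>n. f n x) = g x * exp (s * \<phi> x)" for x
  proof -
    have "f n x = g x * ((s * \<phi> x) ^ n /\<^sub>R fact n)" for n
      by (simp add: f_def divide_simps scaleR_conv_of_real)
    then have "(\<lambda>n. f n x) sums (g x * exp (s * \<phi> x))"
      using sums_mult[OF exp_converges] by simp
    then show ?thesis
      by (simp add: sums_iff)
  qed
  moreover have "integral\<^sup>L lborel (f n) = (LINT x|lborel. g x * \<phi> x ^ n) / fact n * (s - 0) ^ n" for n
  proof -
    have "f n = (\<lambda>x. (s ^ n / fact n) * (g x * \<phi> x ^ n))"
      by (simp add: f_def power_mult_distrib fun_eq_iff)
    then show ?thesis
      by simp
  qed
  ultimately show "(\<lambda>n. (LINT x|lborel. g x * \<phi> x ^ n) / fact n * (s - 0) ^ n) sums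
      (LINT x|lborel. g x * exp (s * \<phi> x))"
    by simp
qed

text \<open>
  The identity theorem in the form needed to continue an identity from a real interval.
\<close>

lemma holomorphic_eq_if_eq_on_reals:
  fixes f g :: "complex \<Rightarrow> complex"
  assumes "f holomorphic_on S" "g holomorphic_on S" "open S" "connected S" "z \<in> S"
    and "a < b" "of_real a \<in> S" "\<And>x. a < x \<Longrightarrow> x < b \<Longrightarrow> f (of_real x) = g (of_real x)"
    shows "f z = g z"
proof -
  have "complex_of_real a islimpt (of_real ` {a<..<b})"
    unfolding islimpt_approachable
  proof (intro allI impI)
    fix e :: real assume "e > 0"
    let ?x = "a + min (e / 2) ((b - a) / 2)"
    have "?x \<in> {a<..<b}" "?x \<noteq> a" "dist (complex_of_real ?x) (of_real a) < e"
      using \<open>e > 0\<close> \<open>a < b\<close> by (auto simp: dist_norm min_def norm_divide field_simps)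
    then show "\<exists>y\<in>of_real ` {a<..<b}. y \<noteq> complex_of_real a \<and> dist y (of_real a) < e"
      by (intro bexI[of _ "complex_of_real ?x"] imageI) (auto simp only: of_real_eq_iff)
  qed
  then have lim: "complex_of_real a islimpt (of_real ` {a<..<b} \<inter> S)"
    using eventually_at_in_open'[OF \<open>open S\<close> \<open>of_real a \<in> S\<close>]
    by (intro islimpt_Int_eventually) auto
  have "f z - g z = 0"
    by (rule analytic_continuation[of "\<lambda>z. f z - g z" S "of_real ` {a<..<b} \<inter> S" "of_real a"])
      (use assms lim in \<open>auto intro!: holomorphic_intros\<close>)
  then show ?thesis
    by simp
qed

lemma norm_gaussian:
  "norm (exp (- w * (of_real x)\<^sup>2 + z * of_real x)) = exp (- Re w * x\<^sup>2 + Re z * x)"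
  by (simp add: norm_exp_eq_Re power2_eq_square)

lemma integrable_gaussian:
  assumes "Re w > 0"
  shows "integrable lborel (\<lambda>x. exp (- w * (of_real x)\<^sup>2 + z * of_real x))"
proof (rule Bochner_Integration.integrable_bound)
  show "integrable lborel (\<lambda>x. exp (- Re w * x\<^sup>2 + Re z * x))"
    using has_bochner_integral_gaussian_real[OF assms] by (rule integrable.intros)
  show "AE x in lborel. norm (exp (- w * (of_real x)\<^sup>2 + z * of_real x))
      \<le> norm (exp (- Re w * x\<^sup>2 + Re z * x))"
    unfolding norm_gaussian by simp
qed measurable

text \<open>
  Two analytic continuations. For real \<open>w > 0\<close> and real \<open>z\<close> this is completing the square. Both
  sides are holomorphic in \<open>w\<close> on the right half-plane for fixed real \<open>z\<close>, and then entire in \<open>z\<close>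
  for fixed \<open>w\<close>.
\<close>

theorem integral_gaussian:
  assumes w: "Re w > 0"
  shows "(LINT x|lborel. exp (- w * (of_real x)\<^sup>2 + z * of_real x))
       = of_real (sqrt pi) / csqrt w * exp (z\<^sup>2 / (4 * w))"
proof -
  define G where "G = (\<lambda>w z::complex. LINT x|lborel. exp (- w * (of_real x)\<^sup>2 + z * of_real x))"
  define H where "H = (\<lambda>w z::complex. complex_of_real (sqrt pi) / csqrt w * exp (z\<^sup>2 / (4 * w)))"
  have rr: "G (of_real c) (of_real b) = H (of_real c) (of_real b)" if "c > 0" for b c
  proof -
    have "(LINT x|lborel. of_real (exp (- c * x\<^sup>2 + b * x)))
        = complex_of_real (sqrt (pi / c) * exp (b\<^sup>2 / (4 * c)))"
      using has_bochner_integral_gaussian_real[OF that, of b]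
      by (metis has_bochner_integral_integral_eq has_bochner_integral_of_real)
    moreover have "csqrt (of_real c) = of_real (sqrt c)"
      using that by simp
    moreover have "exp (- of_real c * (of_real x)\<^sup>2 + of_real b * of_real x)
        = complex_of_real (exp (- c * x\<^sup>2 + b * x))" for x
      unfolding exp_of_real[symmetric] by simp
    moreover have "exp ((of_real b)\<^sup>2 / (4 * of_real c)) = complex_of_real (exp (b\<^sup>2 / (4 * c)))"
      unfolding exp_of_real[symmetric] by simp
    ultimately show ?thesis
      unfolding G_def H_def by (simp add: real_sqrt_divide)
  qed
  let ?R = "{w. Re w > 0}"
  have "G w (of_real b) = H w (of_real b)" for b
  proof (rule holomorphic_eq_if_eq_on_reals[where f = "\<lambda>w. G w (of_real b)"
        and g = "\<lambda>w. H w (of_real b)" and S = "?R" and a = 1 and b = 2])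
    show "open ?R"
      by (rule open_halfspace_Re_gt)
    show "connected ?R"
      by (intro convex_connected convex_halfspace_Re_gt)
    show "(\<lambda>w. G w (of_real b)) holomorphic_on ?R"
    proof (subst holomorphic_on_open[OF \<open>open ?R\<close>], safe)
      fix u assume u: "Re u > 0"
      have "(\<lambda>s. LINT x|lborel. exp (- u * (of_real x)\<^sup>2 + of_real b * of_real x)
          * exp (s * (- (of_real x)\<^sup>2))) holomorphic_on ball 0 (Re u / 2)"
      proof (rule holomorphic_integral_exp)
        have "norm (exp (- u * (of_real x)\<^sup>2 + of_real b * of_real x))
          * exp (Re u / 2 * norm (- (complex_of_real x)\<^sup>2)) = exp (- (Re u / 2) * x\<^sup>2 + b * x)" for x
          unfolding norm_gaussian by (simp add: exp_add[symmetric] norm_power)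
        then show "integrable lborel (\<lambda>x. norm (exp (- u * (of_real x)\<^sup>2 + of_real b * of_real x))
          * exp (Re u / 2 * norm (- (complex_of_real x)\<^sup>2)))"
          using has_bochner_integral_gaussian_real[of "Re u / 2" b] u
          by (simp add: has_bochner_integral_iff)
      qed measurable
      then have "(\<lambda>s. G (u + s) (of_real b)) holomorphic_on ball 0 (Re u / 2)"
        unfolding G_def exp_add[symmetric] by (simp add: algebra_simps)
      then have "(\<lambda>s. G (u + s) (of_real b)) field_differentiable (at 0)"
        using u by (meson centre_in_ball half_gt_zero holomorphic_on_imp_differentiable_at open_ball)
      then obtain D where "((\<lambda>s. G (s + u) (of_real b)) has_field_derivative D) (at 0)"
        unfolding field_differentiable_def by (auto simp: add.commute)
      then show "\<exists>D. ((\<lambda>w. G w (of_real b)) has_field_derivative D) (at u)"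
        using DERIV_shift[of "\<lambda>w. G w (of_real b)" D 0 u] by auto
    qed
    show "(\<lambda>w. H w (of_real b)) holomorphic_on ?R"
      unfolding H_def by (intro holomorphic_intros) (auto simp: complex_nonpos_Reals_iff)
  qed (use rr w in auto)
  have "G w z = H w z"
  proof (rule holomorphic_eq_if_eq_on_reals[where f = "G w" and g = "H w" and S = UNIV and a = 0 and b = 1])
    have "G w holomorphic_on ball 0 R" for R
      unfolding G_def exp_add
    proof (rule holomorphic_integral_exp)
      have "norm (exp (- w * (of_real x)\<^sup>2)) * exp (R * norm (complex_of_real x))
         \<le> exp (- Re w * x\<^sup>2 + R * x) + exp (- Re w * x\<^sup>2 + (- R) * x)" for x
        using norm_gaussian[of w x 0] by (cases "x \<ge> 0") (auto simp: exp_add[symmetric])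
      moreover have "integrable lborel (\<lambda>x. exp (- Re w * x\<^sup>2 + R * x) + exp (- Re w * x\<^sup>2 + (- R) * x))"
        by (intro Bochner_Integration.integrable_add
            integrable.intros[OF has_bochner_integral_gaussian_real[OF w]])
      ultimately show "integrable lborel (\<lambda>x. norm (exp (- w * (of_real x)\<^sup>2)) * exp (R * norm (complex_of_real x)))"
        by (intro Bochner_Integration.integrable_bound[where g = "\<lambda>x. norm (exp (- w * (of_real x)\<^sup>2)) * exp (R * norm (complex_of_real x))"]) auto
    qed measurable
    then have "G w field_differentiable at u" for u
      by (rule holomorphic_on_imp_differentiable_at[where s = "ball 0 (norm u + 1)"]) auto
    then show "G w holomorphic_on UNIV"
      by (simp add: holomorphic_on_def)
    show "H w holomorphic_on UNIV"
      using w unfolding H_def by (intro holomorphic_intros) auto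
  qed (use \<open>\<And>b. G w (of_real b) = H w (of_real b)\<close> in auto)
  then show ?thesis
    by (simp add: G_def H_def)
qed

section \<open>Uniqueness of Fourier coefficients\<close>

text \<open>
  The factor \<open>(1 + cos) / 2\<close> is a combination of the characters of index \<open>-1, 0, 1\<close>, so
  multiplying by it keeps \<open>h\<close> orthogonal to all characters. This provides test functions that
  concentrate at \<open>x0\<close> as \<open>N\<close> grows.
\<close>

lemma orthogonal_trig_powers:
  fixes h :: "real \<Rightarrow> complex"
  assumes h: "continuous_on {0..1} h"
    and orth: "\<And>m::int. integral {0..1} (\<lambda>x. h x * exp (- (2 * pi * \<i> * m * x))) = 0"
  shows "integral {0..1} (\<lambda>x. h x * of_real (((1 + cos (2 * pi * (x - x0))) / 2) ^ N)
      * exp (- (2 * pi * \<i> * of_int m * x))) = 0"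
proof (induction N arbitrary: m)
  case 0
  then show ?case
    using orth by simp
next
  case (Suc N)
  define F where "F = (\<lambda>m x. h x * of_real (((1 + cos (2 * pi * (x - x0))) / 2) ^ N)
      * exp (- (2 * pi * \<i> * of_int m * x)))"
  have int: "F m integrable_on {0..1}" for m :: int
    unfolding F_def by (intro integrable_continuous_interval continuous_intros h) auto
  have 0: "integral {0..1} (F m) = 0" for m
    unfolding F_def by (rule Suc.IH)
  have "h x * of_real (((1 + cos (2 * pi * (x - x0))) / 2) ^ Suc N)
      * exp (- (2 * pi * \<i> * of_int m * x)) =
      1/2 * F m x + (exp (- (2 * pi * \<i> * x0)) / 4 * F (m - 1) x + exp (2 * pi * \<i> * x0) / 4 * F (m + 1) x)" for x
  proof -
    define u e where "u = exp (2 * pi * \<i> * (x - x0))" and "e = exp (- (2 * pi * \<i> * of_int m * x))"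
    have cos: "complex_of_real (cos (2 * pi * (x - x0))) = (u + inverse u) / 2"
      unfolding cos_of_real[symmetric] cos_exp_eq u_def by (simp add: exp_minus[symmetric] algebra_simps)
    have e1: "exp (- (2 * pi * \<i> * x0)) * exp (- (2 * pi * \<i> * of_int (m - 1) * x)) = u * e"
      unfolding exp_add[symmetric] u_def e_def by (rule arg_cong[of _ _ exp]) (simp add: algebra_simps)
    have e2: "exp (2 * pi * \<i> * x0) * exp (- (2 * pi * \<i> * of_int (m + 1) * x)) = inverse u * e"
      unfolding u_def e_def exp_add[symmetric] exp_minus[symmetric]
      by (rule arg_cong[of _ _ exp]) (simp add: algebra_simps)
    define A where "A = h x * of_real (((1 + cos (2 * pi * (x - x0))) / 2) ^ N)"
    have "1/2 * F m x + (exp (- (2 * pi * \<i> * x0)) / 4 * F (m - 1) x + exp (2 * pi * \<i> * x0) / 4 * F (m + 1) x)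
      = A * (e / 2 + (exp (- (2 * pi * \<i> * x0)) * exp (- (2 * pi * \<i> * of_int (m - 1) * x))) / 4
       + (exp (2 * pi * \<i> * x0) * exp (- (2 * pi * \<i> * of_int (m + 1) * x))) / 4)"
      unfolding F_def A_def[symmetric] e_def by (simp add: algebra_simps)
    also have "\<dots> = A * of_real ((1 + cos (2 * pi * (x - x0))) / 2) * e"
      unfolding e1 e2 of_real_divide of_real_add cos by (simp add: field_simps)
    also have "\<dots> = h x * of_real (((1 + cos (2 * pi * (x - x0))) / 2) ^ Suc N) * e"
      by (simp add: A_def)
    finally show ?thesis
      by (simp add: e_def)
  qed
  then have "integral {0..1} (\<lambda>x. h x * of_real (((1 + cos (2 * pi * (x - x0))) / 2) ^ Suc N)
      * exp (- (2 * pi * \<i> * of_int m * x)))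
    = integral {0..1} (\<lambda>x. 1/2 * F m x + (exp (- (2 * pi * \<i> * x0)) / 4 * F (m - 1) x
         + exp (2 * pi * \<i> * x0) / 4 * F (m + 1) x))"
    by (simp only:)
  also have "\<dots> = 1/2 * integral {0..1} (F m) + (exp (- (2 * pi * \<i> * x0)) / 4 * integral {0..1} (F (m - 1))
      + exp (2 * pi * \<i> * x0) / 4 * integral {0..1} (F (m + 1)))"
    by (simp add: integral_add int integrable_add integrable_on_mult_right del: exp_minus times_divide_eq_left mult_minus_left)
  also have "\<dots> = 0"
    by (simp add: 0)
  finally show ?case .
qed

text \<open>
  If \<open>h x0\<close> were not zero, normalise it to \<open>1\<close>. The kernel \<open>((1 + cos (2 \<pi> (x - x0))) / 2) ^ N\<close>
  is exponentially larger within distance \<open>\<delta> / 2\<close> of \<open>x0\<close> than beyond distance \<open>\<delta>\<close>, so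
  for large \<open>N\<close> the integral of \<open>Re (h / h x0)\<close> against it is positive, although it must vanish.
\<close>

lemma zero_if_fourier_coeffs_zero_interior:
  fixes h :: "real \<Rightarrow> complex"
  assumes h: "continuous_on {0..1} h"
    and orth: "\<And>m::int. integral {0..1} (\<lambda>x. h x * exp (- (2 * pi * \<i> * m * x))) = 0"
    and x0: "0 < x0" "x0 < 1"
  shows "h x0 = 0"
proof (rule ccontr)
  assume nz: "h x0 \<noteq> 0"
  define f where "f = (\<lambda>x. Re (h x / h x0))"
  define K where "K = (\<lambda>x. (1 + cos (2 * pi * (x - x0))) / 2)"
  have cont_f: "continuous_on {0..1} f"
    unfolding f_def using nz by (intro continuous_intros h) auto
  have cont_K: "continuous_on {0..1} K"
    unfolding K_def by (intro continuous_intros) auto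
  have int0: "integral {0..1} (\<lambda>x. f x * K x ^ N) = 0" for N
  proof -
    have "integral {0..1} (\<lambda>x. h x * of_real (K x ^ N)) = 0"
      using orthogonal_trig_powers[OF h orth, of x0 N 0] by (simp add: K_def)
    moreover have "(\<lambda>x. h x * of_real (K x ^ N)) integrable_on {0..1}"
      by (intro integrable_continuous_interval continuous_intros h cont_K)
    ultimately have "((\<lambda>x. h x * of_real (K x ^ N)) has_integral 0) {0..1}"
      by (metis integrable_integral)
    then have "((\<lambda>x. h x * of_real (K x ^ N) * (1 / h x0)) has_integral 0 * (1 / h x0)) {0..1}"
      by (rule has_integral_mult_left)
    then have "((\<lambda>x. Re (h x * of_real (K x ^ N) * (1 / h x0))) has_integral Re (0 * (1 / h x0))) {0..1}"
      by (rule has_integral_Re)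
    moreover have "Re (h x * of_real (K x ^ N) * (1 / h x0)) = f x * K x ^ N" for x
    proof -
      have "h x * of_real (K x ^ N) * (1 / h x0) = (h x / h x0) * of_real (K x ^ N)"
        by (simp add: mult_ac)
      then show ?thesis
        by (simp only: f_def Re_complex_of_real Im_complex_of_real times_complex.sel mult_zero_right diff_zero)
    qed
    ultimately show ?thesis
      by (simp add: integral_unique)
  qed
  have "f x0 = 1"
    using nz by (simp add: f_def)
  have "isCont f x0"
    using continuous_on_interior[OF cont_f] x0 by simp
  then have "(f \<longlongrightarrow> 1) (nhds x0)"
    using \<open>f x0 = 1\<close> by (metis isCont_def tendsto_at_iff_tendsto_nhds)
  then have "\<forall>\<^sub>F x in nhds x0. f x > 1 / 2"
    by (rule order_tendstoD) simp
  then obtain d where d: "d > 0" "\<And>x. dist x x0 < d \<Longrightarrow> f x > 1 / 2"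
    unfolding eventually_nhds_metric by blast
  \<comment> \<open>Small enough that the interval of radius \<open>\<delta>\<close> about \<open>x0\<close> stays inside the period.\<close>
  define \<delta> where "\<delta> = Min {d / 2, x0 / 2, (1 - x0) / 2}"
  have \<delta>: "\<delta> > 0" "\<delta> < d" "\<delta> < x0" "\<delta> < 1 - x0"
    using d x0 by (auto simp: \<delta>_def min_def)
  obtain M where "\<forall>y\<in>f ` {0..1}. norm y \<le> M"
    using compact_imp_bounded[OF compact_continuous_image[OF cont_f compact_Icc]]
    unfolding bounded_iff by blast
  then have M: "\<bar>f x\<bar> \<le> M" if "x \<in> {0..1}" for x
    using that by auto
  \<comment> \<open>The minimum of the kernel up to distance \<open>\<delta> / 2\<close> and its maximum from distance \<open>\<delta>\<close> on.\<close>
  define k1 k2 where "k1 = (1 + cos (2 * pi * (\<delta> / 2))) / 2" and "k2 = (1 + cos (2 * pi * \<delta>)) / 2"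
  have "\<delta> < 1 / 2"
    using \<delta> by linarith
  then have "2 * pi * \<delta> < pi"
    using mult_strict_left_mono[of \<delta> "1 / 2" "2 * pi"] by simp
  have Kabs: "K x = (1 + cos (2 * pi * \<bar>x - x0\<bar>)) / 2" for x
  proof -
    have "2 * pi * \<bar>x - x0\<bar> = \<bar>2 * pi * (x - x0)\<bar>"
      by (simp add: abs_mult)
    then show ?thesis
      by (simp only: cos_abs_real K_def)
  qed
  have nonneg: "0 \<le> (1 + cos y) / 2" for y :: real
    using cos_double_cos[of "y / 2"] by simp
  have k12: "0 \<le> k2" "k2 < k1" "k1 > 0"
  proof -
    show "k2 < k1"
      unfolding k1_def k2_def using \<delta> \<open>2 * pi * \<delta> < pi\<close> cos_monotone_0_pi[of "2 * pi * (\<delta> / 2)" "2 * pi * \<delta>"] by simp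
    show "0 \<le> k2"
      unfolding k2_def by (rule nonneg)
    then show "k1 > 0"
      using \<open>k2 < k1\<close> by simp
  qed
  have K0: "K x \<ge> 0" for x
    unfolding K_def by (rule nonneg)
  have K1: "K x \<ge> k1" if "\<bar>x - x0\<bar> \<le> \<delta> / 2" for x
  proof -
    have "cos (2 * pi * (\<delta> / 2)) \<le> cos (2 * pi * \<bar>x - x0\<bar>)"
      using that \<open>2 * pi * \<delta> < pi\<close> \<delta> by (intro cos_monotone_0_pi_le) (auto intro: mult_left_mono)
    then show ?thesis
      by (simp add: Kabs k1_def)
  qed
  have K2: "K x \<le> k2" if "\<bar>x - x0\<bar> \<ge> \<delta>" "x \<in> {0..1}" for x
  proof -
    have u: "\<bar>x - x0\<bar> \<le> 1 - \<delta>"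
      using that \<delta> by auto
    have "cos (2 * pi * \<bar>x - x0\<bar>) \<le> cos (2 * pi * \<delta>)"
    proof (cases "\<bar>x - x0\<bar> \<le> 1 / 2")
      case True
      then show ?thesis
        using that \<delta> by (intro cos_monotone_0_pi_le) auto
    next
      case False
      have "cos (2 * pi * \<bar>x - x0\<bar>) = cos (2 * pi * (1 - \<bar>x - x0\<bar>))"
        by (simp add: right_diff_distrib cos_diff)
      also have "\<dots> \<le> cos (2 * pi * \<delta>)"
        using False u \<delta> by (intro cos_monotone_0_pi_le) auto
      finally show ?thesis .
    qed
    then show ?thesis
      by (simp add: Kabs k2_def)
  qed
  have "M \<ge> 0"
    using M[of x0] x0 by auto
  \<comment> \<open>Integrate the pointwise lower bound of \<open>f x * K x ^ N\<close>; the right side tends to \<open>0\<close>.\<close>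
  have key: "\<delta> / 2 \<le> M * (k2 / k1) ^ N" for N
  proof -
    let ?S = "{x0 - \<delta> / 2 .. x0 + \<delta> / 2}"
    let ?g = "\<lambda>x. (if x \<in> ?S then k1 ^ N / 2 else 0) - M * k2 ^ N"
    have "((\<lambda>x. k1 ^ N / 2) has_integral (\<delta> * (k1 ^ N / 2))) ?S"
      using has_integral_const_real[of "k1 ^ N / 2" "x0 - \<delta> / 2" "x0 + \<delta> / 2"] \<delta> by simp
    moreover have "?S \<subseteq> {0..1}"
      using \<delta> by auto
    ultimately have "((\<lambda>x. if x \<in> ?S then k1 ^ N / 2 else 0) has_integral \<delta> * (k1 ^ N / 2)) {0..1}"
      by (subst has_integral_restrict) auto
    moreover have "((\<lambda>x. M * k2 ^ N) has_integral M * k2 ^ N) {0..(1::real)}"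
      using has_integral_const_real[of "M * k2 ^ N" 0 1] by simp
    ultimately have g: "(?g has_integral (\<delta> * (k1 ^ N / 2) - M * k2 ^ N)) {0..1}"
      by (rule has_integral_diff)
    have "(\<lambda>x. f x * K x ^ N) integrable_on {0..1}"
      by (intro integrable_continuous_interval continuous_intros cont_f cont_K)
    then have f: "((\<lambda>x. f x * K x ^ N) has_integral 0) {0..1}"
      using int0[of N] by (metis integrable_integral)
    have "\<delta> * (k1 ^ N / 2) - M * k2 ^ N \<le> 0"
    proof (rule has_integral_le[OF g f])
      fix x :: real assume x: "x \<in> {0..1}"
      have S: "x \<in> ?S \<longleftrightarrow> \<bar>x - x0\<bar> \<le> \<delta> / 2"
        unfolding atLeastAtMost_iff by linarith
      have Mk: "0 \<le> M * k2 ^ N"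
        using \<open>M \<ge> 0\<close> k12 by simp
      consider "\<bar>x - x0\<bar> \<le> \<delta> / 2" | "\<bar>x - x0\<bar> > \<delta> / 2" "\<bar>x - x0\<bar> < \<delta>" | "\<bar>x - x0\<bar> \<ge> \<delta>"
        by linarith
      then show "?g x \<le> f x * K x ^ N"
      proof cases
        case 1
        then have "f x \<ge> 1 / 2"
          using d(2)[of x] \<delta> by (auto simp: dist_real_def)
        then have "(1 / 2) * k1 ^ N \<le> f x * K x ^ N"
          using K1[OF 1] k12 by (intro mult_mono power_mono) auto
        moreover have "x \<in> ?S"
          using 1 S by simp
        ultimately show ?thesis
          using Mk by simp
      next
        case 2
        then have "x \<notin> ?S"
          using S by simp
        moreover have "f x * K x ^ N \<ge> 0"
          using d(2)[of x] \<delta> 2 K0[of x] by (auto simp: dist_real_def)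
        ultimately show ?thesis
          using Mk by auto
      next
        case 3
        then have "x \<notin> ?S"
          using S \<delta> by simp
        have "\<bar>f x * K x ^ N\<bar> \<le> M * k2 ^ N"
          unfolding abs_mult power_abs using M[OF x] K2[OF 3 x] K0[of x] \<open>M \<ge> 0\<close>
          by (intro mult_mono power_mono) auto
        then show ?thesis
          using \<open>x \<notin> ?S\<close> by auto
      qed
    qed
    then show ?thesis
      using k12 by (simp add: power_divide field_simps)
  qed
  have "(\<lambda>N. M * (k2 / k1) ^ N) \<longlonglongrightarrow> M * 0"
    using k12 by (intro tendsto_mult tendsto_const LIMSEQ_realpow_zero) auto
  then have "\<delta> / 2 \<le> M * 0"
    by (rule tendsto_lowerbound) (use key in auto)
  then show False
    using \<delta> by simp
qed

theorem zero_if_fourier_coeffs_zero: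
  fixes h :: "real \<Rightarrow> complex"
  assumes h: "continuous_on UNIV h" and per: "\<And>x. h (x + 1) = h x"
    and orth: "\<And>m::int. integral {0..1} (\<lambda>x. h x * exp (- (2 * pi * \<i> * m * x))) = 0"
  shows "h x = 0"
proof -
  have h01: "continuous_on {0..1} h"
    using h continuous_on_subset by blast
  have "h y = 0" if "y \<in> {0..1}" for y
  proof -
    have "h y = 0" if "y \<in> closure {0<..<1}" for y
      by (rule continuous_constant_on_closure[OF _ _ that])
        (use zero_if_fourier_coeffs_zero_interior[OF h01 orth] h01 in auto)
    then show ?thesis
      using that by simp
  qed
  moreover have "h (y + of_int k) = h y" for y and k :: int
  proof (induction k arbitrary: y rule: int_induct[of _ 0])
    case (step1 i)
    then show ?case
      using per[of "y + of_int i"] by (simp add: add_ac)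
  next
    case (step2 i)
    then show ?case
      using per[of "y + of_int i - 1"] by (simp add: algebra_simps)
  qed auto
  from this[of "frac x" "\<lfloor>x\<rfloor>"] have "h x = h (frac x)"
    by (simp add: frac_def)
  ultimately show ?thesis
    using frac_ge_0[of x] frac_lt_1[of x] by auto
qed

section \<open>Poisson summation for Gaussians\<close>

lemma Im_neg_inverse_pos: "Im \<tau> > 0 \<Longrightarrow> Im (- 1 / \<tau>) > 0"
  by (simp add: Im_divide field_simps sum_power2_gt_zero_iff)

text \<open>
  The summand of a theta series as a function of the lattice point \<open>t\<close>; the parameter \<open>v\<close> is the
  elliptic variable.
\<close>

definition gauss_term :: "complex \<Rightarrow> complex \<Rightarrow> complex \<Rightarrow> complex" where
  "gauss_term \<tau> v t = exp (pi * \<i> * \<tau> * t\<^sup>2 + 2 * pi * \<i> * v * t)"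

lemma norm_gauss_term_real:
  "norm (gauss_term \<tau> v (of_real t)) = exp (- pi * Im \<tau> * t\<^sup>2 - 2 * pi * Im v * t)"
  by (simp add: gauss_term_def norm_exp_eq_Re power2_eq_square)

definition gauss_bound :: "complex \<Rightarrow> complex \<Rightarrow> real \<Rightarrow> int \<Rightarrow> real" where
  "gauss_bound \<tau> v R k = exp (2 * pi * \<bar>Im v\<bar> * R) *
    exp ((2 * pi * Im \<tau> * R + 2 * pi * \<bar>Im v\<bar>) * \<bar>of_int k\<bar> - pi * Im \<tau> * (of_int k)\<^sup>2)"

lemma summable_on_gauss_bound: "Im \<tau> > 0 \<Longrightarrow> gauss_bound \<tau> v R summable_on UNIV"
  unfolding gauss_bound_def by (intro summable_on_cmult_right summable_on_exp_quadratic_int) auto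

lemma norm_gauss_term_le:
  assumes "Im \<tau> > 0" "\<bar>x\<bar> \<le> R"
  shows "norm (gauss_term \<tau> v (of_int k + of_real x)) \<le> gauss_bound \<tau> v R k"
proof -
  have "- x * of_int k \<le> \<bar>- x * of_int k\<bar>"
    by (rule abs_ge_self)
  also have "\<dots> = \<bar>x\<bar> * \<bar>of_int k\<bar>"
    by (simp add: abs_mult)
  also have "\<dots> \<le> R * \<bar>of_int k\<bar>"
    using assms(2) by (rule mult_right_mono) simp
  finally have 1: "(pi * Im \<tau>) * (- x * of_int k) \<le> (pi * Im \<tau>) * (R * \<bar>of_int k\<bar>)"
    using assms(1) by (intro mult_left_mono) auto
  have "- Im v * (of_int k + x) \<le> \<bar>Im v\<bar> * (\<bar>of_int k\<bar> + R)"
  proof -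
    have "- Im v * (of_int k + x) \<le> \<bar>- Im v * (of_int k + x)\<bar>"
      by (rule abs_ge_self)
    also have "\<dots> = \<bar>Im v\<bar> * \<bar>of_int k + x\<bar>"
      by (simp only: abs_mult abs_minus_cancel)
    also have "\<dots> \<le> \<bar>Im v\<bar> * (\<bar>of_int k\<bar> + R)"
      using assms(2) by (intro mult_left_mono) auto
    finally show ?thesis .
  qed
  then have 2: "pi * (- Im v * (of_int k + x)) \<le> pi * (\<bar>Im v\<bar> * (\<bar>of_int k\<bar> + R))"
    by (intro mult_left_mono) auto
  have 3: "0 \<le> (pi * Im \<tau>) * x\<^sup>2"
    using assms(1) by simp
  have "- pi * Im \<tau> * (of_int k + x)\<^sup>2 - 2 * pi * Im v * (of_int k + x)
    = 2 * ((pi * Im \<tau>) * (- x * of_int k)) + 2 * (pi * (- Im v * (of_int k + x)))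
       - (pi * Im \<tau>) * (of_int k)\<^sup>2 - (pi * Im \<tau>) * x\<^sup>2"
    by (simp add: power2_eq_square algebra_simps)
  also have "\<dots> \<le> 2 * ((pi * Im \<tau>) * (R * \<bar>of_int k\<bar>)) + 2 * (pi * (\<bar>Im v\<bar> * (\<bar>of_int k\<bar> + R)))
       - (pi * Im \<tau>) * (of_int k)\<^sup>2"
    using 1 2 3 by linarith
  also have "\<dots> = 2 * pi * \<bar>Im v\<bar> * R + ((2 * pi * Im \<tau> * R + 2 * pi * \<bar>Im v\<bar>) * \<bar>of_int k\<bar> - pi * Im \<tau> * (of_int k)\<^sup>2)"
    by (simp add: algebra_simps)
  finally have "- pi * Im \<tau> * (of_int k + x)\<^sup>2 - 2 * pi * Im v * (of_int k + x)
    \<le> 2 * pi * \<bar>Im v\<bar> * R + ((2 * pi * Im \<tau> * R + 2 * pi * \<bar>Im v\<bar>) * \<bar>of_int k\<bar> - pi * Im \<tau> * (of_int k)\<^sup>2)" .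
  moreover have "norm (gauss_term \<tau> v (of_int k + of_real x))
      = exp (- pi * Im \<tau> * (of_int k + x)\<^sup>2 - 2 * pi * Im v * (of_int k + x))"
    using norm_gauss_term_real[of \<tau> v "of_int k + x"] by simp
  ultimately show ?thesis
    by (simp add: gauss_bound_def exp_add[symmetric])
qed

lemma abs_summable_gauss_term:
  assumes "Im \<tau> > 0"
  shows "(\<lambda>k::int. norm (gauss_term \<tau> v (of_int k + of_real x))) summable_on UNIV"
  by (rule summable_on_comparison_test[OF summable_on_gauss_bound[OF assms]
        norm_gauss_term_le[OF assms, of x "\<bar>x\<bar>"]]) auto

lemma csqrt_of_real_mult:
  assumes "r > 0"
  shows "csqrt (of_real r * z) = of_real (sqrt r) * csqrt z"
proof (rule csqrt_unique)
  have "(complex_of_real (sqrt r))\<^sup>2 = of_real r"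
    using assms by (simp flip: of_real_power)
  then show "(of_real (sqrt r) * csqrt z)\<^sup>2 = of_real r * z"
    by (simp add: power_mult_distrib)
  show "0 < Re (of_real (sqrt r) * csqrt z) \<or>
      Re (of_real (sqrt r) * csqrt z) = 0 \<and> 0 \<le> Im (of_real (sqrt r) * csqrt z)"
    using csqrt_principal[of z] assms by (auto simp del: csqrt.sel)
qed

lemma fourier_gauss_term:
  assumes "Im \<tau> > 0"
  shows "integrable lborel (\<lambda>t. gauss_term \<tau> v (of_real t) * exp (- (2 * pi * \<i> * u * of_real t)))"
      (is ?int)
    and "(LINT t|lborel. gauss_term \<tau> v (of_real t) * exp (- (2 * pi * \<i> * u * of_real t)))
       = exp (- pi * \<i> * (u - v)\<^sup>2 / \<tau>) / csqrt (- \<i> * \<tau>)"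
      (is ?eq)
proof -
  define w where "w = of_real pi * (- \<i> * \<tau>)"
  define z where "z = 2 * pi * \<i> * (v - u)"
  have w: "Re w > 0"
    using assms by (simp add: w_def)
  have eq: "gauss_term \<tau> v (of_real t) * exp (- (2 * pi * \<i> * u * of_real t))
      = exp (- w * (of_real t)\<^sup>2 + z * of_real t)" for t
    by (simp add: gauss_term_def w_def z_def exp_add[symmetric] algebra_simps)
  show ?int
    unfolding eq by (rule integrable_gaussian[OF w])
  have "csqrt w = of_real (sqrt pi) * csqrt (- \<i> * \<tau>)"
    unfolding w_def by (rule csqrt_of_real_mult) simp
  moreover have "z\<^sup>2 / (4 * w) = - pi * \<i> * (u - v)\<^sup>2 / \<tau>"
  proof -
    have alg: "(2 * P * \<i> * - D)\<^sup>2 / (4 * (P * (- \<i> * t))) = - P * \<i> * D\<^sup>2 / t"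
      if "t \<noteq> 0" "P \<noteq> 0" for P D t :: complex
      using that by (simp add: power2_eq_square field_simps)
    have "\<tau> \<noteq> 0"
      using assms by auto
    then show ?thesis
      using alg[of \<tau> "of_real pi" "u - v"] by (simp add: w_def z_def)
  qed
  ultimately show ?eq
    unfolding eq integral_gaussian[OF w] by (simp add: power2_commute)
qed

lemma continuous_on_infsum_int:
  fixes f :: "int \<Rightarrow> 'a::topological_space \<Rightarrow> complex"
  assumes "\<And>k. continuous_on S (f k)" "\<And>k x. x \<in> S \<Longrightarrow> norm (f k x) \<le> B k" "B summable_on UNIV"
  shows "continuous_on S (\<lambda>x. \<Sum>\<^sub>\<infinity>k. f k x)"
  by (rule uniform_limit_theorem[OF _ Weierstrass_m_test_general[OF assms(2,3)]])
    (auto intro!: always_eventually continuous_intros assms(1))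

lemma integral_unit_interval:
  fixes F :: "real \<Rightarrow> complex"
  assumes "continuous_on {0..1} F"
  shows "integral {0..1} F = (LINT x|lborel. indicator {0..<1} x *\<^sub>R F x)"
    and "integrable lborel (\<lambda>x. indicator {0..<1} x *\<^sub>R F x)"
proof -
  have 1: "set_integrable lborel {0..1} F"
    by (rule borel_integrable_atLeastAtMost'[OF assms])
  then have "set_integrable lborel {0..<1} F"
    by (rule set_integrable_subset) auto
  then show 2: "integrable lborel (\<lambda>x. indicator {0..<1} x *\<^sub>R F x)"
    by (simp add: set_integrable_def)
  have "integral {0..1} F = (LINT x|lborel. indicator {0..1} x *\<^sub>R F x)"
    using set_borel_integral_eq_integral(2)[OF 1] by (simp add: set_lebesgue_integral_def)
  also have "\<dots> = (LINT x|lborel. indicator {0..<1} x *\<^sub>R F x)"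
  proof (rule integral_cong_AE)
    show "AE x in lborel. indicator {0..1} x *\<^sub>R F x = indicator {0..<1} x *\<^sub>R F x"
      using AE_lborel_singleton[of 1] by eventually_elim (auto simp: indicator_def)
  qed (use 1 2 in \<open>auto simp: set_integrable_def\<close>)
  finally show "integral {0..1} F = (LINT x|lborel. indicator {0..<1} x *\<^sub>R F x)" .
qed

lemma exp_2pi_int: "exp (2 * pi * \<i> * of_int k * of_int l) = 1"
proof -
  have "2 * pi * \<i> * of_int k * of_int l = (2 * of_int (k * l) * pi) * \<i>"
    by simp
  then show ?thesis
    by (simp only: exp_integer_2pi Ints_of_int)
qed

lemma integral_unit_interval_exp:
  "integral {0..1} (\<lambda>x. exp (2 * pi * \<i> * of_int j * of_real x)) = (if j = 0 then 1 else 0)"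
proof (cases "j = 0")
  case False
  define c where "c = 2 * pi * \<i> * of_int j"
  have "c \<noteq> 0"
    using False by (simp add: c_def)
  have "((\<lambda>x. exp (c * of_real x)) has_integral exp (c * of_real 1) / c - exp (c * of_real 0) / c) {0..1}"
  proof (rule fundamental_theorem_of_calculus)
    fix x :: real
    have "((\<lambda>z. exp (c * z) / c) has_field_derivative exp (c * of_real x)) (at (of_real x))"
      using \<open>c \<noteq> 0\<close> by (auto intro!: derivative_eq_intros)
    then show "((\<lambda>x. exp (c * of_real x) / c) has_vector_derivative exp (c * of_real x)) (at x within {0..1})"
      by (rule has_vector_derivative_real_field)
  qed simp
  moreover have "exp c = 1"
    using exp_2pi_int[of j 1] by (simp add: c_def)
  ultimately show ?thesis
    using False by (simp add: c_def integral_unique)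
qed simp

text \<open>
  Unfolding: the unit intervals tile the line, so the zeroth Fourier coefficient of the
  periodization of \<open>g\<close> is the integral of \<open>g\<close>. The half-open interval makes the tiling exact.
\<close>

lemma fourier_coeff_periodization:
  fixes g :: "real \<Rightarrow> complex"
  assumes g: "continuous_on UNIV g" "integrable lborel g"
    and bd: "\<And>k x. x \<in> {0..1} \<Longrightarrow> norm (g (of_int k + x)) \<le> B k" and B: "B summable_on UNIV"
  shows "integral {0..1} (\<lambda>x. (\<Sum>\<^sub>\<infinity>k. g (of_int k + x))) = (LINT x|lborel. g x)"
proof -
  define f where "f = (\<lambda>k x. indicator {0..<1} x *\<^sub>R g (of_int k + x))"
  define f' where "f' = (\<lambda>k x. indicator {of_int k..<of_int k + 1} x *\<^sub>R g x)"
  have cont: "continuous_on A (\<lambda>x. g (of_int k + x))" for k :: int and A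
    by (rule continuous_on_compose2[OF g(1)]) (auto intro!: continuous_intros)
  have shift: "f' k (of_int k + 1 * x) = f k x" for k x
    by (simp add: f_def f'_def indicator_def)
  have int_f: "integrable lborel (f k)" for k
    unfolding f_def by (rule integral_unit_interval(2)[OF cont])
  have int_f': "integrable lborel (f' k)" for k
    unfolding f'_def by (rule integrable_mult_indicator[OF _ g(2)]) auto
  have B0: "B k \<ge> 0" for k
    using order_trans[OF norm_ge_zero bd[of 0 k]] by simp
  have nf: "norm (f k x) \<le> indicator {0..<1} x *\<^sub>R B k" for k x
    using bd[of x k] by (simp add: f_def indicator_def)
  have bd_f: "(LINT x|lborel. norm (f k x)) \<le> B k" for k
  proof -
    have "(LINT x|lborel. norm (f k x)) \<le> (LINT x|lborel. indicator {0..<1::real} x *\<^sub>R B k)"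
      using int_f nf by (intro integral_mono integrable_norm) (auto simp: integrable_indicator_iff)
    then show ?thesis
      by simp
  qed
  have bd_f': "(LINT x|lborel. norm (f' k x)) \<le> B k" for k
    using bd_f[of k] lborel_integral_real_affine[of 1 "\<lambda>x. norm (f' k x)" "of_int k"] shift by simp
  have pt_f: "(\<lambda>k. norm (f k x)) summable_on UNIV" for x
  proof (rule summable_on_comparison_test[OF B])
    show "norm (f k x) \<le> B k" for k
      using nf[of k x] B0[of k] by (cases "x \<in> {0..<1}") auto
  qed simp
  have off: "f' k x = 0" if "k \<noteq> \<lfloor>x\<rfloor>" for k x
    using that by (auto simp: f'_def indicator_def) linarith
  have pt_f': "(\<lambda>k. norm (f' k x)) summable_on UNIV" for x
    by (rule finite_nonzero_values_imp_summable_on)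
      (rule finite_subset[of _ "{\<lfloor>x\<rfloor>}"], use off in auto)
  have sum_f': "(\<Sum>\<^sub>\<infinity>k. f' k x) = g x" for x
  proof -
    have "(\<Sum>\<^sub>\<infinity>k. f' k x) = (\<Sum>\<^sub>\<infinity>k\<in>{\<lfloor>x\<rfloor>}. f' k x)"
      by (rule infsum_cong_neutral) (use off in auto)
    also have "\<dots> = g x"
      by (simp add: f'_def indicator_def)
    finally show ?thesis .
  qed
  have "integral {0..1} (\<lambda>x. (\<Sum>\<^sub>\<infinity>k. g (of_int k + x)))
      = (LINT x|lborel. indicator {0..<1} x *\<^sub>R (\<Sum>\<^sub>\<infinity>k. g (of_int k + x)))"
    by (intro integral_unit_interval(1) continuous_on_infsum_int[OF cont bd B])
  also have "\<dots> = (LINT x|lborel. (\<Sum>\<^sub>\<infinity>k. f k x))"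
    by (intro Bochner_Integration.integral_cong refl) (auto simp: f_def indicator_def)
  also have "\<dots> = (\<Sum>\<^sub>\<infinity>k. LINT x|lborel. f k x)"
    by (rule integral_infsum_int(2)[OF int_f pt_f bd_f B])
  also have "\<dots> = (\<Sum>\<^sub>\<infinity>k. LINT x|lborel. f' k x)"
  proof (intro infsum_cong)
    show "(LINT x|lborel. f k x) = (LINT x|lborel. f' k x)" for k
      using lborel_integral_real_affine[of 1 "f' k" "of_int k"] unfolding shift by simp
  qed
  also have "\<dots> = (LINT x|lborel. (\<Sum>\<^sub>\<infinity>k. f' k x))"
    by (rule integral_infsum_int(2)[OF int_f' pt_f' bd_f' B, symmetric])
  finally show ?thesis
    by (simp add: sum_f')
qed

lemma fourier_coeff_trig_series:
  fixes a :: "int \<Rightarrow> complex"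
  assumes a: "(\<lambda>j. norm (a j)) summable_on UNIV"
  shows "integral {0..1} (\<lambda>x. (\<Sum>\<^sub>\<infinity>j. a j * exp (2 * pi * \<i> * of_int j * of_real x))) = a 0"
proof -
  define f where "f = (\<lambda>j x. indicator {0..<1} x *\<^sub>R (a j * exp (2 * pi * \<i> * of_int j * of_real x)))"
  have cont: "continuous_on A (\<lambda>x. a j * exp (2 * pi * \<i> * of_int j * complex_of_real x))" for A j
    by (intro continuous_intros)
  have bd: "norm (a j * exp (2 * pi * \<i> * of_int j * complex_of_real x)) \<le> norm (a j)" for j x
    by (simp add: norm_mult norm_exp_eq_Re)
  have int_f: "integrable lborel (f j)" for j
    unfolding f_def by (rule integral_unit_interval(2)[OF cont])
  have nf: "norm (f j x) \<le> indicator {0..<1} x *\<^sub>R norm (a j)" for j x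
    using bd by (simp add: f_def indicator_def)
  have bd_f: "(LINT x|lborel. norm (f j x)) \<le> norm (a j)" for j
  proof -
    have "(LINT x|lborel. norm (f j x)) \<le> (LINT x|lborel. indicator {0..<1::real} x *\<^sub>R norm (a j))"
      using int_f nf by (intro integral_mono integrable_norm) (auto simp: integrable_indicator_iff)
    then show ?thesis
      by simp
  qed
  have pt_f: "(\<lambda>j. norm (f j x)) summable_on UNIV" for x
  proof (rule summable_on_comparison_test[OF a])
    show "norm (f j x) \<le> norm (a j)" for j
      using nf[of j x] by (cases "x \<in> {0..<1}") auto
  qed simp
  have "integral {0..1} (\<lambda>x. (\<Sum>\<^sub>\<infinity>j. a j * exp (2 * pi * \<i> * of_int j * of_real x)))
      = (LINT x|lborel. indicator {0..<1} x *\<^sub>R (\<Sum>\<^sub>\<infinity>j. a j * exp (2 * pi * \<i> * of_int j * of_real x)))"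
    by (intro integral_unit_interval(1) continuous_on_infsum_int[OF cont bd a])
  also have "\<dots> = (LINT x|lborel. (\<Sum>\<^sub>\<infinity>j. f j x))"
    by (intro Bochner_Integration.integral_cong refl) (auto simp: f_def indicator_def)
  also have "\<dots> = (\<Sum>\<^sub>\<infinity>j. LINT x|lborel. f j x)"
    by (rule integral_infsum_int(2)[OF int_f pt_f bd_f a])
  also have "\<dots> = (\<Sum>\<^sub>\<infinity>j. a j * (if j = 0 then 1 else 0))"
    unfolding f_def integral_unit_interval(1)[OF cont, symmetric] integral_mult_right integral_unit_interval_exp ..
  also have "\<dots> = (\<Sum>\<^sub>\<infinity>j\<in>{0}. a j)"
    by (rule infsum_cong_neutral) auto
  finally show ?thesis
    by simp
qed

text \<open>
  Both sides are continuous and have period \<open>1\<close> in \<open>x\<close>. By \<open>fourier_coeff_periodization\<close> the Fourier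
  coefficients of the left side are Gaussian integrals, and these are the coefficients of the
  series on the right, so uniqueness of Fourier coefficients applies. Complex \<open>v\<close> is allowed because the
  Gaussian integral is known for complex \<open>z\<close>; this later accommodates complex \<open>\<epsilon>\<close>.
\<close>

theorem poisson_summation_gauss:
  assumes \<tau>: "Im \<tau> > 0"
  shows "(\<Sum>\<^sub>\<infinity>k::int. gauss_term \<tau> v (of_int k + of_real x))
    = (\<Sum>\<^sub>\<infinity>m::int. exp (- pi * \<i> * (of_int m - v)\<^sup>2 / \<tau> + 2 * pi * \<i> * of_int m * of_real x)) / csqrt (- \<i> * \<tau>)"
proof -
  define a where "a = (\<lambda>m::int. exp (- pi * \<i> * (of_int m - v)\<^sup>2 / \<tau>) / csqrt (- \<i> * \<tau>))"
  define P where "P = (\<lambda>x. \<Sum>\<^sub>\<infinity>k::int. gauss_term \<tau> v (of_int k + of_real x))"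
  define Q where "Q = (\<lambda>x::real. \<Sum>\<^sub>\<infinity>m::int. a m * exp (2 * pi * \<i> * of_int m * of_real x))"
  define \<tau>' where "\<tau>' = - 1 / \<tau>"
  have \<tau>': "Im \<tau>' > 0"
    unfolding \<tau>'_def by (rule Im_neg_inverse_pos[OF \<tau>])
  have sa: "(\<lambda>m. norm (a m)) summable_on UNIV"
  proof -
    have "a m = (exp (pi * \<i> * \<tau>' * v\<^sup>2) / csqrt (- \<i> * \<tau>)) * gauss_term \<tau>' (- \<tau>' * v) (of_int m + of_real 0)" for m
      unfolding a_def gauss_term_def times_divide_eq_left exp_add[symmetric]
      by (simp add: \<tau>'_def power2_eq_square diff_divide_distrib add_divide_distrib algebra_simps)
    then show ?thesis
      unfolding norm_mult by (simp only: norm_mult summable_on_cmult_right abs_summable_gauss_term[OF \<tau>'])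
  qed
  define B where "B = gauss_bound \<tau> v 1"
  have B: "B summable_on UNIV"
    unfolding B_def by (rule summable_on_gauss_bound[OF \<tau>])
  have nB: "norm (gauss_term \<tau> v (of_int k + of_real x)) \<le> B k" if "\<bar>x\<bar> \<le> 1" for k x
    unfolding B_def by (rule norm_gauss_term_le[OF \<tau> that])
  have per: "P (x + 1) = P x" "Q (x + 1) = Q x" for x
  proof -
    have "P (x + 1) = (\<Sum>\<^sub>\<infinity>k::int. gauss_term \<tau> v (of_int (k + 1) + of_real x))"
      by (simp add: P_def add_ac)
    also have "\<dots> = P x"
      unfolding P_def by (rule infsum_reindex_bij_witness[of _ "\<lambda>k. k - 1" "\<lambda>k. k + 1"]) auto
    finally show "P (x + 1) = P x" .
    show "Q (x + 1) = Q x"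
      unfolding Q_def using exp_2pi_int[of _ 1] by (simp add: distrib_left exp_add)
  qed
  have contQ: "continuous_on UNIV Q"
    unfolding Q_def
    by (rule continuous_on_infsum_int[OF _ _ sa]) (auto intro!: continuous_intros simp: norm_mult norm_exp_eq_Re)
  have cont_g: "continuous_on A (\<lambda>x. gauss_term \<tau> v (of_int k + complex_of_real x))" for A k
    unfolding gauss_term_def by (intro continuous_intros)
  have contP: "continuous_on UNIV P"
  proof -
    have "isCont P x" for x
    proof -
      have "continuous_on {x - 1<..<x + 1} P"
        unfolding P_def
      proof (rule continuous_on_infsum_int[OF cont_g])
        fix k y assume "y \<in> {x - 1<..<x + 1}"
        then have "\<bar>y\<bar> \<le> \<bar>x\<bar> + 1"
          by auto
        then show "norm (gauss_term \<tau> v (of_int k + of_real y)) \<le> gauss_bound \<tau> v (\<bar>x\<bar> + 1) k"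
          by (rule norm_gauss_term_le[OF \<tau>])
      qed (rule summable_on_gauss_bound[OF \<tau>])
      then show ?thesis
        by (rule continuous_on_interior) simp
    qed
    then show ?thesis
      by (simp add: continuous_on_eq_continuous_at)
  qed
  have "P x - Q x = 0"
  proof (rule zero_if_fourier_coeffs_zero[where h = "\<lambda>x. P x - Q x"])
    show "continuous_on UNIV (\<lambda>x. P x - Q x)"
      by (intro continuous_intros contP contQ)
    show "P (x + 1) - Q (x + 1) = P x - Q x" for x
      by (simp add: per)
    fix m :: int
    let ?e = "\<lambda>x. exp (- (2 * pi * \<i> * of_int m * complex_of_real x))"
    have ee: "?e (of_int k + x) = ?e x" for x k
    proof -
      have "?e (of_int k + x) = exp (2 * pi * \<i> * of_int (- m) * of_int k) * ?e x"
        unfolding exp_add[symmetric] by (rule arg_cong[of _ _ exp]) (simp add: algebra_simps)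
      then show ?thesis
        by (simp only: exp_2pi_int mult_1)
    qed
    define g where "g = (\<lambda>t. gauss_term \<tau> v (of_real t) * ?e t)"
    have "integral {0..1} (\<lambda>x. (\<Sum>\<^sub>\<infinity>k. g (of_int k + x))) = (LINT x|lborel. g x)"
    proof (rule fourier_coeff_periodization[OF _ _ _ B])
      show "continuous_on UNIV g"
        unfolding g_def gauss_term_def by (intro continuous_intros)
      show "integrable lborel g"
        unfolding g_def using fourier_gauss_term(1)[OF \<tau>, of v "of_int m"] by simp
      show "norm (g (of_int k + x)) \<le> B k" if "x \<in> {0..1}" for k x
        using nB[of x k] that by (simp add: g_def norm_mult norm_exp_eq_Re)
    qed
    also have "\<dots> = a m"
      unfolding g_def a_def using fourier_gauss_term(2)[OF \<tau>, of v "of_int m"] by simp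
    also have "(\<lambda>x. (\<Sum>\<^sub>\<infinity>k. g (of_int k + x))) = (\<lambda>x. P x * ?e x)"
      unfolding g_def ee P_def
      by (subst infsum_cmult_left[symmetric]) (auto intro!: abs_summable_summable abs_summable_gauss_term \<tau>)
    finally have 1: "integral {0..1} (\<lambda>x. P x * ?e x) = a m" .
    have "Q x * ?e x = (\<Sum>\<^sub>\<infinity>j. a (j + m) * exp (2 * pi * \<i> * of_int j * of_real x))" for x
    proof -
      have "Q x * ?e x = (\<Sum>\<^sub>\<infinity>j. a j * exp (2 * pi * \<i> * of_int j * of_real x) * ?e x)"
        unfolding Q_def
      proof (rule infsum_cmult_left[symmetric])
        have "(\<lambda>j. norm (a j * exp (2 * pi * \<i> * of_int j * complex_of_real x))) summable_on UNIV"
          using sa by (simp add: norm_mult norm_exp_eq_Re)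
        then show "(\<lambda>j. a j * exp (2 * pi * \<i> * of_int j * complex_of_real x)) summable_on UNIV"
          by (rule abs_summable_summable)
      qed
      also have "\<dots> = (\<Sum>\<^sub>\<infinity>j. a (j + m) * exp (2 * pi * \<i> * of_int j * of_real x))"
        by (rule infsum_reindex_bij_witness[of _ "\<lambda>j. j + m" "\<lambda>j. j - m"])
          (auto simp: mult.assoc exp_add[symmetric] algebra_simps)
      finally show ?thesis .
    qed
    moreover have "(\<lambda>j. norm (a (j + m))) summable_on UNIV"
    proof -
      have "bij (\<lambda>j. j + m)"
        by (rule bij_betwI[where g = "\<lambda>j. j - m"]) auto
      from summable_on_reindex_bij_betw[OF this, of "\<lambda>j. norm (a j)"] show ?thesis
        using sa by simp
    qed
    ultimately have 2: "integral {0..1} (\<lambda>x. Q x * ?e x) = a m"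
      using fourier_coeff_trig_series[of "\<lambda>j. a (j + m)"] by simp
    have "(\<lambda>x. P x * ?e x) integrable_on {0..1}" "(\<lambda>x. Q x * ?e x) integrable_on {0..1}"
      by (intro integrable_continuous_interval continuous_intros continuous_on_subset[OF contP]
          continuous_on_subset[OF contQ]; simp)+
    then show "integral {0..1} (\<lambda>x. (P x - Q x) * ?e x) = 0"
      using 1 2 by (simp add: left_diff_distrib integral_diff)
  qed
  moreover have "Q x = (\<Sum>\<^sub>\<infinity>m::int. exp (- pi * \<i> * (of_int m - v)\<^sup>2 / \<tau> + 2 * pi * \<i> * of_int m * of_real x)) / csqrt (- \<i> * \<tau>)"
    unfolding Q_def a_def exp_add divide_inverse infsum_cmult_left'[symmetric]
    by (simp add: mult_ac)
  ultimately show ?thesis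
    by (simp add: P_def)
qed

section \<open>The Dedekind eta function at -1/tau\<close>

text \<open>
  Written as a sum to avoid the division in \<open>s (s + 1) / 2\<close>.
\<close>

definition triangular :: "nat \<Rightarrow> nat" where
  "triangular s = (\<Sum>i\<le>s. i)"

lemma triangular_Suc [simp]: "triangular (Suc s) = triangular s + Suc s" and triangular_0 [simp]: "triangular 0 = 0"
  by (simp_all add: triangular_def)

text \<open>
  Shanks' finite form of the pentagonal number theorem; its exponents
  \<open>(k + 1)\<^sup>2 + triangular k\<close> and \<open>(k + 1)\<^sup>2 + triangular (k + 1)\<close> are the pentagonal numbers of
  index \<open>k + 1\<close> and \<open>- (k + 1)\<close>. When \<open>n\<close> grows by one, each summand splits into \<open>A s * x ^ s - B s\<close>,
  and \<open>A (s + 1) * x ^ (s + 1) - A (s + 1) = B s\<close>, so that the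
  terms \<open>B\<close> cancel except for the last one.
\<close>

lemma shanks_identity:
  fixes x :: complex
  shows "(\<Sum>s\<le>n. (-1) ^ s * (\<Prod>j\<in>{s<..n}. 1 - x ^ j) * x ^ (s * n + triangular s))
       = 1 + (\<Sum>k<n. (-1) ^ Suc k * (x ^ ((Suc k)\<^sup>2 + triangular k) + x ^ ((Suc k)\<^sup>2 + triangular (Suc k))))"
proof (induction n)
  case 0
  then show ?case
    by simp
next
  case (Suc m)
  define T where "T = (\<lambda>s. \<Prod>j\<in>{s<..m}. 1 - x ^ j)"
  define A where "A = (\<lambda>s. (-1) ^ s * T s * x ^ (s * m + triangular s))"
  define B where "B = (\<lambda>s. (-1) ^ s * T s * x ^ (Suc s * Suc m + triangular s))"
  have T: "T s = (1 - x ^ Suc s) * T (Suc s)" if "s < m" for s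
  proof -
    have "{s<..m} = insert (Suc s) {Suc s<..m}"
      using that by auto
    then show ?thesis
      by (simp add: T_def)
  qed
  have step: "A (Suc s) * x ^ Suc s - A (Suc s) = B s" if "s < m" for s
  proof -
    have "Suc s * Suc m + triangular s = Suc s * m + triangular (Suc s)"
      by simp
    then have "B s = (-1) ^ s * T s * x ^ (Suc s * m + triangular (Suc s))"
      by (simp only: B_def)
    then show ?thesis
      by (simp add: A_def T[OF that] algebra_simps)
  qed
  have "(\<Sum>s\<le>m. A s * x ^ s - A s) = (\<Sum>s<m. B s)"
  proof (cases m)
    case (Suc l)
    then show ?thesis
      using step by (simp add: sum.atMost_Suc_shift lessThan_Suc_atMost del: sum.atMost_Suc power_Suc)
  qed simp
  then have tele: "(\<Sum>s\<le>m. A s * x ^ s - B s) = (\<Sum>s\<le>m. A s) - B m"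
    by (simp add: sum_subtractf lessThan_Suc_atMost[symmetric] algebra_simps)
  have "(\<Sum>s\<le>Suc m. (-1) ^ s * (\<Prod>j\<in>{s<..Suc m}. 1 - x ^ j) * x ^ (s * Suc m + triangular s))
      = (\<Sum>s\<le>m. A s * x ^ s - B s) + (-1) ^ Suc m * x ^ (Suc m * Suc m + triangular (Suc m))"
  proof -
    have "(-1) ^ s * (\<Prod>j\<in>{s<..Suc m}. 1 - x ^ j) * x ^ (s * Suc m + triangular s) = A s * x ^ s - B s"
      if "s \<le> m" for s
    proof -
      have "{s<..Suc m} = insert (Suc m) {s<..m}"
        using that by auto
      then have P: "(\<Prod>j\<in>{s<..Suc m}. 1 - x ^ j) = (1 - x ^ Suc m) * T s"
        by (simp add: T_def)
      show ?thesis
        unfolding P A_def B_def by (simp add: power_add algebra_simps)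
    qed
    then show ?thesis
      by simp
  qed
  also have "\<dots> = (\<Sum>s\<le>m. A s) - B m + (-1) ^ Suc m * x ^ (Suc m * Suc m + triangular (Suc m))"
    by (simp add: tele)
  also have "(\<Sum>s\<le>m. A s) = 1 + (\<Sum>k<m. (-1) ^ Suc k * (x ^ ((Suc k)\<^sup>2 + triangular k) + x ^ ((Suc k)\<^sup>2 + triangular (Suc k))))"
    using Suc.IH by (simp add: A_def T_def)
  also have "B m = (-1) ^ m * x ^ (Suc m * Suc m + triangular m)"
    by (simp add: B_def T_def)
  finally show ?case
    by (simp add: power2_eq_square algebra_simps)
qed

text \<open>
  The summand \<open>s = 0\<close> is the partial product, and all others carry a factor \<open>x ^ n\<close>.
\<close>

lemma euler_product_limit:
  fixes x :: complex
  assumes x: "norm x < 1"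
  shows "(\<lambda>n. \<Sum>s\<le>n. (-1) ^ s * (\<Prod>j\<in>{s<..n}. 1 - x ^ j) * x ^ (s * n + triangular s))
     \<longlonglongrightarrow> (\<Prod>k. 1 - x ^ Suc k)"
proof -
  let ?t = "\<lambda>n s. (-1) ^ s * (\<Prod>j\<in>{s<..n}. 1 - x ^ j) * x ^ (s * n + triangular s)"
  define r where "r = norm x"
  have r: "0 \<le> r" "r < 1"
    using x by (auto simp: r_def)
  define C where "C = exp (1 / (1 - r))"
  have T: "norm (\<Prod>j\<in>{s<..n}. 1 - x ^ j) \<le> C" for s n
  proof -
    have "norm (\<Prod>j\<in>{s<..n}. 1 - x ^ j) \<le> (\<Prod>j\<in>{s<..n}. exp (r ^ j))"
      unfolding prod_norm[symmetric]
    proof (intro prod_mono conjI)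
      fix j
      have "norm (1 - x ^ j) \<le> 1 + r ^ j"
        using norm_triangle_ineq4[of 1 "x ^ j"] by (simp add: r_def norm_power)
      also have "\<dots> \<le> exp (r ^ j)"
        by (rule exp_ge_add_one_self)
      finally show "norm (1 - x ^ j) \<le> exp (r ^ j)" .
    qed simp
    also have "\<dots> = exp (\<Sum>j\<in>{s<..n}. r ^ j)"
      by (simp add: exp_sum)
    also have "(\<Sum>j\<in>{s<..n}. r ^ j) \<le> (\<Sum>j. r ^ j)"
      using r by (intro sum_le_suminf summable_geometric) auto
    also have "(\<Sum>j. r ^ j) = 1 / (1 - r)"
      using r by (intro suminf_geometric) auto
    finally show ?thesis
      by (simp add: C_def)
  qed
  have le_tri: "s \<le> triangular s" for s
    by (induction s) auto
  have rest: "(\<lambda>n. \<Sum>s = 1..n. ?t n s) \<longlonglongrightarrow> 0"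
  proof (rule Lim_null_comparison)
    show "\<forall>\<^sub>F n in sequentially. norm (\<Sum>s = 1..n. ?t n s)
        \<le> C * r ^ n * (1 / (1 - r))"
    proof (rule always_eventually, rule allI)
      fix n
      have "norm (\<Sum>s = 1..n. ?t n s)
        \<le> (\<Sum>s = 1..n. C * r ^ n * r ^ s)"
      proof (rule sum_norm_le)
        fix s assume s: "s \<in> {1..n}"
        have "r ^ (s * n + triangular s) \<le> r ^ (n + s)"
          using r s le_tri[of s] by (intro power_decreasing add_mono) auto
        then have "norm (\<Prod>j\<in>{s<..n}. 1 - x ^ j) * r ^ (s * n + triangular s) \<le> C * r ^ (n + s)"
          using r T[of s n] by (intro mult_mono) (auto simp: C_def)
        then show "norm (?t n s) \<le> C * r ^ n * r ^ s"
          by (simp add: norm_mult norm_power r_def power_add mult_ac)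
      qed
      also have "\<dots> = C * r ^ n * (\<Sum>s = 1..n. r ^ s)"
        by (simp add: sum_distrib_left)
      also have "(\<Sum>s = 1..n. r ^ s) \<le> (\<Sum>j. r ^ j)"
        using r by (intro sum_le_suminf summable_geometric) auto
      then have "C * r ^ n * (\<Sum>s = 1..n. r ^ s) \<le> C * r ^ n * (1 / (1 - r))"
        using r suminf_geometric[of r] by (intro mult_left_mono) (auto simp: C_def)
      finally show "norm (\<Sum>s = 1..n. ?t n s)
        \<le> C * r ^ n * (1 / (1 - r))" .
    qed
    have "(\<lambda>n. C * r ^ n * (1 / (1 - r))) \<longlonglongrightarrow> C * 0 * (1 / (1 - r))"
      using r by (intro tendsto_intros LIMSEQ_realpow_zero) auto
    then show "(\<lambda>n. C * r ^ n * (1 / (1 - r))) \<longlonglongrightarrow> 0"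
      by simp
  qed
  have "summable (\<lambda>k. norm (- (x ^ Suc k)))"
    using r summable_geometric[of r] by (subst summable_Suc_iff) (simp add: norm_power r_def)
  then have "convergent_prod (\<lambda>k. 1 + (- (x ^ Suc k)))"
    by (intro abs_convergent_prod_imp_convergent_prod summable_imp_abs_convergent_prod)
      (simp only: add_diff_cancel_left')
  then have "(\<lambda>n. \<Prod>k\<le>n. 1 - x ^ Suc k) \<longlonglongrightarrow> (\<Prod>k. 1 - x ^ Suc k)"
    by (intro convergent_prod_LIMSEQ) simp
  then have lim: "(\<lambda>n. \<Prod>k<n. 1 - x ^ Suc k) \<longlonglongrightarrow> (\<Prod>k. 1 - x ^ Suc k)"
    unfolding lessThan_Suc_atMost[symmetric] by (rule LIMSEQ_imp_Suc)
  have "(\<Sum>s\<le>n. ?t n s)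
     = (\<Prod>k<n. 1 - x ^ Suc k) + (\<Sum>s = 1..n. ?t n s)" for n
  proof -
    have "{..n} = insert 0 {1..n}"
      by auto
    moreover have "(\<Prod>j\<in>{0<..n}. 1 - x ^ j) = (\<Prod>k<n. 1 - x ^ Suc k)"
      by (rule prod.reindex_bij_witness[of _ Suc "\<lambda>j. j - 1"]) auto
    ultimately show ?thesis
      by simp
  qed
  then show ?thesis
    using tendsto_add[OF lim rest] by simp
qed

text \<open>
  Euler's pentagonal number theorem, with the square completed: \<open>k (3 k + 1) / 2 + 1 / 24\<close> is
  \<open>3 / 2 * (k + 1 / 6)\<^sup>2\<close>, which exhibits \<open>\<eta>\<close> as a theta series.
\<close>

lemma dedekind_eta_eq_theta:
  assumes \<tau>: "Im \<tau> > 0"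
  shows "dedekind_eta \<tau> = exp (- pi * \<i> / 6) * (\<Sum>\<^sub>\<infinity>k::int. gauss_term (3 * \<tau>) (1 / 2) (of_int k + 1 / 6))"
proof -
  define x where "x = exp (2 * pi * \<i> * \<tau>)"
  have x: "norm x < 1"
    using \<tau> by (simp add: x_def norm_exp_eq_Re)
  have pow: "nome_pow \<tau> (of_nat n) = x ^ n" for n
    by (simp add: nome_pow_def x_def exp_of_nat_mult[symmetric] mult_ac)
  have x_pow: "x ^ n = exp (2 * pi * \<i> * \<tau> * of_nat n)" for n
    by (simp add: x_def exp_of_nat_mult[symmetric] mult_ac)
  define f where "f = (\<lambda>k::int. exp (- pi * \<i> / 6) * nome_pow \<tau> (- 1 / 24) * gauss_term (3 * \<tau>) (1 / 2) (of_int k + 1 / 6))"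
  have f_eq: "f k = exp (pi * \<i> * of_int k) * exp (2 * pi * \<i> * \<tau> * ((3 * (of_int k)\<^sup>2 + of_int k) / 2))" for k
    unfolding f_def nome_pow_def gauss_term_def exp_add[symmetric]
    by (rule arg_cong[of _ _ exp]) (simp add: field_simps power2_eq_square)
  have tri: "2 * complex_of_nat (triangular k) = of_nat k * (of_nat k + 1)" for k
    by (induction k) (auto simp: algebra_simps)
  have m1: "exp (pi * \<i> * of_nat k) = (-1) ^ k" for k
    using exp_of_nat_mult[of k "pi * \<i>"] by (simp add: mult_ac)
  have fpos: "f (int (Suc k)) = (-1) ^ Suc k * x ^ ((Suc k)\<^sup>2 + triangular (Suc k))" for k
  proof -
    have "(3 * (of_int (int (Suc k)))\<^sup>2 + of_int (int (Suc k))) / 2 = complex_of_nat ((Suc k)\<^sup>2 + triangular (Suc k))"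
      unfolding of_nat_add of_nat_power of_int_of_nat_eq using tri[of "Suc k"]
      by (simp add: power2_eq_square field_simps del: triangular_Suc of_nat_Suc)
    then have "exp (2 * pi * \<i> * \<tau> * ((3 * (of_int (int (Suc k)))\<^sup>2 + of_int (int (Suc k))) / 2)) = x ^ ((Suc k)\<^sup>2 + triangular (Suc k))"
      by (simp only: x_pow)
    then show ?thesis
      using m1[of "Suc k"] by (simp add: f_eq del: triangular_Suc of_nat_Suc)
  qed
  have fneg: "f (- int (Suc k)) = (-1) ^ Suc k * x ^ ((Suc k)\<^sup>2 + triangular k)" for k
  proof -
    have "(3 * (of_int (- int (Suc k)))\<^sup>2 + of_int (- int (Suc k))) / 2 = complex_of_nat ((Suc k)\<^sup>2 + triangular k)"
      unfolding of_nat_add of_nat_power of_int_of_nat_eq of_int_minus using tri[of k]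
      by (simp add: power2_eq_square field_simps)
    then have "exp (2 * pi * \<i> * \<tau> * ((3 * (of_int (- int (Suc k)))\<^sup>2 + of_int (- int (Suc k))) / 2)) = x ^ ((Suc k)\<^sup>2 + triangular k)"
      by (simp only: x_pow)
    moreover have "exp (pi * \<i> * of_int (- int (Suc k))) = (-1) ^ Suc k"
    proof -
      have "exp (pi * \<i> * of_int (- int (Suc k))) = inverse (exp (pi * \<i> * of_nat (Suc k)))"
        by (simp add: exp_minus[symmetric] del: of_nat_Suc)
      then show ?thesis
        unfolding m1 by (simp add: power_inverse[symmetric] del: power_Suc)
    qed
    ultimately show ?thesis
      by (simp only: f_eq)
  qed
  have part: "(\<Sum>k = - int n..int n. f k) = 1 + (\<Sum>k<n. (-1) ^ Suc k * (x ^ ((Suc k)\<^sup>2 + triangular k) + x ^ ((Suc k)\<^sup>2 + triangular (Suc k))))" for n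
  proof (induction n)
    case 0
    then show ?case
      by (simp add: f_eq)
  next
    case (Suc n)
    have "{- int (Suc n)..int (Suc n)} = insert (int (Suc n)) (insert (- int (Suc n)) {- int n..int n})"
      by auto
    then have "(\<Sum>k = - int (Suc n)..int (Suc n). f k) = f (int (Suc n)) + (f (- int (Suc n)) + (\<Sum>k = - int n..int n. f k))"
      by (simp del: of_nat_Suc)
    then show ?case
      unfolding Suc fpos fneg by (simp add: algebra_simps)
  qed
  have s: "(\<lambda>k::int. norm (gauss_term (3 * \<tau>) (1 / 2) (of_int k + 1 / 6))) summable_on UNIV"
    using abs_summable_gauss_term[of "3 * \<tau>" "1 / 2" "1 / 6"] \<tau> by simp
  have "f summable_on UNIV"
    unfolding f_def by (intro summable_on_cmult_right abs_summable_summable[OF s])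
  then have "(\<lambda>n. \<Sum>k = - int n..int n. f k) \<longlonglongrightarrow> (\<Sum>\<^sub>\<infinity>k. f k)"
    by (intro has_sum_int_symmetric_limit) simp
  moreover have "(\<lambda>n. \<Sum>k = - int n..int n. f k) \<longlonglongrightarrow> (\<Prod>k. 1 - x ^ Suc k)"
    unfolding part shanks_identity[symmetric] by (rule euler_product_limit[OF x])
  ultimately have "(\<Prod>k. 1 - x ^ Suc k) = (\<Sum>\<^sub>\<infinity>k. f k)"
    using LIMSEQ_unique by blast
  also have "\<dots> = exp (- pi * \<i> / 6) * nome_pow \<tau> (- 1 / 24) * (\<Sum>\<^sub>\<infinity>k::int. gauss_term (3 * \<tau>) (1 / 2) (of_int k + 1 / 6))"
    unfolding f_def by (intro infsum_cmult_right abs_summable_summable[OF s])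
  finally have "dedekind_eta \<tau> = nome_pow \<tau> (1 / 24) * nome_pow \<tau> (- 1 / 24)
     * (exp (- pi * \<i> / 6) * (\<Sum>\<^sub>\<infinity>k::int. gauss_term (3 * \<tau>) (1 / 2) (of_int k + 1 / 6)))"
    unfolding dedekind_eta_def pow by simp
  moreover have "nome_pow \<tau> (1 / 24) * nome_pow \<tau> (- 1 / 24) = 1"
    by (simp add: nome_pow_def exp_add[symmetric])
  ultimately show ?thesis
    by simp
qed

text \<open>
  Poisson summation applied to \<open>dedekind_eta_eq_theta\<close> gives a sum over odd integers \<open>l = 2 m - 1\<close>. The
  multiples of \<open>3\<close> among them cancel under \<open>l \<mapsto> - l\<close>, and the remaining ones are \<open>\<plusminus> (6 k + 1)\<close>.
  Each pair contributes \<open>2 cos (\<pi> (6 k + 1) / 6)\<close>, that is \<open>sqrt 3 (-1)\<^sup>k\<close>, and so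
  reproduces the series of \<open>\<eta>(\<tau>)\<close>.
\<close>

theorem dedekind_eta_S:
  assumes \<tau>: "Im \<tau> > 0"
  shows "dedekind_eta (- 1 / \<tau>) = dedekind_eta \<tau> / csqrt (\<i> / \<tau>)"
proof -
  have [simp]: "\<tau> \<noteq> 0"
    using \<tau> by auto
  have \<tau>': "Im (- 1 / \<tau>) > 0"
    by (rule Im_neg_inverse_pos[OF \<tau>])
  moreover have "Im (3 * z) = 3 * Im z" for z
    by simp
  ultimately have \<tau>'3: "Im (3 * (- 1 / \<tau>)) > 0"
    by (simp only: zero_less_mult_iff) simp
  define t where "t = (\<lambda>l::complex. exp (pi * \<i> * \<tau> * l\<^sup>2 / 12))"
  define u where "u = (\<lambda>l::complex. exp (pi * \<i> * l / 6))"
  define F where "F = (\<lambda>m::int. u (2 * of_int m - 1) * t (2 * of_int m - 1))"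
  have csq: "csqrt (- \<i> * (3 * (- 1 / \<tau>))) = of_real (sqrt 3) * csqrt (\<i> / \<tau>)"
    using csqrt_of_real_mult[of 3 "\<i> / \<tau>"] by (simp add: mult_ac)
  have "dedekind_eta (- 1 / \<tau>) = exp (- pi * \<i> / 6) *
     ((\<Sum>\<^sub>\<infinity>m::int. exp (- pi * \<i> * (of_int m - 1 / 2)\<^sup>2 / (3 * (- 1 / \<tau>)) + 2 * pi * \<i> * of_int m * of_real (1 / 6)))
       / (of_real (sqrt 3) * csqrt (\<i> / \<tau>)))"
    using poisson_summation_gauss[OF \<tau>'3, of "1 / 2" "1 / 6"]
    unfolding dedekind_eta_eq_theta[OF \<tau>'] csq by simp
  also have "\<dots> = (\<Sum>\<^sub>\<infinity>m::int. exp (- pi * \<i> / 6) * exp (- pi * \<i> * (of_int m - 1 / 2)\<^sup>2 / (3 * (- 1 / \<tau>)) + 2 * pi * \<i> * of_int m * of_real (1 / 6)))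
       / (of_real (sqrt 3) * csqrt (\<i> / \<tau>))"
    by (simp add: infsum_cmult_right')
  also have "(\<lambda>m::int. exp (- pi * \<i> / 6) * exp (- pi * \<i> * (of_int m - 1 / 2)\<^sup>2 / (3 * (- 1 / \<tau>)) + 2 * pi * \<i> * of_int m * of_real (1 / 6))) = F"
  proof
    fix m :: int
    show "exp (- pi * \<i> / 6) * exp (- pi * \<i> * (of_int m - 1 / 2)\<^sup>2 / (3 * (- 1 / \<tau>)) + 2 * pi * \<i> * of_int m * of_real (1 / 6)) = F m"
      unfolding F_def t_def u_def exp_add[symmetric]
      by (rule arg_cong[of _ _ exp]) (simp add: field_simps power2_eq_square)
  qed
  finally have eta': "dedekind_eta (- 1 / \<tau>) = (\<Sum>\<^sub>\<infinity>m. F m) / (of_real (sqrt 3) * csqrt (\<i> / \<tau>))" .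
  have sF: "(\<lambda>m. norm (F m)) summable_on UNIV"
  proof -
    have "F m = gauss_term (\<tau> / 3) (1 / 6) (of_int m + of_real (- 1 / 2))" for m
      unfolding F_def t_def u_def gauss_term_def exp_add[symmetric]
      by (rule arg_cong[of _ _ exp]) (simp add: field_simps power2_eq_square)
    then show ?thesis
      using abs_summable_gauss_term[of "\<tau> / 3" "1 / 6" "- 1 / 2"] \<tau> by simp
  qed
  define G where "G = (\<lambda>k::int. t (6 * of_int k + 1))"
  have sj: "(\<lambda>k. F (3 * k + j)) summable_on UNIV" for j
    by (rule abs_summable_summable, rule abs_summable_on_int_affine[OF sF]) simp
  have t_minus: "t (- l) = t l" for l
    by (simp add: t_def)
  have Fm: "F (3 * (- k)) = u (- (6 * of_int k + 1)) * G k" for k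
  proof -
    have "2 * complex_of_int (3 * (- k)) - 1 = - (6 * of_int k + 1)"
      by simp
    then show ?thesis
      by (simp only: F_def G_def t_minus)
  qed
  have F0: "(\<Sum>\<^sub>\<infinity>k. F (3 * k)) = (\<Sum>\<^sub>\<infinity>k::int. u (- (6 * of_int k + 1)) * G k)"
    unfolding Fm[symmetric] by (rule infsum_reindex_bij_witness[of _ uminus uminus]) auto
  have F1: "(\<Sum>\<^sub>\<infinity>k. F (3 * k + 1)) = (\<Sum>\<^sub>\<infinity>k::int. u (6 * of_int k + 1) * G k)"
    by (rule infsum_cong) (simp add: F_def G_def algebra_simps)
  have u_minus: "u (- l) = inverse (u l)" for l
    by (simp add: u_def exp_minus[symmetric])
  have u_odd: "u (6 * of_int k + l) = (-1) powi k * u l" for k l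
  proof -
    have "of_real pi * \<i> * (6 * of_int k + l) / 6 = of_real pi * \<i> * of_int k + of_real pi * \<i> * l / 6"
      by (simp add: field_simps)
    then show ?thesis
      by (simp only: u_def exp_add exp_pi_int)
  qed
  have "(\<Sum>\<^sub>\<infinity>k. F (3 * k + 2)) = (\<Sum>\<^sub>\<infinity>k. - F (3 * k + 2))"
  proof (rule infsum_reindex_bij_witness[of _ "\<lambda>k. - 1 - k" "\<lambda>k. - 1 - k"])
    fix k :: int
    have "u (- (6 * of_int k + 3)) = - u (6 * of_int k + 3)"
    proof -
      have u3: "u (6 * of_int k + 3) = (-1) powi k * \<i>"
        unfolding u_odd by (simp add: u_def exp_eq_polar)
      have "u (- (6 * of_int k + 3)) = inverse (u (6 * of_int k + 3))"
        by (rule u_minus)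
      also have "\<dots> = (-1) powi k * (- \<i>)"
        unfolding u3 by (simp add: power_int_inverse[symmetric])
      finally show ?thesis
        by (simp add: u3)
    qed
    moreover have "2 * complex_of_int (3 * (- 1 - k) + 2) - 1 = - (6 * of_int k + 3)"
      "2 * complex_of_int (3 * k + 2) - 1 = 6 * of_int k + 3"
      by simp_all
    ultimately show "- F (3 * (- 1 - k) + 2) = F (3 * k + 2)"
      by (simp only: F_def t_minus mult_minus_left minus_minus)
  qed auto
  then have F2: "(\<Sum>\<^sub>\<infinity>k. F (3 * k + 2)) = 0"
    by (simp add: infsum_uminus)
  have uu: "u (- (6 * of_int k + 1)) + u (6 * of_int k + 1) = of_real (sqrt 3) * exp (pi * \<i> * of_int k)" for k :: int
  proof -
    have u1: "u 1 = Complex (sqrt 3 / 2) (1 / 2)"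
      using cis_conv_exp[of "pi / 6"] by (simp add: u_def cis.ctr cos_30 sin_30 mult_ac)
    have k: "exp (pi * \<i> * of_int k) = (-1) powi k"
      by (rule exp_pi_int)
    have "u (- (6 * of_int k + 1)) = inverse (u (6 * of_int k + 1))"
      by (rule u_minus)
    also have "\<dots> = (-1) powi k * inverse (u 1)"
      unfolding u_odd by (simp add: power_int_inverse[symmetric])
    also have "inverse (u 1) = Complex (sqrt 3 / 2) (- 1 / 2)"
      unfolding u1 by (simp add: complex_eq_iff power2_eq_square)
    finally show ?thesis
      unfolding u_odd k u1 by (simp add: complex_eq_iff distrib_left[symmetric] flip: distrib_left)
  qed
  have "(\<Sum>\<^sub>\<infinity>m. F m) = (\<Sum>j = 0..3 - 1. \<Sum>\<^sub>\<infinity>k. F (3 * k + j))"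
    by (rule infsum_int_residues[OF sF]) simp
  also have "{0..3 - 1} = {0, 1, 2::int}"
    by auto
  also have "(\<Sum>j\<in>{0, 1, 2}. \<Sum>\<^sub>\<infinity>k. F (3 * k + j)) = (\<Sum>\<^sub>\<infinity>k. F (3 * k)) + (\<Sum>\<^sub>\<infinity>k. F (3 * k + 1)) + (\<Sum>\<^sub>\<infinity>k. F (3 * k + 2))"
    by simp
  also have "\<dots> = (\<Sum>\<^sub>\<infinity>k::int. u (- (6 * of_int k + 1)) * G k) + (\<Sum>\<^sub>\<infinity>k::int. u (6 * of_int k + 1) * G k)"
    by (simp add: F0 F1 F2)
  also have "\<dots> = (\<Sum>\<^sub>\<infinity>k::int. u (- (6 * of_int k + 1)) * G k + u (6 * of_int k + 1) * G k)"
  proof (rule infsum_add[symmetric])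
    have "(\<lambda>k. F (3 * (- k))) summable_on UNIV"
      using sj[of 0] summable_on_reindex_bij_witness[of UNIV uminus uminus UNIV "\<lambda>k. F (3 * (- k))" "\<lambda>k. F (3 * k)"] by simp
    then show "(\<lambda>k. u (- (6 * of_int k + 1)) * G k) summable_on UNIV"
      by (simp only: Fm)
    show "(\<lambda>k. u (6 * of_int k + 1) * G k) summable_on UNIV"
      using sj[of 1] by (simp add: F_def G_def algebra_simps)
  qed
  also have "\<dots> = (\<Sum>\<^sub>\<infinity>k::int. of_real (sqrt 3) * (exp (- pi * \<i> / 6) * gauss_term (3 * \<tau>) (1 / 2) (of_int k + 1 / 6)))"
  proof (rule infsum_cong)
    fix k :: int
    have "exp (- pi * \<i> / 6) * gauss_term (3 * \<tau>) (1 / 2) (of_int k + 1 / 6) = exp (pi * \<i> * of_int k) * G k"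
      unfolding G_def t_def gauss_term_def exp_add[symmetric]
      by (rule arg_cong[of _ _ exp]) (simp add: field_simps power2_eq_square)
    then show "u (- (6 * of_int k + 1)) * G k + u (6 * of_int k + 1) * G k
      = of_real (sqrt 3) * (exp (- pi * \<i> / 6) * gauss_term (3 * \<tau>) (1 / 2) (of_int k + 1 / 6))"
      using uu[of k] by (simp add: distrib_right[symmetric])
  qed
  also have "\<dots> = of_real (sqrt 3) * dedekind_eta \<tau>"
    unfolding dedekind_eta_eq_theta[OF \<tau>] by (simp add: infsum_cmult_right')
  finally show ?thesis
    unfolding eta' by simp
qed

section \<open>Theta series of the momentum lattice\<close>

text \<open>
  The regularised Fock character of momentum \<open>M / alpha p q\<close>.
\<close>

definition lattice_fock :: "int \<Rightarrow> int \<Rightarrow> complex \<Rightarrow> complex \<Rightarrow> int \<Rightarrow> complex" where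
  "lattice_fock p q \<epsilon> \<tau> M = exp (2 * of_real pi * \<epsilon> * of_int M / of_real (alpha p q))
     * nome_pow \<tau> ((of_int M)\<^sup>2 / (4 * of_int p * of_int q)) / dedekind_eta \<tau>"

definition lattice_theta :: "int \<Rightarrow> int \<Rightarrow> complex \<Rightarrow> complex \<Rightarrow> int \<Rightarrow> complex" where
  "lattice_theta p q \<epsilon> \<tau> l = (\<Sum>\<^sub>\<infinity>k. lattice_fock p q \<epsilon> \<tau> (2 * p * q * k + l))"

lemma alpha_pos: "p \<ge> 1 \<Longrightarrow> q \<ge> 1 \<Longrightarrow> alpha p q > 0"
  by (simp add: alpha_def)

lemma alpha_squared: "p \<ge> 1 \<Longrightarrow> q \<ge> 1 \<Longrightarrow> (complex_of_real (alpha p q))\<^sup>2 = 2 * of_int p * of_int q"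
  by (simp add: alpha_def flip: of_real_power)

text \<open>
  Both \<open>\<alpha>\<^sub>+\<close> and \<open>- \<alpha>\<^sub>-\<close> are \<open>alpha p q\<close> divided by \<open>p\<close> and \<open>q\<close> respectively, so all momenta lie
  in the lattice generated by \<open>1 / alpha p q\<close>.
\<close>

lemma alpha_weight_eq:
  assumes "p \<ge> 1" "q \<ge> 1"
  shows "alpha_weight p q r s n - alpha_zero p q / 2 = of_int (n * p * q - r * q + s * p) / alpha p q"
proof -
  have a2: "alpha p q * alpha p q = 2 * of_int p * of_int q"
    using assms by (simp add: alpha_def)
  have ap: "alpha_plus p q = alpha p q / of_int p"
  proof (unfold alpha_plus_def, rule real_sqrt_unique)
    show "(alpha p q / of_int p)\<^sup>2 = 2 * of_int q / of_int p"
      using assms by (simp add: power2_eq_square a2)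
    show "0 \<le> alpha p q / of_int p"
      using assms alpha_pos[of p q] by simp
  qed
  have am: "alpha_minus p q = - (alpha p q / of_int q)"
  proof -
    have "sqrt (2 * of_int p / of_int q) = alpha p q / of_int q"
    proof (rule real_sqrt_unique)
      show "(alpha p q / of_int q)\<^sup>2 = 2 * of_int p / of_int q"
        using assms by (simp add: power2_eq_square a2)
      show "0 \<le> alpha p q / of_int q"
        using assms alpha_pos[of p q] by simp
    qed
    then show ?thesis
      by (simp add: alpha_minus_def)
  qed
  have nz: "alpha p q \<noteq> 0" "real_of_int p \<noteq> 0" "real_of_int q \<noteq> 0"
    using alpha_pos[OF assms] assms by auto
  have "alpha_weight p q r s n - alpha_zero p q / 2
      = alpha p q * (of_int n - of_int r / of_int p + of_int s / of_int q) / 2"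
    unfolding alpha_weight_def alpha_zero_def ap am using nz by (simp add: field_simps)
  also have "\<dots> = (alpha p q * alpha p q) * (of_int n - of_int r / of_int p + of_int s / of_int q) / (2 * alpha p q)"
    using nz by simp
  also have "\<dots> = of_int (n * p * q - r * q + s * p) / alpha p q"
    unfolding a2 using nz assms by (simp add: field_simps)
  finally show ?thesis .
qed

lemma ch_F_eq_lattice_fock:
  assumes "p \<ge> 1" "q \<ge> 1"
  shows "ch_F p q \<epsilon> r s n \<tau> = lattice_fock p q \<epsilon> \<tau> (n * p * q - r * q + s * p)"
proof -
  define M where "M = n * p * q - r * q + s * p"
  have "complex_of_real (alpha_weight p q r s n) - of_real (alpha_zero p q) / 2
      = of_real (alpha_weight p q r s n - alpha_zero p q / 2)"
    by simp
  also have "\<dots> = of_int M / of_real (alpha p q)"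
    unfolding alpha_weight_eq[OF assms] M_def by simp
  finally have w: "complex_of_real (alpha_weight p q r s n) - of_real (alpha_zero p q) / 2
      = of_int M / of_real (alpha p q)" .
  have sq: "(of_int M / complex_of_real (alpha p q))\<^sup>2 / 2 = (of_int M)\<^sup>2 / (4 * of_int p * of_int q)"
    unfolding power_divide alpha_squared[OF assms] by simp
  show ?thesis
    unfolding ch_F_def ch_Fock_def w sq lattice_fock_def M_def[symmetric] by simp
qed

lemma lattice_fock_eq_gauss_term:
  assumes "p \<ge> 1" "q \<ge> 1"
  shows "lattice_fock p q \<epsilon> \<tau> M = gauss_term (\<tau> / (2 * of_int p * of_int q)) (- \<i> * \<epsilon> / of_real (alpha p q)) (of_int M + of_real 0) / dedekind_eta \<tau>"
  unfolding lattice_fock_def nome_pow_def gauss_term_def exp_add[symmetric]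
  by (intro arg_cong[of _ _ "\<lambda>z. exp z / dedekind_eta \<tau>"]) (use assms in \<open>simp add: field_simps\<close>)

lemma abs_summable_lattice_fock:
  assumes "p \<ge> 1" "q \<ge> 1" "Im \<tau> > 0"
  shows "(\<lambda>M. norm (lattice_fock p q \<epsilon> \<tau> M)) summable_on UNIV"
proof -
  have "Im (\<tau> / (2 * of_int p * of_int q)) = Im \<tau> / (2 * of_int p * of_int q)"
    by (metis Im_divide_of_real of_real_mult of_real_numeral of_real_of_int_eq)
  then have "Im (\<tau> / (2 * of_int p * of_int q)) > 0"
    using assms by simp
  note s = summable_on_cmult_left[OF abs_summable_gauss_term[OF this], of _ _ "inverse (norm (dedekind_eta \<tau>))"]
  have "norm (lattice_fock p q \<epsilon> \<tau> M) = norm (gauss_term (\<tau> / (2 * of_int p * of_int q))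
      (- \<i> * \<epsilon> / of_real (alpha p q)) (of_int M + of_real 0)) * inverse (norm (dedekind_eta \<tau>))" for M
    unfolding lattice_fock_eq_gauss_term[OF assms(1,2)] norm_divide by (rule divide_inverse)
  then show ?thesis
    using s by (simp only:)
qed

lemma abs_summable_lattice_theta:
  assumes "p \<ge> 1" "q \<ge> 1" "Im \<tau> > 0"
  shows "(\<lambda>k. norm (lattice_fock p q \<epsilon> \<tau> (2 * p * q * k + l))) summable_on UNIV"
  by (rule abs_summable_on_int_affine[OF abs_summable_lattice_fock[OF assms]]) (use assms in auto)

lemma lattice_theta_periodic: "lattice_theta p q \<epsilon> \<tau> (2 * p * q * j + l) = lattice_theta p q \<epsilon> \<tau> l"
  unfolding lattice_theta_def
  by (rule infsum_reindex_bij_witness[of _ "\<lambda>k. k - j" "\<lambda>k. k + j"]) (auto simp: algebra_simps)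

lemma lattice_theta_0_uminus: "lattice_theta p q 0 \<tau> (- l) = lattice_theta p q 0 \<tau> l"
  unfolding lattice_theta_def
proof (rule infsum_reindex_bij_witness[of _ uminus uminus])
  fix k :: int
  have "(complex_of_int (2 * p * q * - k + l))\<^sup>2 = (of_int (2 * p * q * k + - l))\<^sup>2"
    by (simp add: power2_eq_square algebra_simps)
  then show "lattice_fock p q 0 \<tau> (2 * p * q * - k + l) = lattice_fock p q 0 \<tau> (2 * p * q * k + - l)"
    by (simp only: lattice_fock_def mult_zero_right mult_zero_left div_0)
qed auto

text \<open>
  Completing the square absorbs the prefactor of \<open>E_theta\<close>: it is the theta series of the coset \<open>m\<close>
  shifted by \<open>\<i> a \<epsilon>\<close>, the form in which Poisson summation produces it.
\<close>

lemma E_theta_eq: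
  assumes "p \<ge> 1" "q \<ge> 1"
  shows "E_theta p q m \<epsilon> \<tau> = (\<Sum>\<^sub>\<infinity>k. exp (of_real pi * \<i> * \<tau> *
      (of_int (2 * p * q * k + m) + \<i> * of_real (alpha p q) * \<epsilon>)\<^sup>2 / (2 * of_int p * of_int q))) / dedekind_eta \<tau>"
proof -
  let ?a = "complex_of_real (alpha p q)"
  have a2: "?a * ?a = 2 * of_int p * of_int q"
    using alpha_squared[OF assms] by (simp add: power2_eq_square)
  have nz: "complex_of_int p \<noteq> 0" "complex_of_int q \<noteq> 0"
    using assms by auto
  have "nome_pow \<tau> (- \<epsilon>\<^sup>2 / 2) * (exp (2 * of_real pi * \<i> * (\<i> * ?a * \<epsilon> * \<tau>) * (of_int k + of_int m / (2 * of_int (p * q)))) *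
     nome_pow \<tau> (of_int (p * q) * (of_int k + of_int m / (2 * of_int (p * q)))\<^sup>2))
    = exp (of_real pi * \<i> * \<tau> *
      (of_int (2 * p * q * k + m) + \<i> * ?a * \<epsilon>)\<^sup>2 / (2 * of_int p * of_int q))" for k
  proof -
    define M where "M = complex_of_int (2 * p * q * k + m)"
    define N where "N = complex_of_int (2 * p * q)"
    have N0: "N \<noteq> 0"
      using nz by (simp add: N_def)
    have 1: "complex_of_int k + of_int m / (2 * of_int (p * q)) = M / N"
      using nz by (simp add: M_def N_def field_simps)
    have 2: "complex_of_int (p * q) = N / 2" and 3: "2 * complex_of_int p * of_int q = N"
      by (simp_all add: N_def)
    have a2N: "?a * ?a = N"
      by (simp add: a2 3)
    have sq: "(M + \<i> * ?a * \<epsilon>)\<^sup>2 = M\<^sup>2 + 2 * \<i> * ?a * \<epsilon> * M - N * \<epsilon>\<^sup>2"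
    proof -
      have "(M + \<i> * ?a * \<epsilon>)\<^sup>2 = M\<^sup>2 + 2 * \<i> * ?a * \<epsilon> * M - (?a * ?a) * \<epsilon>\<^sup>2"
        by (simp add: power2_eq_square algebra_simps)
      then show ?thesis
        by (simp only: a2N)
    qed
    show ?thesis
      unfolding 1 unfolding 2 3 M_def[symmetric] nome_pow_def exp_add[symmetric] sq
      using N0 by (intro arg_cong[of _ _ exp]) (simp add: field_simps power2_eq_square)
  qed
  then show ?thesis
    unfolding E_theta_def theta_def infsum_cmult_right'[symmetric] by simp
qed

lemma E_theta_0:
  assumes "p \<ge> 1" "q \<ge> 1"
  shows "E_theta p q m 0 \<tau> = lattice_theta p q 0 \<tau> m"
proof -
  have "exp (of_real pi * \<i> * \<tau> * (of_int M + \<i> * of_real (alpha p q) * 0)\<^sup>2 / (2 * of_int p * of_int q)) * inverse (dedekind_eta \<tau>)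
      = lattice_fock p q 0 \<tau> M" for M
    unfolding lattice_fock_def nome_pow_def divide_inverse[of _ "dedekind_eta \<tau>"] exp_add[symmetric]
    by (intro arg_cong[of _ _ "\<lambda>z. exp z * inverse (dedekind_eta \<tau>)"]) (use assms in \<open>simp add: field_simps\<close>)
  then show ?thesis
    unfolding E_theta_eq[OF assms] lattice_theta_def divide_inverse[of _ "dedekind_eta \<tau>"] infsum_cmult_left'[symmetric]
    by (simp only:)
qed

lemma exp_phase_periodic:
  assumes "p \<ge> 1" "q \<ge> 1"
  shows "exp (of_real pi * \<i> * of_int (2 * p * q * k + m) * of_int l / (of_int p * of_int q))
    = exp (of_real pi * \<i> * of_int m * of_int l / (of_int p * of_int q))"
proof -
  have "of_real pi * \<i> * of_int (2 * p * q * k + m) * of_int l / (of_int p * of_int q)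
    = of_real (2 * pi) * \<i> * of_int k * of_int l + of_real pi * \<i> * of_int m * of_int l / (of_int p * of_int q)"
    using assms by (simp add: field_simps)
  then show ?thesis
    using exp_2pi_int[of k l] by (simp add: exp_add)
qed

text \<open>
  Poisson summation with parameter \<open>- 2 p q / \<tau>\<close>, followed by a decomposition of the dual sum
  into residues modulo \<open>2 p q\<close>. The square roots from Poisson summation and from \<open>\<eta>\<close> combine to
  \<open>1 / alpha p q\<close>.
\<close>

theorem lattice_theta_S:
  assumes pq: "p \<ge> 1" "q \<ge> 1" and \<tau>: "Im \<tau> > 0"
  shows "lattice_theta p q \<epsilon> (- 1 / \<tau>) l = (\<Sum>m = 0..2 * p * q - 1.
     exp (of_real pi * \<i> * of_int m * of_int l / (of_int p * of_int q)) * E_theta p q m \<epsilon> \<tau>) / of_real (alpha p q)"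
proof -
  let ?a = "complex_of_real (alpha p q)"
  define N where "N = complex_of_int (2 * p * q)"
  have a2: "?a * ?a = N"
    using alpha_squared[OF pq] by (simp add: power2_eq_square N_def)
  have N0: "N \<noteq> 0" and a0: "?a \<noteq> 0" and t0: "\<tau> \<noteq> 0"
    using pq alpha_pos[OF pq] \<tau> by (auto simp: N_def)
  have pos: "2 * p * q > 0"
    using pq by simp
  define \<tau>' where "\<tau>' = - N / \<tau>"
  have \<tau>'_eq: "\<tau>' = of_real (2 * of_int p * of_int q) * (- 1 / \<tau>)"
    by (simp add: \<tau>'_def N_def)
  have "Im (- 1 / \<tau>) > 0"
    by (rule Im_neg_inverse_pos[OF \<tau>])
  then have \<tau>': "Im \<tau>' > 0"
  proof -
    have "Im (of_real c * z) = c * Im z" for c z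
      by simp
    then show ?thesis
      unfolding \<tau>'_eq using \<open>Im (- 1 / \<tau>) > 0\<close> pq by (simp only:) (intro mult_pos_pos; simp)
  qed
  define v where "v = - \<i> * \<epsilon> * ?a"
  define x where "x = real_of_int l / (2 * of_int p * of_int q)"
  have x: "complex_of_real x = of_int l / N"
    by (simp add: x_def N_def)
  define h where "h = (\<lambda>M::int. exp (of_real pi * \<i> * \<tau> * (of_int M + \<i> * ?a * \<epsilon>)\<^sup>2 / N))"
  define e where "e = (\<lambda>m::int. exp (of_real pi * \<i> * of_int m * of_int l / (of_int p * of_int q)))"
  have csq: "csqrt (- \<i> * \<tau>') = ?a * csqrt (\<i> / \<tau>)"
  proof -
    have "- \<i> * \<tau>' = of_real (2 * of_int p * of_int q) * (\<i> / \<tau>)"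
      by (simp add: \<tau>'_def N_def)
    moreover have "real_of_int p * of_int q > 0"
      using pq by simp
    ultimately show ?thesis
      using csqrt_of_real_mult[of "2 * of_int p * of_int q" "\<i> / \<tau>"] by (simp add: alpha_def)
  qed
  have lhs: "gauss_term \<tau>' v (of_int k + of_real x) / dedekind_eta (- 1 / \<tau>)
     = lattice_fock p q \<epsilon> (- 1 / \<tau>) (2 * p * q * k + l)" for k
  proof -
    define M where "M = complex_of_int (2 * p * q * k + l)"
    have 1: "of_int k + of_real x = M / N"
      unfolding x M_def using N0 by (simp add: N_def field_simps)
    have 2: "4 * complex_of_int p * of_int q = 2 * N"
      by (simp add: N_def)
    have 3: "v * (M / N) = - \<i> * \<epsilon> * M / ?a"
      unfolding v_def a2[symmetric] using a0 by simp
    have 4: "\<tau>' * (M / N)\<^sup>2 = - (M\<^sup>2 / (\<tau> * N))"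
      unfolding \<tau>'_def using N0 t0 by (simp add: power2_eq_square)
    have "of_real pi * \<i> * \<tau>' * (M / N)\<^sup>2 + 2 * of_real pi * \<i> * v * (M / N)
      = of_real pi * \<i> * (\<tau>' * (M / N)\<^sup>2) + 2 * of_real pi * \<i> * (v * (M / N))"
      by simp
    also have "\<dots> = 2 * of_real pi * \<epsilon> * M / ?a + 2 * of_real pi * \<i> * (- 1 / \<tau>) * (M\<^sup>2 / (2 * N))"
      unfolding 3 4 by (simp add: algebra_simps)
    finally show ?thesis
      unfolding 1 lattice_fock_def nome_pow_def 2 M_def[symmetric] gauss_term_def exp_add[symmetric] by simp
  qed
  have rhs: "exp (- of_real pi * \<i> * (of_int m - v)\<^sup>2 / \<tau>' + 2 * of_real pi * \<i> * of_int m * of_real x) = e m * h m" for m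
  proof -
    have 1: "of_int m - v = of_int m + \<i> * ?a * \<epsilon>"
      by (simp add: v_def)
    have 2: "- of_real pi * \<i> * X / \<tau>' = of_real pi * \<i> * \<tau> * X / N" for X
      unfolding \<tau>'_def using N0 t0 by simp
    have 3: "2 * of_real pi * \<i> * of_int m * of_real x = of_real pi * \<i> * of_int m * of_int l / (of_int p * of_int q)"
      unfolding x N_def by simp
    show ?thesis
      unfolding 1 2 3 e_def h_def by (simp add: exp_add)
  qed
  have e_per: "e (2 * p * q * k + m) = e m" for k m
    unfolding e_def by (rule exp_phase_periodic[OF pq])
  have sum_eh: "(\<lambda>m. norm (e m * h m)) summable_on UNIV"
  proof -
    have "norm (e m) = 1" for m
    proof -
      have "of_real pi * \<i> * of_int m * of_int l / (of_int p * of_int q)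
        = \<i> * complex_of_real (pi * of_int m * of_int l / (of_int p * of_int q))"
        by simp
      then show ?thesis
        by (simp only: e_def norm_exp_i_times)
    qed
    moreover have "h m = exp (of_real pi * \<i> * \<tau> * (\<i> * ?a * \<epsilon>)\<^sup>2 / N) * gauss_term (\<tau> / N) (\<tau> / N * (\<i> * ?a * \<epsilon>)) (of_int m + of_real 0)" for m
      unfolding h_def gauss_term_def exp_add[symmetric] using N0
      by (intro arg_cong[of _ _ exp]) (simp add: field_simps power2_eq_square)
    moreover have "Im (\<tau> / N) > 0"
    proof -
      have "Im (\<tau> / N) = Im \<tau> / (2 * of_int p * of_int q)"
        unfolding N_def by (metis Im_divide_of_real of_int_mult of_int_numeral of_real_of_int_eq)
      then show ?thesis
        using \<tau> pq by simp
    qed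
    ultimately show ?thesis
      unfolding norm_mult by (simp only: norm_mult mult_1 summable_on_cmult_right abs_summable_gauss_term)
  qed
  have E: "E_theta p q m \<epsilon> \<tau> = (\<Sum>\<^sub>\<infinity>k. h (2 * p * q * k + m)) / dedekind_eta \<tau>" for m
    unfolding E_theta_eq[OF pq] h_def by (simp add: N_def mult.assoc)
  have "lattice_theta p q \<epsilon> (- 1 / \<tau>) l = (\<Sum>\<^sub>\<infinity>k::int. gauss_term \<tau>' v (of_int k + of_real x)) / dedekind_eta (- 1 / \<tau>)"
    unfolding lattice_theta_def lhs[symmetric] divide_inverse[of _ "dedekind_eta (- 1 / \<tau>)"] by (rule infsum_cmult_left')
  also have "\<dots> = (\<Sum>\<^sub>\<infinity>m. e m * h m) / csqrt (- \<i> * \<tau>') / dedekind_eta (- 1 / \<tau>)"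
    using poisson_summation_gauss[OF \<tau>', of v x] rhs by simp
  also have "\<dots> = (\<Sum>\<^sub>\<infinity>m. e m * h m) / dedekind_eta \<tau> / ?a"
    unfolding csq dedekind_eta_S[OF \<tau>] using t0 by simp
  also have "(\<Sum>\<^sub>\<infinity>m. e m * h m) = (\<Sum>m = 0..2 * p * q - 1. \<Sum>\<^sub>\<infinity>k. e (2 * p * q * k + m) * h (2 * p * q * k + m))"
    by (rule infsum_int_residues[OF sum_eh pos])
  also have "\<dots> = (\<Sum>m = 0..2 * p * q - 1. e m * (\<Sum>\<^sub>\<infinity>k. h (2 * p * q * k + m)))"
    unfolding e_per infsum_cmult_right' ..
  finally show ?thesis
    by (simp add: E e_def sum_divide_distrib)
qed

text \<open>
  Termwise differentiation: \<open>d/d\<epsilon>\<close> multiplies each term by its momentum up to the factor \<open>2 \<pi>\<close>, and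
  the Gaussian bound is uniform for \<open>\<epsilon>\<close> in a disc.
\<close>

lemma has_field_derivative_lattice_theta:
  assumes pq: "p \<ge> 1" "q \<ge> 1" and \<tau>: "Im \<tau> > 0"
  shows "((\<lambda>e. lattice_theta p q e \<tau> l) has_field_derivative
      2 * of_real pi / of_real (alpha p q) *
        (\<Sum>\<^sub>\<infinity>k. of_int (2 * p * q * k + l) * lattice_fock p q \<epsilon> \<tau> (2 * p * q * k + l))) (at \<epsilon>)"
      (is ?deriv)
    and "(\<lambda>k. norm (of_int (2 * p * q * k + l) * lattice_fock p q \<epsilon> \<tau> (2 * p * q * k + l))) summable_on UNIV"
      (is ?summable)
proof -
  let ?a = "alpha p q"
  define R where "R = norm \<epsilon> + 1"
  define b where "b = 2 * pi * R / ?a"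
  define c where "c = 2 * pi * Im \<tau> / (4 * of_int p * of_int q)"
  have apos: "?a > 0"
    using alpha_pos[OF pq] .
  have c: "c > 0"
    using pq \<tau> by (simp add: c_def)
  define f' where "f' = (\<lambda>e M. of_int M * lattice_fock p q e \<tau> M)"
  define B where "B = (\<lambda>M::int. norm (of_int M * complex_of_real (1 / norm (dedekind_eta \<tau>) * exp (b * \<bar>of_int M\<bar> - c * (of_int M)\<^sup>2))))"
  have sB: "B summable_on UNIV"
    unfolding B_def by (rule abs_summable_on_int_mult[where b = b and M = "1 / norm (dedekind_eta \<tau>)", OF c]) (simp add: norm_mult norm_divide)
  have fB: "norm (f' e M) \<le> B M" if "e \<in> ball \<epsilon> 1" for e M
  proof -
    have e: "norm e \<le> R"
      using that norm_triangle_ineq2[of e \<epsilon>] by (simp add: R_def dist_norm norm_minus_commute)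
    have "Re (2 * of_real pi * e * of_int M / of_real ?a) \<le> norm (2 * of_real pi * e * of_int M / of_real ?a)"
      by (rule complex_Re_le_cmod)
    also have "\<dots> = 2 * pi / ?a * norm e * \<bar>of_int M\<bar>"
      using apos by (simp add: norm_mult norm_divide)
    also have "\<dots> \<le> 2 * pi / ?a * R * \<bar>of_int M\<bar>"
      using e apos by (intro mult_right_mono mult_left_mono) auto
    finally have 1: "Re (2 * of_real pi * e * of_int M / of_real ?a) \<le> b * \<bar>of_int M\<bar>"
      by (simp add: b_def)
    have "2 * of_real pi * \<i> * \<tau> * ((of_int M)\<^sup>2 / (4 * of_int p * of_int q))
        = of_real (2 * pi * (of_int M)\<^sup>2 / (4 * of_int p * of_int q)) * (\<i> * \<tau>)"
      by simp
    then have 2: "Re (2 * of_real pi * \<i> * \<tau> * ((of_int M)\<^sup>2 / (4 * of_int p * of_int q))) = - c * (of_int M)\<^sup>2"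
      by (simp only: Re_complex_of_real Im_complex_of_real times_complex.sel) (simp add: c_def)
    have "norm (lattice_fock p q e \<tau> M) \<le> exp (b * \<bar>of_int M\<bar> - c * (of_int M)\<^sup>2) / norm (dedekind_eta \<tau>)"
      unfolding lattice_fock_def nome_pow_def exp_add[symmetric] norm_divide norm_exp_eq_Re plus_complex.sel 2
      using 1 by (intro divide_right_mono) auto
    then have "norm (of_int M :: complex) * norm (lattice_fock p q e \<tau> M)
      \<le> norm (of_int M :: complex) * (exp (b * \<bar>of_int M\<bar> - c * (of_int M)\<^sup>2) / norm (dedekind_eta \<tau>))"
      by (rule mult_left_mono) simp
    then show ?thesis
      by (simp add: f'_def B_def norm_mult norm_divide)
  qed
  have deriv1: "((\<lambda>e. lattice_fock p q e \<tau> M) has_field_derivative 2 * of_real pi / of_real ?a * f' e M) (at e within S)" for e M S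
  proof -
    define K where "K = nome_pow \<tau> ((of_int M)\<^sup>2 / (4 * of_int p * of_int q)) / dedekind_eta \<tau>"
    define d where "d = 2 * of_real pi * of_int M / complex_of_real ?a"
    have eq: "lattice_fock p q e \<tau> M = exp (d * e) * K" for e
      by (simp add: lattice_fock_def K_def d_def mult_ac)
    have "((\<lambda>e. exp (d * e) * K) has_field_derivative d * (exp (d * e) * K)) (at e within S)"
      by (auto intro!: derivative_eq_intros)
    moreover have "d * X = 2 * of_real pi / of_real ?a * (of_int M * X)" for X
      by (simp add: d_def)
    ultimately show ?thesis
      unfolding eq f'_def by (simp only:)
  qed
  define g where "g = (\<lambda>n. 2 * p * q * int_decode n + l)"
  have inj: "inj (\<lambda>k. 2 * p * q * k + l)"
    using pq by (auto simp: inj_def)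
  have sBl: "(\<lambda>k. B (2 * p * q * k + l)) summable_on UNIV"
    using summable_on_subset[OF sB, of "range (\<lambda>k. 2 * p * q * k + l)"]
      summable_on_reindex[OF inj, of B] by (simp add: o_def)
  show s': ?summable
  proof (rule summable_on_comparison_test[OF sBl])
    show "norm (of_int (2 * p * q * k + l) * lattice_fock p q \<epsilon> \<tau> (2 * p * q * k + l)) \<le> B (2 * p * q * k + l)" for k
      using fB[of \<epsilon> "2 * p * q * k + l"] unfolding f'_def by simp
  qed simp
  have sBn: "summable (\<lambda>n. B (g n))"
    using summable_on_reindex_bij_betw[OF bij_int_decode, of "\<lambda>k. B (2 * p * q * k + l)"] sBl
    by (intro summable_on_imp_summable) (simp add: g_def)
  have sum_bd: "summable (\<lambda>n. 2 * pi / ?a * B (g n))"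
    by (intro summable_mult sBn)
  have bd: "norm (2 * of_real pi / of_real ?a * f' e (g n)) \<le> 2 * pi / ?a * B (g n)" if "e \<in> ball \<epsilon> 1" for n e
    using fB[OF that, of "g n"] apos by (simp add: norm_mult norm_divide mult_left_mono divide_right_mono)
  have unif: "uniformly_convergent_on (ball \<epsilon> 1) (\<lambda>n e. \<Sum>i<n. 2 * of_real pi / of_real ?a * f' e (g i))"
    by (rule uniformly_convergentI[OF Weierstrass_m_test[OF bd sum_bd]])
  have eq: "lattice_theta p q e \<tau> l = (\<Sum>n. lattice_fock p q e \<tau> (g n))" for e
    unfolding lattice_theta_def g_def by (rule infsum_int_eq_suminf(2)[OF abs_summable_lattice_theta[OF pq \<tau>]])
  have "((\<lambda>e. \<Sum>n. lattice_fock p q e \<tau> (g n)) has_field_derivative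
      (\<Sum>n. 2 * of_real pi / of_real ?a * f' \<epsilon> (g n))) (at \<epsilon>)"
  proof (rule has_field_derivative_series'(2)[OF _ deriv1 unif])
    show "summable (\<lambda>n. lattice_fock p q \<epsilon> \<tau> (g n))"
      unfolding g_def
      by (rule summable_norm_cancel, rule infsum_int_eq_suminf(1)[OF abs_summable_lattice_theta[OF pq \<tau>]])
  qed auto
  also have "(\<Sum>n. 2 * of_real pi / of_real ?a * f' \<epsilon> (g n)) = 2 * of_real pi / of_real ?a * (\<Sum>n. f' \<epsilon> (g n))"
    unfolding g_def f'_def
    by (rule suminf_mult, rule summable_norm_cancel, rule infsum_int_eq_suminf(1)[OF s'])
  also have "(\<Sum>n. f' \<epsilon> (g n)) = (\<Sum>\<^sub>\<infinity>k. of_int (2 * p * q * k + l) * lattice_fock p q \<epsilon> \<tau> (2 * p * q * k + l))"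
    unfolding g_def f'_def by (rule infsum_int_eq_suminf(2)[OF s', symmetric])
  finally show ?deriv
    unfolding eq .
qed

text \<open>
  The weight \<open>k\<close> is an affine function of the momentum \<open>2 p q k + l\<close>; the momentum itself is produced
  by differentiation in \<open>\<epsilon>\<close>.
\<close>

lemma lattice_fock_weighted_sum:
  assumes pq: "p \<ge> 1" "q \<ge> 1" and \<tau>: "Im \<tau> > 0"
  shows "(\<lambda>k. norm (of_int k * lattice_fock p q \<epsilon> \<tau> (2 * p * q * k + l))) summable_on UNIV"
    and "(\<Sum>\<^sub>\<infinity>k. of_int k * lattice_fock p q \<epsilon> \<tau> (2 * p * q * k + l))
      = ((\<Sum>\<^sub>\<infinity>k. of_int (2 * p * q * k + l) * lattice_fock p q \<epsilon> \<tau> (2 * p * q * k + l))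
          - of_int l * lattice_theta p q \<epsilon> \<tau> l) / (2 * of_int p * of_int q)"
proof -
  define F where "F = (\<lambda>k. lattice_fock p q \<epsilon> \<tau> (2 * p * q * k + l))"
  define G where "G = (\<lambda>k. of_int (2 * p * q * k + l) * F k)"
  define c where "c = 1 / (2 * complex_of_int p * of_int q)"
  have nz: "complex_of_int p \<noteq> 0" "complex_of_int q \<noteq> 0"
    using pq by auto
  have eq: "of_int k * F k = c * G k + (- c * of_int l) * F k" for k
    unfolding G_def c_def using nz by (simp add: field_simps)
  have sG: "(\<lambda>k. norm (G k)) summable_on UNIV"
    unfolding G_def F_def by (rule has_field_derivative_lattice_theta(2)[OF pq \<tau>])
  have sF: "(\<lambda>k. norm (F k)) summable_on UNIV"
    unfolding F_def by (rule abs_summable_lattice_theta[OF pq \<tau>])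
  have "(\<lambda>k. norm c * norm (G k) + norm (- c * of_int l) * norm (F k)) summable_on UNIV"
    by (intro summable_on_add summable_on_cmult_right sG sF)
  then have "(\<lambda>k. norm (of_int k * F k)) summable_on UNIV"
  proof (rule summable_on_comparison_test)
    show "norm (of_int k * F k) \<le> norm c * norm (G k) + norm (- c * of_int l) * norm (F k)" for k
      unfolding eq norm_mult[symmetric] by (rule norm_triangle_ineq)
  qed simp
  then show "(\<lambda>k. norm (of_int k * lattice_fock p q \<epsilon> \<tau> (2 * p * q * k + l))) summable_on UNIV"
    by (simp only: F_def)
  have "(\<Sum>\<^sub>\<infinity>k. of_int k * F k) = (\<Sum>\<^sub>\<infinity>k. c * G k) + (\<Sum>\<^sub>\<infinity>k. (- c * of_int l) * F k)"
    unfolding eq by (intro infsum_add summable_on_cmult_right abs_summable_summable[OF sG] abs_summable_summable[OF sF])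
  also have "\<dots> = c * (\<Sum>\<^sub>\<infinity>k. G k) + (- c * of_int l) * (\<Sum>\<^sub>\<infinity>k. F k)"
    by (simp only: infsum_cmult_right')
  finally show "(\<Sum>\<^sub>\<infinity>k. of_int k * lattice_fock p q \<epsilon> \<tau> (2 * p * q * k + l))
      = ((\<Sum>\<^sub>\<infinity>k. of_int (2 * p * q * k + l) * lattice_fock p q \<epsilon> \<tau> (2 * p * q * k + l))
          - of_int l * lattice_theta p q \<epsilon> \<tau> l) / (2 * of_int p * of_int q)"
    by (simp add: F_def G_def c_def lattice_theta_def diff_divide_distrib)
qed

section \<open>Minimal model characters at -1/tau\<close>

lemma minus_one_powi: "(-1) powi k = (if even k then 1 else - 1 :: 'a::field)" for k :: int
  by (auto elim!: evenE oddE simp: power_int_add power_int_mult)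

lemma sin_add_pi_int: "sin (x + pi * of_int k) = (-1) powi k * sin (x::real)"
  unfolding sin_add cos_npi_int sin_npi_int by (simp add: minus_one_powi)

lemma sin_pi_int_minus: "sin (pi * of_int k - x) = - ((-1) powi k * sin (x::real))"
  using sin_add_pi_int[of "- x" k] by simp

lemma ch_L_eq_lattice_theta:
  assumes "p \<ge> 1" "q \<ge> 1"
  shows "ch_L p q r s \<tau> = lattice_theta p q 0 \<tau> (r * q - s * p) - lattice_theta p q 0 \<tau> (r * q + s * p)"
proof -
  have "theta (p * q) b 0 \<tau> / dedekind_eta \<tau> = lattice_theta p q 0 \<tau> b" for b
    using E_theta_0[OF assms, of b \<tau>] by (simp add: E_theta_def nome_pow_def)
  then show ?thesis
    by (simp add: ch_L_def diff_divide_distrib)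
qed

text \<open>
  On the boundary of the Kac table the two theta series in a minimal model character coincide, by their
  periodicity and evenness.
\<close>

lemma ch_L_border:
  assumes "p \<ge> 1" "q \<ge> 1"
  shows "ch_L p q r q \<tau> = 0" "ch_L p q r 0 \<tau> = 0" "ch_L p q p s \<tau> = 0"
proof -
  show "ch_L p q r q \<tau> = 0"
    using lattice_theta_periodic[of p q 0 \<tau> 1 "r * q - q * p"]
    by (simp add: ch_L_eq_lattice_theta[OF assms] algebra_simps)
  show "ch_L p q r 0 \<tau> = 0"
    by (simp add: ch_L_eq_lattice_theta[OF assms])
  show "ch_L p q p s \<tau> = 0"
    using lattice_theta_periodic[of p q 0 \<tau> 1 "- (p * q + s * p)"] lattice_theta_0_uminus[of p q \<tau> "p * q + s * p"]
    by (simp add: ch_L_eq_lattice_theta[OF assms] algebra_simps)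
qed

text \<open>
  By the Chinese remainder theorem, \<open>r q + s p\<close> with \<open>0 < r < p\<close> and \<open>0 < |s| < q\<close> runs through
  the residues modulo \<open>2 p q\<close> that neither \<open>p\<close> nor \<open>q\<close> divides, each once. The reflection
  \<open>(r, s) \<mapsto> (p - r, q - s)\<close> exchanges \<open>Kac_half\<close> with the rest of the positive Kac table, and it
  negates \<open>r q + s p\<close> and \<open>r q - s p\<close> modulo \<open>2 p q\<close>.
\<close>

lemma residue_sum_Kac:
  fixes g :: "int \<Rightarrow> complex"
  assumes pq: "p \<ge> 1" "q \<ge> 1" "coprime p q"
    and per: "\<And>m j. g (2 * p * q * j + m) = g m"
    and zero: "\<And>m. p dvd m \<or> q dvd m \<Longrightarrow> g m = 0"
  shows "(\<Sum>m = 0..2 * p * q - 1. g m) = (\<Sum>(r, s)\<in>Kac_half p q.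
    g (r * q - s * p) + g (- (r * q - s * p)) + (g (r * q + s * p) + g (- (r * q + s * p))))"
proof -
  define N where "N = 2 * p * q"
  have N: "N > 0"
    using pq by (simp add: N_def)
  have g_mod: "g (m mod N) = g m" for m
    using per[of "m div N" "m mod N"] by (simp add: N_def)
  define D where "D = {m \<in> {0..N - 1}. \<not> p dvd m \<and> \<not> q dvd m}"
  define P where "P = {1..p - 1}"
  define Q where "Q = {1..q - 1}"
  define Q' where "Q' = {- (q - 1)..- 1}"
  define \<phi> where "\<phi> = (\<lambda>(r, s). (r * q + s * p) mod N)"
  have abs_dvd: "i = 0" if "d dvd i" "\<bar>i\<bar> < d" for i d :: int
    using dvd_imp_le_int[of i d] that by linarith
  have inj: "inj_on \<phi> (P \<times> (Q \<union> Q'))"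
  proof (rule inj_onI, clarify)
    fix r s r' s' assume rs: "r \<in> P" "s \<in> Q \<union> Q'" "r' \<in> P" "s' \<in> Q \<union> Q'" and "\<phi> (r, s) = \<phi> (r', s')"
    then have "N dvd (r * q + s * p) - (r' * q + s' * p)"
      by (simp add: \<phi>_def mod_eq_dvd_iff)
    then have d: "N dvd (r - r') * q + (s - s') * p"
      by (simp add: algebra_simps)
    have "p dvd (r - r') * q + (s - s') * p"
      by (rule dvd_trans[OF _ d]) (simp add: N_def)
    then have "p dvd (r - r') * q"
      by (simp add: dvd_add_left_iff)
    then have "p dvd r - r'"
      using pq(3) by (simp add: coprime_dvd_mult_left_iff)
    moreover have "\<bar>r - r'\<bar> < p"
      using rs by (auto simp: P_def)
    ultimately have r: "r = r'"
      using abs_dvd by fastforce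
    then have "p * (2 * q) dvd p * (s - s')"
      using d by (simp add: N_def mult_ac)
    then have "2 * q dvd s - s'"
      using pq(1) by simp
    moreover have "\<bar>s - s'\<bar> < 2 * q"
      using rs by (auto simp: Q_def Q'_def)
    ultimately have "s = s'"
      using abs_dvd by fastforce
    with r show "r = r' \<and> s = s'"
      by simp
  qed
  have image: "\<phi> ` (P \<times> (Q \<union> Q')) = D"
  proof (intro equalityI subsetI)
    fix m assume "m \<in> \<phi> ` (P \<times> (Q \<union> Q'))"
    then obtain r s where rs: "r \<in> P" "s \<in> Q \<union> Q'" and m: "m = (r * q + s * p) mod N"
      by (auto simp: \<phi>_def)
    have pm: "p dvd m \<longleftrightarrow> p dvd r * q + s * p" and qm: "q dvd m \<longleftrightarrow> q dvd r * q + s * p"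
      unfolding m by (simp_all add: N_def dvd_mod_iff)
    have "\<not> p dvd r"
      using abs_dvd[of p r] rs by (auto simp: P_def)
    moreover have "\<not> q dvd s"
      using abs_dvd[of q s] rs by (auto simp: Q_def Q'_def)
    ultimately have "\<not> p dvd m" "\<not> q dvd m"
      unfolding pm qm using pq(3)
      by (auto simp: dvd_add_left_iff dvd_add_right_iff coprime_dvd_mult_left_iff coprime_commute)
    then show "m \<in> D"
      unfolding D_def m using N by simp
  next
    fix m assume "m \<in> D"
    then have m: "0 \<le> m" "m < N" "\<not> p dvd m" "\<not> q dvd m"
      by (auto simp: D_def)
    \<comment> \<open>Surjectivity: solve for \<open>r\<close> modulo \<open>p\<close> first, then for \<open>s\<close> modulo \<open>2 q\<close>.\<close>
    obtain x y where xy: "x * q + y * p = 1"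
      using bezout_int[of q p] pq(3) by (metis coprime_commute coprime_imp_gcd_eq_1)
    define r where "r = (m * x) mod p"
    have "p dvd m - r * q"
    proof -
      have "m - r * q = m * (x * q + y * p) - r * q"
        by (simp add: xy)
      also have "\<dots> = (m * x - r) * q + m * y * p"
        by (simp add: algebra_simps)
      also have "m * x - r = p * (m * x div p)"
        unfolding r_def by (simp add: minus_mod_eq_mult_div)
      finally show ?thesis
        by simp
    qed
    then obtain t where t: "m - r * q = p * t"
      by (elim dvdE)
    have r: "r \<in> P"
    proof -
      have "r \<noteq> 0"
        using t m(3) by (metis diff_zero dvd_triv_left mult_zero_left)
      moreover have "0 \<le> r" "r < p"
        using pq by (simp_all add: r_def)
      ultimately show ?thesis
        by (simp add: P_def)
    qed
    have qt: "\<not> q dvd t"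
    proof
      assume "q dvd t"
      moreover have "m = r * q + p * t"
        using t by simp
      ultimately show False
        using m(4) by simp
    qed
    define s0 where "s0 = t mod (2 * q)"
    have s0: "0 \<le> s0" "s0 < 2 * q"
      using pq by (simp_all add: s0_def)
    have "q dvd s0 \<longleftrightarrow> q dvd t"
      by (simp add: s0_def dvd_mod_iff)
    then have s0': "s0 \<noteq> 0" "s0 \<noteq> q"
      using qt by auto
    \<comment> \<open>The representative of \<open>t\<close> modulo \<open>2 q\<close> of absolute value less than \<open>q\<close>.\<close>
    define s where "s = (if s0 < q then s0 else s0 - 2 * q)"
    have "s \<in> Q \<union> Q'"
      using s0 s0' by (auto simp: s_def Q_def Q'_def)
    moreover have "\<phi> (r, s) = m"
    proof -
      have "2 * q dvd s - t"
      proof -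
        have "2 * q dvd s0 - t"
          unfolding s0_def by (simp add: mod_eq_dvd_iff[symmetric])
        then have "2 * q dvd (s0 - t) - 2 * q"
          by (rule dvd_diff) simp
        then show ?thesis
          using \<open>2 * q dvd s0 - t\<close> by (simp add: s_def algebra_simps)
      qed
      then have "p * (2 * q) dvd p * (s - t)"
        by (rule mult_dvd_mono[OF dvd_refl])
      moreover have "r * q + s * p - m = p * (s - t)"
        using t by (simp add: algebra_simps)
      ultimately have "N dvd r * q + s * p - m"
        by (simp add: N_def mult_ac)
      then have "(r * q + s * p) mod N = m mod N"
        by (simp add: mod_eq_dvd_iff)
      then show ?thesis
        using m by (simp add: \<phi>_def)
    qed
    ultimately show "m \<in> \<phi> ` (P \<times> (Q \<union> Q'))"
      using r by (intro image_eqI[of _ _ "(r, s)"]) auto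
  qed
  have "(\<Sum>m = 0..N - 1. g m) = (\<Sum>m\<in>D. g m)"
    by (rule sum.mono_neutral_right) (auto simp: D_def zero)
  also have "\<dots> = (\<Sum>x\<in>P \<times> (Q \<union> Q'). g (\<phi> x))"
    unfolding image[symmetric] by (simp add: sum.reindex[OF inj])
  also have "\<dots> = (\<Sum>r\<in>P. \<Sum>s\<in>Q \<union> Q'. g (r * q + s * p))"
    by (simp add: \<phi>_def g_mod sum.cartesian_product case_prod_unfold)
  also have "\<dots> = (\<Sum>r\<in>P. \<Sum>s\<in>Q. g (r * q + s * p) + g (r * q - s * p))"
  proof (rule sum.cong[OF refl])
    fix r
    have "(\<Sum>s\<in>Q \<union> Q'. g (r * q + s * p)) = (\<Sum>s\<in>Q. g (r * q + s * p)) + (\<Sum>s\<in>Q'. g (r * q + s * p))"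
      by (rule sum.union_disjoint) (auto simp: Q_def Q'_def)
    also have "(\<Sum>s\<in>Q'. g (r * q + s * p)) = (\<Sum>s\<in>Q. g (r * q - s * p))"
      by (rule sum.reindex_bij_witness[of _ uminus uminus]) (auto simp: Q_def Q'_def)
    finally show "(\<Sum>s\<in>Q \<union> Q'. g (r * q + s * p)) = (\<Sum>s\<in>Q. g (r * q + s * p) + g (r * q - s * p))"
      by (simp add: sum.distrib)
  qed
  also have "\<dots> = (\<Sum>(r, s)\<in>P \<times> Q. g (r * q + s * p) + g (r * q - s * p))"
    by (rule sum.cartesian_product)
  also have "\<dots> = (\<Sum>(r, s)\<in>Kac_half p q. g (r * q + s * p) + g (r * q - s * p))
      + (\<Sum>(r, s)\<in>P \<times> Q - Kac_half p q. g (r * q + s * p) + g (r * q - s * p))"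
    by (subst sum.subset_diff[of "Kac_half p q"]) (auto simp: Kac_half_def P_def Q_def)
  also have "(\<Sum>(r, s)\<in>P \<times> Q - Kac_half p q. g (r * q + s * p) + g (r * q - s * p))
      = (\<Sum>(r, s)\<in>Kac_half p q. g (- (r * q + s * p)) + g (- (r * q - s * p)))"
  proof (rule sum.reindex_bij_witness[of _ "\<lambda>(r, s). (p - r, q - s)" "\<lambda>(r, s). (p - r, q - s)"], goal_cases)
    case (2 x)
    obtain r s where x: "x = (r, s)" by fastforce
    have rs: "r \<in> P" "s \<in> Q" "\<not> s * p > r * q"
      using 2 by (auto simp: x Kac_half_def P_def Q_def)
    have "s * p \<noteq> r * q"
    proof
      assume "s * p = r * q"
      then have "p dvd r * q"
        by (metis dvd_triv_right)
      then have "p dvd r"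
        using pq(3) by (simp add: coprime_dvd_mult_left_iff)
      then show False
        using abs_dvd[of p r] rs by (auto simp: P_def)
    qed
    then have "(q - s) * p > (p - r) * q"
      using rs(3) by (simp add: algebra_simps)
    then show ?case
      using rs by (auto simp: x Kac_half_def P_def Q_def)
  next
    case (4 x)
    obtain r s where x: "x = (r, s)" by fastforce
    have rs: "1 \<le> r" "r < p" "1 \<le> s" "s < q" "s * p > r * q"
      using 4 by (auto simp: x Kac_half_def)
    then have "\<not> (q - s) * p > (p - r) * q"
      by (simp add: algebra_simps)
    then show ?case
      using rs by (auto simp: x Kac_half_def P_def Q_def)
  next
    case (5 x)
    obtain r s where x: "x = (r, s)" by fastforce
    have "g (- ((p - r) * q + (q - s) * p)) = g (r * q + s * p)"
      using per[of "-1" "r * q + s * p"] by (simp add: algebra_simps)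
    moreover have "- ((p - r) * q - (q - s) * p) = r * q - s * p"
      by (simp add: algebra_simps)
    ultimately show ?case
      by (simp add: x)
  qed auto
  finally show ?thesis
    unfolding N_def by (simp add: sum.distrib[symmetric] case_prod_unfold add_ac)
qed

lemma sum_residues_uminus:
  fixes g :: "int \<Rightarrow> complex"
  assumes N: "N > 0" and per: "\<And>m j. g (N * j + m) = g m"
  shows "(\<Sum>m = 0..N - 1. g (- m)) = (\<Sum>m = 0..N - 1. g m)"
proof (rule sum.reindex_bij_witness[of _ "\<lambda>m. (- m) mod N" "\<lambda>m. (- m) mod N"], goal_cases)
  case (5 m)
  show ?case
    using per[of "(- m) div N" "(- m) mod N"] by simp
qed (use N in \<open>auto simp: mod_minus_eq\<close>)

text \<open>
  The theta series at \<open>\<epsilon> = 0\<close> are even in the residue \<open>m\<close>, so that only the cosines of the phases in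
  \<open>lattice_theta_S\<close> survive; their difference is twice the product of sines.
\<close>

lemma ch_L_S_sin:
  assumes pq: "p \<ge> 1" "q \<ge> 1" and \<tau>: "Im \<tau> > 0"
  shows "ch_L p q r s (- 1 / \<tau>) = 2 / of_real (alpha p q) *
     (\<Sum>m = 0..2 * p * q - 1. of_real (sin (pi * of_int r * of_int m / of_int p) * sin (pi * of_int s * of_int m / of_int q)) * lattice_theta p q 0 \<tau> m)"
proof -
  let ?a = "complex_of_real (alpha p q)"
  have nz: "real_of_int p \<noteq> 0" "real_of_int q \<noteq> 0"
    using pq by auto
  define e where "e = (\<lambda>l m. exp (of_real pi * \<i> * of_int m * of_int l / (of_int p * of_int q)))"
  define \<Theta> where "\<Theta> = lattice_theta p q 0 \<tau>"
  have e_cis: "e l m = cis (pi * of_int m * of_int l / (of_int p * of_int q))" for l m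
    unfolding e_def cis_conv_exp by (rule arg_cong[of _ _ exp]) simp
  have N: "2 * p * q > 0"
    using pq by simp
  have cos: "(\<Sum>m = 0..2 * p * q - 1. e l m * \<Theta> m)
      = (\<Sum>m = 0..2 * p * q - 1. of_real (cos (pi * of_int m * of_int l / (of_int p * of_int q))) * \<Theta> m)" for l
  proof -
    have "e l (2 * p * q * j + m) * \<Theta> (2 * p * q * j + m) = e l m * \<Theta> m" for j m
    proof -
      have "e l (2 * p * q * j + m) = e l m"
        unfolding e_def by (rule exp_phase_periodic[OF pq])
      then show ?thesis
        by (simp add: \<Theta>_def lattice_theta_periodic)
    qed
    from sum_residues_uminus[OF N this]
    have "2 * (\<Sum>m = 0..2 * p * q - 1. e l m * \<Theta> m)
        = (\<Sum>m = 0..2 * p * q - 1. e l m * \<Theta> m) + (\<Sum>m = 0..2 * p * q - 1. e l (- m) * \<Theta> (- m))"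
      by simp
    also have "\<dots> = (\<Sum>m = 0..2 * p * q - 1. (e l m + e l (- m)) * \<Theta> m)"
      by (simp add: \<Theta>_def lattice_theta_0_uminus sum.distrib distrib_right)
    also have "\<dots> = (\<Sum>m = 0..2 * p * q - 1. 2 * (of_real (cos (pi * of_int m * of_int l / (of_int p * of_int q))) * \<Theta> m))"
      by (intro sum.cong refl) (simp add: e_cis complex_eq_iff)
    finally show ?thesis
      by (simp add: sum_distrib_left[symmetric])
  qed
  have "ch_L p q r s (- 1 / \<tau>) = ((\<Sum>m = 0..2 * p * q - 1. e (r * q - s * p) m * \<Theta> m)
      - (\<Sum>m = 0..2 * p * q - 1. e (r * q + s * p) m * \<Theta> m)) / ?a"
    unfolding ch_L_eq_lattice_theta[OF pq] lattice_theta_S[OF pq \<tau>] e_def \<Theta>_def E_theta_0[OF pq]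
    by (simp add: diff_divide_distrib)
  also have "\<dots> = (\<Sum>m = 0..2 * p * q - 1.
      of_real (cos (pi * of_int m * of_int (r * q - s * p) / (of_int p * of_int q))
        - cos (pi * of_int m * of_int (r * q + s * p) / (of_int p * of_int q))) * \<Theta> m) / ?a"
    unfolding cos sum_subtractf[symmetric] by (simp add: left_diff_distrib)
  also have "(\<Sum>m = 0..2 * p * q - 1.
      of_real (cos (pi * of_int m * of_int (r * q - s * p) / (of_int p * of_int q))
        - cos (pi * of_int m * of_int (r * q + s * p) / (of_int p * of_int q))) * \<Theta> m)
     = (\<Sum>m = 0..2 * p * q - 1. 2 * (of_real (sin (pi * of_int r * of_int m / of_int p) * sin (pi * of_int s * of_int m / of_int q)) * \<Theta> m))"
  proof (rule sum.cong[OF refl])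
    fix m
    let ?A = "pi * of_int r * of_int m / of_int p" and ?B = "pi * of_int s * of_int m / of_int q"
    have "pi * of_int m * of_int (r * q - s * p) / (of_int p * of_int q) = ?A - ?B"
      "pi * of_int m * of_int (r * q + s * p) / (of_int p * of_int q) = ?A + ?B"
      using nz by (simp_all add: field_simps)
    then show "of_real (cos (pi * of_int m * of_int (r * q - s * p) / (of_int p * of_int q))
        - cos (pi * of_int m * of_int (r * q + s * p) / (of_int p * of_int q))) * \<Theta> m
      = 2 * (of_real (sin ?A * sin ?B) * \<Theta> m)"
      by (simp only: cos_diff cos_add) simp
  qed
  finally show ?thesis
    by (simp add: \<Theta>_def sum_distrib_left[symmetric])
qed

text \<open>
  For odd \<open>n\<close>, replacing \<open>s\<close> by \<open>q - s\<close> in the sine produces the sign \<open>- (-1)\<^sup>m\<close>, so both parities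
  have the coefficient \<open>(-1) powi (m n) sin sin\<close>. Its values at \<open>r' q + s' p\<close> and \<open>r' q - s' p\<close>
  are opposite, which recombines the two theta series into \<open>ch_L p q r' s'\<close>.
\<close>

lemma vacuum_S:
  assumes pq: "p \<ge> 1" "q \<ge> 1" "coprime p q" and \<tau>: "Im \<tau> > 0"
  shows "of_bool (even n) * ch_L p q r s (- 1 / \<tau>) - of_bool (odd n) * ch_L p q r (q - s) (- 1 / \<tau>)
    = (\<Sum>(r', s')\<in>Kac_half p q. (-1) powi (n * (p * s' + q * r')) *
           of_real (S_Vir p q (r, s) (r', s')) * ch_L p q r' s' \<tau>)"
proof -
  let ?a = "complex_of_real (alpha p q)"
  have nz: "real_of_int p \<noteq> 0" "real_of_int q \<noteq> 0"
    using pq by auto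
  define f where "f = (\<lambda>m. (-1) powi (m * n) * sin (pi * of_int r * of_int m / of_int p) *
      sin (pi * of_int s * of_int m / of_int q))"
  define \<Theta> where "\<Theta> = lattice_theta p q 0 \<tau>"
  have reflect: "sin (pi * of_int (q - s) * of_int m / of_int q) = - ((-1) powi m * sin (pi * of_int s * of_int m / of_int q))" for m
  proof -
    have "pi * of_int (q - s) * of_int m / of_int q = pi * of_int m - pi * of_int s * of_int m / of_int q"
      using nz by (simp add: field_simps)
    then show ?thesis
      by (simp only: sin_pi_int_minus)
  qed
  have lhs: "of_bool (even n) * ch_L p q r s (- 1 / \<tau>) - of_bool (odd n) * ch_L p q r (q - s) (- 1 / \<tau>)
      = 2 / ?a * (\<Sum>m = 0..2 * p * q - 1. of_real (f m) * \<Theta> m)"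
  proof (cases "even n")
    case True
    then show ?thesis
      unfolding ch_L_S_sin[OF pq(1,2) \<tau>] by (simp add: f_def minus_one_powi \<Theta>_def)
  next
    case False
    then have trm: "complex_of_real (sin (pi * of_int r * of_int m / of_int p) * - ((-1) powi m * sin (pi * of_int s * of_int m / of_int q))) * \<Theta> m
        = - (of_real (f m) * \<Theta> m)" for m
      by (simp add: f_def minus_one_powi)
    have "ch_L p q r (q - s) (- 1 / \<tau>) = 2 / ?a * (\<Sum>m = 0..2 * p * q - 1. - (of_real (f m) * \<Theta> m))"
      unfolding ch_L_S_sin[OF pq(1,2) \<tau>] reflect \<Theta>_def[symmetric] trm ..
    then show ?thesis
      using False by (simp add: sum_negf)
  qed
  have f_uminus: "f (- m) = f m" for m
    by (simp add: f_def minus_one_powi)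
  have f_per: "f (2 * p * q * j + m) = f m" for j m
  proof -
    have "pi * of_int r * of_int (2 * p * q * j + m) / of_int p = pi * of_int r * of_int m / of_int p + pi * of_int (2 * (r * q * j))"
      "pi * of_int s * of_int (2 * p * q * j + m) / of_int q = pi * of_int s * of_int m / of_int q + pi * of_int (2 * (s * p * j))"
      using nz by (simp_all add: field_simps)
    then show ?thesis
      unfolding f_def by (simp only: sin_add_pi_int) (simp add: minus_one_powi)
  qed
  have f_zero: "f m = 0" if "p dvd m \<or> q dvd m" for m
  proof -
    have "sin (pi * of_int r * of_int m / of_int p) = 0" if "p dvd m"
    proof -
      obtain k where "m = p * k" using \<open>p dvd m\<close> by (elim dvdE)
      then have "pi * of_int r * of_int m / of_int p = 0 + pi * of_int (r * k)"
        using nz by simp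
      then show ?thesis
        by (simp only: sin_add_pi_int) simp
    qed
    moreover have "sin (pi * of_int s * of_int m / of_int q) = 0" if "q dvd m"
    proof -
      obtain k where "m = q * k" using \<open>q dvd m\<close> by (elim dvdE)
      then have "pi * of_int s * of_int m / of_int q = 0 + pi * of_int (s * k)"
        using nz by simp
      then show ?thesis
        by (simp only: sin_add_pi_int) simp
    qed
    ultimately show ?thesis
      using that by (auto simp: f_def)
  qed
  define c where "c = (\<lambda>r' s'. (-1) powi (n * (p * s' + q * r')) * (-1) powi (s' * r + r' * s) *
      sin (pi * of_int r * of_int r' * of_int q / of_int p) * sin (pi * of_int s * of_int s' * of_int p / of_int q))"
  have f_plus: "f (r' * q + s' * p) = c r' s'" for r' s'
  proof -
    have "pi * of_int r * of_int (r' * q + s' * p) / of_int p = pi * of_int r * of_int r' * of_int q / of_int p + pi * of_int (s' * r)"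
      "pi * of_int s * of_int (r' * q + s' * p) / of_int q = pi * of_int s * of_int s' * of_int p / of_int q + pi * of_int (r' * s)"
      using nz by (simp_all add: field_simps)
    then show ?thesis
      unfolding f_def c_def by (simp only: sin_add_pi_int) (simp add: power_int_add mult_ac add_ac)
  qed
  have f_minus: "f (r' * q - s' * p) = - c r' s'" for r' s'
  proof -
    have "pi * of_int r * of_int (r' * q - s' * p) / of_int p = pi * of_int r * of_int r' * of_int q / of_int p + pi * of_int (- (s' * r))"
      "pi * of_int s * of_int (r' * q - s' * p) / of_int q = pi * of_int (r' * s) - pi * of_int s * of_int s' * of_int p / of_int q"
      using nz by (simp_all add: field_simps)
    then show ?thesis
      unfolding f_def c_def by (simp only: sin_add_pi_int sin_pi_int_minus) (auto simp: minus_one_powi)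
  qed
  have S: "S_Vir p q (r, s) (r', s') * (-1) powi (n * (p * s' + q * r')) = - (4 / alpha p q * c r' s')" for r' s'
  proof -
    have "sqrt (8 / (of_int p * of_int q)) = 4 / alpha p q"
    proof (rule real_sqrt_unique)
      show "(4 / alpha p q)\<^sup>2 = 8 / (of_int p * of_int q)"
        using pq by (simp add: alpha_def power_divide)
      show "0 \<le> 4 / alpha p q"
        using alpha_pos[OF pq(1,2)] by simp
    qed
    moreover have "pi * of_int r * of_int r' * of_int (q - p) / of_int p = pi * of_int r * of_int r' * of_int q / of_int p + pi * of_int (- (r * r'))"
      "pi * of_int s * of_int s' * of_int (q - p) / of_int q = pi * of_int (s * s') - pi * of_int s * of_int s' * of_int p / of_int q"
      using nz by (simp_all add: field_simps)
    ultimately have "S_Vir p q (r, s) (r', s') = (-1) powi ((r + s) * (r' + s')) * (4 / alpha p q) *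
        ((-1) powi (- (r * r')) * sin (pi * of_int r * of_int r' * of_int q / of_int p)) *
        (- ((-1) powi (s * s') * sin (pi * of_int s * of_int s' * of_int p / of_int q)))"
      unfolding S_Vir_def prod.case by (simp only: sin_add_pi_int sin_pi_int_minus)
    then show ?thesis
      unfolding c_def by (auto simp: minus_one_powi)
  qed
  have "(\<Sum>m = 0..2 * p * q - 1. of_real (f m) * \<Theta> m)
      = (\<Sum>(r', s')\<in>Kac_half p q. - 2 * of_real (c r' s') * ch_L p q r' s' \<tau>)"
  proof (subst residue_sum_Kac[OF pq])
    show "of_real (f (2 * p * q * j + m)) * \<Theta> (2 * p * q * j + m) = of_real (f m) * \<Theta> m" for m j
      by (simp add: f_per \<Theta>_def lattice_theta_periodic)
    show "of_real (f m) * \<Theta> m = 0" if "p dvd m \<or> q dvd m" for m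
      using f_zero[OF that] by simp
    have \<Theta>_uminus: "\<Theta> (- m) = \<Theta> m" for m
      by (simp add: \<Theta>_def lattice_theta_0_uminus)
    show "(\<Sum>(r', s')\<in>Kac_half p q. of_real (f (r' * q - s' * p)) * \<Theta> (r' * q - s' * p) +
         of_real (f (- (r' * q - s' * p))) * \<Theta> (- (r' * q - s' * p)) +
         (of_real (f (r' * q + s' * p)) * \<Theta> (r' * q + s' * p) +
          of_real (f (- (r' * q + s' * p))) * \<Theta> (- (r' * q + s' * p))))
       = (\<Sum>(r', s')\<in>Kac_half p q. - 2 * of_real (c r' s') * ch_L p q r' s' \<tau>)"
      unfolding f_uminus \<Theta>_uminus f_plus f_minus ch_L_eq_lattice_theta[OF pq(1,2)] \<Theta>_def[symmetric]
      by (intro sum.cong refl) (auto simp: algebra_simps)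
  qed
  then have "2 / ?a * (\<Sum>m = 0..2 * p * q - 1. of_real (f m) * \<Theta> m)
      = 2 / ?a * (\<Sum>(r', s')\<in>Kac_half p q. - 2 * of_real (c r' s') * ch_L p q r' s' \<tau>)"
    by (simp only:)
  also have "\<dots> = (\<Sum>(r', s')\<in>Kac_half p q. of_real (- (4 / alpha p q * c r' s')) * ch_L p q r' s' \<tau>)"
    unfolding sum_distrib_left by (intro sum.cong refl) auto
  also have "\<dots> = (\<Sum>(r', s')\<in>Kac_half p q. (-1) powi (n * (p * s' + q * r')) *
           of_real (S_Vir p q (r, s) (r', s')) * ch_L p q r' s' \<tau>)"
  proof (intro sum.cong refl, clarify)
    fix r' s'
    have "complex_of_real ((-1) powi k) = (-1) powi k" for k
      by (simp add: minus_one_powi)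
    then have "complex_of_real (- (4 / alpha p q * c r' s')) = (-1) powi (n * (p * s' + q * r')) * of_real (S_Vir p q (r, s) (r', s'))"
      unfolding S[symmetric] of_real_mult by (simp only: mult.commute)
    then show "complex_of_real (- (4 / alpha p q * c r' s')) * ch_L p q r' s' \<tau>
      = (-1) powi (n * (p * s' + q * r')) * of_real (S_Vir p q (r, s) (r', s')) * ch_L p q r' s' \<tau>"
      by simp
  qed
  finally show ?thesis
    using lhs by simp
qed

section \<open>The characters as weighted half-lattice sums\<close>

text \<open>
  Abel summation; the hypothesis makes the boundary terms \<open>K * X K\<close> vanish in the limit.
\<close>

lemma suminf_weighted_telescope:
  fixes X :: "nat \<Rightarrow> complex"
  assumes s: "summable (\<lambda>k. norm (of_nat (Suc k) * X k))"
  shows "(\<lambda>k. of_nat (k + 1) * (X k - X (Suc k))) sums (\<Sum>k. X k)"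
proof -
  have bd: "norm (of_nat c * X k) \<le> norm (of_nat (Suc k) * X k)" if "c \<le> Suc k" for c k
    unfolding norm_mult using that by (intro mult_right_mono) (simp_all only: norm_of_nat of_nat_le_iff norm_ge_zero)
  have "summable X"
    by (rule summable_norm_cancel, rule summable_comparison_test[OF _ s])
      (use bd[of 1] in auto)
  moreover have "(\<lambda>K. of_nat K * X K) \<longlonglongrightarrow> 0"
    by (rule Lim_null_comparison[OF _ summable_LIMSEQ_zero[OF s]])
      (intro always_eventually allI bd, simp)
  ultimately have "(\<lambda>K. (\<Sum>k<K. X k) - of_nat K * X K) \<longlonglongrightarrow> (\<Sum>k. X k) - 0"
    by (intro tendsto_diff summable_LIMSEQ)
  moreover have "(\<Sum>k<K. of_nat (k + 1) * (X k - X (Suc k))) = (\<Sum>k<K. X k) - of_nat K * X K" for K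
    by (induction K) (auto simp: algebra_simps)
  ultimately show ?thesis
    by (simp add: sums_def)
qed

text \<open>
  The four Fock characters that share one weight in the interior resolution. The resolution uses
  \<open>j = k + 1 \<ge> 1\<close>, where the weight is \<open>j\<close>; the extension to all integers \<open>j\<close> is what makes
  the full lattice sum available.
\<close>

definition fock_quad :: "int \<Rightarrow> int \<Rightarrow> complex \<Rightarrow> int \<Rightarrow> int \<Rightarrow> int \<Rightarrow> complex \<Rightarrow> int \<Rightarrow> complex" where
  "fock_quad p q \<epsilon> r s n \<tau> j = (let F = lattice_fock p q \<epsilon> \<tau>; N = (n - 2 * j) * p * q in
     F (N + (r * q + s * p)) + F (N - (r * q + s * p)) - F (N + (r * q - s * p)) - F (N - (r * q - s * p)))"

lemma infsum_fock_quad: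
  fixes p q r s n :: int and \<epsilon> \<tau> :: complex
  assumes pq: "p \<ge> 1" "q \<ge> 1" and \<tau>: "Im \<tau> > 0"
  defines "W \<equiv> \<lambda>l. \<Sum>\<^sub>\<infinity>k. of_int k * lattice_fock p q \<epsilon> \<tau> (2 * p * q * k + l)"
  shows "(\<lambda>j. norm (of_int j * fock_quad p q \<epsilon> r s n \<tau> j)) summable_on UNIV"
    and "(\<Sum>\<^sub>\<infinity>j. of_int j * fock_quad p q \<epsilon> r s n \<tau> j)
      = - (W (n * p * q + (r * q + s * p)) + W (n * p * q - (r * q + s * p))
         - W (n * p * q + (r * q - s * p)) - W (n * p * q - (r * q - s * p)))"
proof -
  define F where "F = (\<lambda>l j. of_int j * lattice_fock p q \<epsilon> \<tau> (2 * p * q * (- j) + l))"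
  have bij: "bij (uminus :: int \<Rightarrow> int)"
    by (rule bij_betwI[where g = uminus]) auto
  have F_eq: "F l j = - (of_int (- j) * lattice_fock p q \<epsilon> \<tau> (2 * p * q * (- j) + l))" for l j
    by (simp add: F_def)
  have sF: "(\<lambda>j. norm (F l j)) summable_on UNIV" for l
    unfolding F_eq norm_minus_cancel
    using lattice_fock_weighted_sum(1)[OF pq \<tau>, of \<epsilon> l]
      summable_on_reindex_bij_betw[OF bij, of "\<lambda>k. norm (of_int k * lattice_fock p q \<epsilon> \<tau> (2 * p * q * k + l))"]
    by blast
  have infF: "(\<Sum>\<^sub>\<infinity>j. F l j) = - W l" for l
    unfolding F_eq infsum_uminus W_def
    using infsum_reindex_bij_betw[OF bij, of "\<lambda>k. of_int k * lattice_fock p q \<epsilon> \<tau> (2 * p * q * k + l)"]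
    by simp
  let ?c1 = "r * q + s * p" and ?c2 = "r * q - s * p"
  have eq: "of_int j * fock_quad p q \<epsilon> r s n \<tau> j = F (n * p * q + ?c1) j + F (n * p * q - ?c1) j
      - F (n * p * q + ?c2) j - F (n * p * q - ?c2) j" for j
  proof -
    have "(n - 2 * j) * p * q + c = 2 * p * q * (- j) + (n * p * q + c)"
      "(n - 2 * j) * p * q - c = 2 * p * q * (- j) + (n * p * q - c)" for c
      by (simp_all add: algebra_simps)
    then show ?thesis
      unfolding fock_quad_def Let_def F_def by (simp only: distrib_left right_diff_distrib)
  qed
  have "(\<lambda>j. norm (F (n * p * q + ?c1) j) + norm (F (n * p * q - ?c1) j)
      + norm (F (n * p * q + ?c2) j) + norm (F (n * p * q - ?c2) j)) summable_on UNIV"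
    by (intro summable_on_add sF)
  then show "(\<lambda>j. norm (of_int j * fock_quad p q \<epsilon> r s n \<tau> j)) summable_on UNIV"
  proof (rule summable_on_comparison_test)
    have tri: "norm (a + b - c - d) \<le> norm a + norm b + norm c + norm d" for a b c d :: complex
      using norm_triangle_ineq4[of "a + b - c" d] norm_triangle_ineq4[of "a + b" c] norm_triangle_ineq[of a b]
      by linarith
    show "norm (of_int j * fock_quad p q \<epsilon> r s n \<tau> j) \<le> norm (F (n * p * q + ?c1) j) + norm (F (n * p * q - ?c1) j)
      + norm (F (n * p * q + ?c2) j) + norm (F (n * p * q - ?c2) j)" for j
      unfolding eq by (rule tri)
  qed simp
  have diff: "(\<Sum>\<^sub>\<infinity>j. f j - g j) = (\<Sum>\<^sub>\<infinity>j. f j) - (\<Sum>\<^sub>\<infinity>j. g j)" and diff': "(\<lambda>j. f j - g j) summable_on UNIV"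
    if "f summable_on UNIV" "g summable_on UNIV" for f g :: "int \<Rightarrow> complex"
  proof -
    have "(\<lambda>j. - g j) summable_on UNIV"
      using that(2) by (simp add: summable_on_uminus)
    from infsum_add[OF that(1) this] summable_on_add[OF that(1) this]
    show "(\<Sum>\<^sub>\<infinity>j. f j - g j) = (\<Sum>\<^sub>\<infinity>j. f j) - (\<Sum>\<^sub>\<infinity>j. g j)" "(\<lambda>j. f j - g j) summable_on UNIV"
      by (simp_all add: infsum_uminus)
  qed
  note sF' = abs_summable_summable[OF sF]
  have "(\<Sum>\<^sub>\<infinity>j. of_int j * fock_quad p q \<epsilon> r s n \<tau> j)
      = (\<Sum>\<^sub>\<infinity>j. F (n * p * q + ?c1) j) + (\<Sum>\<^sub>\<infinity>j. F (n * p * q - ?c1) j)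
      - (\<Sum>\<^sub>\<infinity>j. F (n * p * q + ?c2) j) - (\<Sum>\<^sub>\<infinity>j. F (n * p * q - ?c2) j)"
    unfolding eq
    by (simp only: diff[OF diff'[OF summable_on_add[OF sF' sF'] sF'] sF'] diff[OF summable_on_add[OF sF' sF'] sF'] infsum_add[OF sF' sF'])
  then show "(\<Sum>\<^sub>\<infinity>j. of_int j * fock_quad p q \<epsilon> r s n \<tau> j)
      = - (W (n * p * q + ?c1) + W (n * p * q - ?c1) - W (n * p * q + ?c2) - W (n * p * q - ?c2))"
    unfolding infF by simp
qed

text \<open>
  On the border the four characters form consecutive differences.
\<close>

lemma fock_quad_border:
  fixes p q r s n j :: int and \<epsilon> \<tau> :: complex
  assumes "r = p \<or> s = q"
  defines "F \<equiv> lattice_fock p q \<epsilon> \<tau>"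
    and "c \<equiv> (if s = q then r * q else s * p)"
  shows "fock_quad p q \<epsilon> r s n \<tau> j
    = (F ((n - 2 * j + 1) * p * q + c) - F ((n - 2 * j + 1) * p * q - c))
      - (F ((n - 2 * (j + 1) + 1) * p * q + c) - F ((n - 2 * (j + 1) + 1) * p * q - c))"
  using assms(1) unfolding fock_quad_def Let_def F_def[symmetric] c_def
  by (auto simp: algebra_simps)

text \<open>
  In the interior this is the definition with the momenta made explicit. On the border the
  minimal model characters vanish and \<open>\<Sum> (k + 1) (X k - X (k + 1))\<close> telescopes to the
  border resolution \<open>\<Sum> X k\<close>, which telescopes once more if \<open>r = p\<close> and \<open>s = q\<close>.
\<close>

lemma ch_I_uniform:
  assumes pq: "p \<ge> 1" "q \<ge> 1" and \<tau>: "Im \<tau> > 0" and rs: "r \<le> p" "s \<le> q"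
  shows "ch_I p q \<epsilon> r s n \<tau> = of_int n * of_bool (n \<ge> 0) *
      (of_bool (even n) * ch_L p q r s \<tau> - of_bool (odd n) * ch_L p q r (q - s) \<tau>)
    + (\<Sum>k. of_nat (k + 1) * fock_quad p q \<epsilon> r s n \<tau> (int k + 1))"
proof -
  define F where "F = lattice_fock p q \<epsilon> \<tau>"
  note chF = ch_F_eq_lattice_fock[OF pq, of \<epsilon> _ _ _ \<tau>, folded F_def]
  consider "r < p" "s < q" | "r = p \<or> s = q"
    using rs by linarith
  then show ?thesis
  proof cases
    case 1
    have "ch_F p q \<epsilon> (p - r) s (n - 2 * int k - 1) \<tau>
             + ch_F p q \<epsilon> r (q - s) (n - 2 * int k - 3) \<tau>
             - ch_F p q \<epsilon> r s (n - 2 * int k - 2) \<tau>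
             - ch_F p q \<epsilon> (p - r) (q - s) (n - 2 * int k - 2) \<tau> = fock_quad p q \<epsilon> r s n \<tau> (int k + 1)" for k
      unfolding chF fock_quad_def Let_def F_def[symmetric] by (simp add: algebra_simps)
    then show ?thesis
      using 1 by (simp add: ch_I_def)
  next
    case 2
    define c where "c = (if s = q then r * q else s * p)"
    define X where "X = (\<lambda>k::nat. F ((n - 2 * int k - 1) * p * q + c) - F ((n - 2 * int k - 1) * p * q - c))"
    have nc: "summable (\<lambda>k. norm (of_nat (Suc k) * F ((n - 2 * int k - 1) * p * q + d)))" for d
    proof -
      have "(\<lambda>j. norm (of_int j * F (2 * p * q * j + ((n + 1) * p * q + d)))) summable_on UNIV"
        unfolding F_def by (rule lattice_fock_weighted_sum(1)[OF pq \<tau>])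
      from infsum_int_split(2)[OF this]
      have "summable (\<lambda>k. norm (of_int (- (int k + 1)) * F (2 * p * q * (- (int k + 1)) + ((n + 1) * p * q + d))))" .
      moreover have "norm (of_int (- (int k + 1)) * F (2 * p * q * (- (int k + 1)) + ((n + 1) * p * q + d)))
          = norm (of_nat (Suc k) * F ((n - 2 * int k - 1) * p * q + d))" for k
      proof -
        have 1: "2 * p * q * (- (int k + 1)) + ((n + 1) * p * q + d) = (n - 2 * int k - 1) * p * q + d"
          by (simp add: algebra_simps)
        have 2: "complex_of_int (- (int k + 1)) = - of_nat (Suc k)"
          by simp
        show ?thesis
          unfolding 1 2 by (simp only: mult_minus_left norm_minus_cancel)
      qed
      ultimately show ?thesis
        by (simp only:)
    qed
    have sX: "summable (\<lambda>k. norm (of_nat (Suc k) * X k))"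
    proof (rule summable_comparison_test)
      show "summable (\<lambda>k. norm (of_nat (Suc k) * F ((n - 2 * int k - 1) * p * q + c))
          + norm (of_nat (Suc k) * F ((n - 2 * int k - 1) * p * q + (- c))))"
        by (intro summable_add nc)
      show "\<exists>N. \<forall>k\<ge>N. norm (norm (of_nat (Suc k) * X k)) \<le> norm (of_nat (Suc k) * F ((n - 2 * int k - 1) * p * q + c))
          + norm (of_nat (Suc k) * F ((n - 2 * int k - 1) * p * q + (- c)))"
        unfolding X_def right_diff_distrib real_norm_def abs_norm_cancel
        by (metis (no_types, lifting) add_uminus_conv_diff norm_triangle_ineq4)
    qed
    have quad: "fock_quad p q \<epsilon> r s n \<tau> (int k + 1) = X k - X (Suc k)" for k
      unfolding fock_quad_border[OF 2] X_def F_def c_def by (simp add: algebra_simps)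
    have "(\<lambda>k. of_nat (k + 1) * fock_quad p q \<epsilon> r s n \<tau> (int k + 1)) sums (\<Sum>k. X k)"
      unfolding quad by (rule suminf_weighted_telescope[OF sX])
    then have D: "(\<Sum>k. of_nat (k + 1) * fock_quad p q \<epsilon> r s n \<tau> (int k + 1)) = (\<Sum>k. X k)"
      by (rule sums_unique[symmetric])
    have vac: "of_bool (even n) * ch_L p q r s \<tau> - of_bool (odd n) * ch_L p q r (q - s) \<tau> = 0"
      using 2 by (auto simp: ch_L_border[OF pq])
    have "ch_I p q \<epsilon> r s n \<tau> = (\<Sum>k. X k)"
    proof -
      consider "r < p" "s = q" | "r = p" "s < q" | "r = p" "s = q"
        using 2 rs by linarith
      then show ?thesis
      proof cases
        case 1
        then have "ch_F p q \<epsilon> (p - r) q (n - 2 * int k - 1) \<tau> - ch_F p q \<epsilon> r q (n - 2 * int k - 2) \<tau> = X k" for k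
          unfolding chF X_def c_def by (simp add: algebra_simps)
        then show ?thesis
          using 1 by (simp add: ch_I_def)
      next
        case 2
        then have "ch_F p q \<epsilon> p s (n - 2 * int k) \<tau> - ch_F p q \<epsilon> p (q - s) (n - 2 * int k - 1) \<tau> = X k" for k
          unfolding chF X_def c_def by (simp add: algebra_simps)
        then show ?thesis
          using 2 by (simp add: ch_I_def)
      next
        case 3
        define Z where "Z = (\<lambda>k::nat. F ((n - 2 * int k) * p * q))"
        have "X = (\<lambda>k. Z k - Z (Suc k))"
          using 3 unfolding X_def c_def Z_def by (simp add: fun_eq_iff algebra_simps)
        moreover have "Z \<longlonglongrightarrow> 0"
        proof (rule Lim_null_comparison)
          have "norm (Z k) \<le> norm (of_nat (Suc k) * F ((n - 2 * int k - 1) * p * q + p * q))" for k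
          proof -
            have "(n - 2 * int k - 1) * p * q + p * q = (n - 2 * int k) * p * q"
              by (simp add: algebra_simps)
            then show ?thesis
              using mult_right_mono[of 1 "real (Suc k)" "norm (Z k)"] by (simp only: Z_def norm_mult norm_of_nat) simp
          qed
          then show "\<forall>\<^sub>F k in sequentially. norm (Z k) \<le> norm (of_nat (Suc k) * F ((n - 2 * int k - 1) * p * q + p * q))"
            by simp
          show "(\<lambda>k. norm (of_nat (Suc k) * F ((n - 2 * int k - 1) * p * q + p * q))) \<longlonglongrightarrow> 0"
            by (rule summable_LIMSEQ_zero[OF nc])
        qed
        ultimately have "X sums (Z 0 - 0)"
          using telescope_sums'[of Z 0] by simp
        then have "(\<Sum>k. X k) = Z 0"
          by (simp add: sums_iff)
        moreover have "ch_F p q \<epsilon> p q n \<tau> = Z 0"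
          unfolding chF Z_def by (simp add: algebra_simps)
        ultimately show ?thesis
          using 3 by (simp add: ch_I_def)
      qed
    qed
    then show ?thesis
      unfolding D vac by simp
  qed
qed

section \<open>The full lattice sum is the correction term\<close>

text \<open>
  The weighted sum over a coset of momenta is a combination of \<open>L\<close>, a theta series, and its
  \<open>\<epsilon>\<close>-derivative, and \<open>L\<close> is known at \<open>- 1 / \<tau>\<close>. The alternating combination of
  the four cosets has phases \<open>2 cos (A + B) - 2 cos (A - B) = - 4 sin A sin B\<close>, which yields the derivative
  term and the term proportional to \<open>n\<close>. The offsets \<open>\<plusminus> (r q \<plusminus> s p)\<close> of the cosets weight the
  antisymmetric combinations, whose phases \<open>2 \<i> sin (A \<plusminus> B)\<close> yield the mixed terms.
\<close>

lemma Y_corr_eq_infsum_fock_quad: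
  assumes pq: "p \<ge> 1" "q \<ge> 1" and \<tau>: "Im \<tau> > 0"
  shows "(\<Sum>\<^sub>\<infinity>j. of_int j * fock_quad p q \<epsilon> r s n (- 1 / \<tau>) j) = Y_corr p q \<epsilon> r s n \<tau>"
proof -
  let ?a = "complex_of_real (alpha p q)"
  let ?S = "\<lambda>m. complex_of_real (sin (pi * of_int r * of_int m / of_int p))"
  let ?T = "\<lambda>m. complex_of_real (sin (pi * of_int s * of_int m / of_int q))"
  let ?C = "\<lambda>m. complex_of_real (cos (pi * of_int r * of_int m / of_int p))"
  let ?D = "\<lambda>m. complex_of_real (cos (pi * of_int s * of_int m / of_int q))"
  let ?z = "\<lambda>m. (-1) powi (m * n) :: complex"
  have \<tau>': "Im (- 1 / \<tau>) > 0"
    by (rule Im_neg_inverse_pos[OF \<tau>])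
  have a2: "?a * ?a = 2 * of_int p * of_int q"
    using alpha_squared[OF pq] by (simp add: power2_eq_square)
  have a0: "?a \<noteq> 0" and p0: "complex_of_int p \<noteq> 0" "complex_of_int q \<noteq> 0"
    and pr0: "real_of_int p \<noteq> 0" "real_of_int q \<noteq> 0" and pi0: "complex_of_real pi \<noteq> 0"
    using alpha_pos[OF pq] pq by auto
  let ?g = "\<lambda>l m. pi * of_int m * of_int l / (of_int p * of_int q)"
  define L where "L = (\<lambda>e l. lattice_theta p q e (- 1 / \<tau>) (n * p * q + l))"
  define M where "M = (\<lambda>l. \<Sum>\<^sub>\<infinity>k. of_int (2 * p * q * k + (n * p * q + l)) * lattice_fock p q \<epsilon> (- 1 / \<tau>) (2 * p * q * k + (n * p * q + l)))"
  define c1 c2 where "c1 = r * q + s * p" and "c2 = r * q - s * p"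
  have L_eq: "L e l = (\<Sum>m = 0..2 * p * q - 1. ?z m * cis (?g l m) * E_theta p q m e \<tau>) / ?a" for e l
  proof -
    have "exp (of_real pi * \<i> * of_int m * of_int (n * p * q + l) / (of_int p * of_int q))
        = ?z m * cis (?g l m)" for m
    proof -
      have "of_real pi * \<i> * of_int m * of_int (n * p * q + l) / (of_int p * of_int q)
        = of_real pi * \<i> * of_int (m * n) + \<i> * of_real (?g l m)"
        using p0 by (simp add: field_simps)
      then show ?thesis
        by (simp only: exp_add exp_pi_int cis_conv_exp)
    qed
    then show ?thesis
      unfolding L_def lattice_theta_S[OF pq \<tau>] by simp
  qed
  have ang: "?g c1 m = pi * of_int r * of_int m / of_int p + pi * of_int s * of_int m / of_int q"
    "?g c2 m = pi * of_int r * of_int m / of_int p - pi * of_int s * of_int m / of_int q" for m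
    unfolding c1_def c2_def using pr0 by (simp_all add: field_simps)
  define SS where "SS = (\<lambda>e. \<Sum>m = 0..2 * p * q - 1. ?z m * ?S m * ?T m * E_theta p q m e \<tau>)"
  define CS where "CS = (\<Sum>m = 0..2 * p * q - 1. ?z m * ?C m * ?T m * E_theta p q m \<epsilon> \<tau>)"
  define SC where "SC = (\<Sum>m = 0..2 * p * q - 1. ?z m * ?S m * ?D m * E_theta p q m \<epsilon> \<tau>)"
  have symm: "L e l + L e (- l) = 2 / ?a * (\<Sum>m = 0..2 * p * q - 1. ?z m * of_real (cos (?g l m)) * E_theta p q m e \<tau>)"
    and skew: "L e l - L e (- l) = 2 * \<i> / ?a * (\<Sum>m = 0..2 * p * q - 1. ?z m * of_real (sin (?g l m)) * E_theta p q m e \<tau>)" for e l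
  proof -
    have "cis x = of_real (cos x) + \<i> * of_real (sin x)" for x
      by (simp add: complex_eq_iff)
    then show "L e l + L e (- l) = 2 / ?a * (\<Sum>m = 0..2 * p * q - 1. ?z m * of_real (cos (?g l m)) * E_theta p q m e \<tau>)"
      "L e l - L e (- l) = 2 * \<i> / ?a * (\<Sum>m = 0..2 * p * q - 1. ?z m * of_real (sin (?g l m)) * E_theta p q m e \<tau>)"
      unfolding L_eq by (simp_all add: distrib_left distrib_right right_diff_distrib left_diff_distrib
          sum.distrib sum_subtractf sum_distrib_left sum_divide_distrib sum_negf add_divide_distrib diff_divide_distrib mult_ac)
  qed
  have alt: "L e c1 + L e (- c1) - L e c2 - L e (- c2) = - 4 / ?a * SS e" for e
  proof -
    have "L e c1 + L e (- c1) - L e c2 - L e (- c2) = (L e c1 + L e (- c1)) - (L e c2 + L e (- c2))"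
      by simp
    also have "\<dots> = 2 / ?a * (\<Sum>m = 0..2 * p * q - 1. - 2 * (?z m * ?S m * ?T m * E_theta p q m e \<tau>))"
      unfolding symm ang right_diff_distrib[symmetric] sum_subtractf[symmetric]
      by (intro arg_cong[of _ _ "(*) _"] sum.cong refl) (simp add: cos_add cos_diff algebra_simps)
    finally show ?thesis
      unfolding SS_def sum_distrib_left[symmetric] by simp
  qed
  have skew1: "L \<epsilon> c1 - L \<epsilon> (- c1) = 2 * \<i> / ?a * (SC + CS)"
    unfolding skew ang SC_def CS_def sum.distrib[symmetric]
    by (intro arg_cong[of _ _ "(*) _"] sum.cong refl) (simp add: sin_add algebra_simps)
  have skew2: "L \<epsilon> c2 - L \<epsilon> (- c2) = 2 * \<i> / ?a * (SC - CS)"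
    unfolding skew ang SC_def CS_def sum_subtractf[symmetric]
    by (intro arg_cong[of _ _ "(*) _"] sum.cong refl) (simp add: sin_diff algebra_simps)
  have derL: "((\<lambda>e. L e l) has_field_derivative 2 * of_real pi / ?a * M l) (at \<epsilon>)" for l
    unfolding L_def M_def by (rule has_field_derivative_lattice_theta(1)[OF pq \<tau>'])
  have "((\<lambda>e. - ?a / 4 * (L e c1 + L e (- c1) - L e c2 - L e (- c2))) has_field_derivative
      - ?a / 4 * (2 * of_real pi / ?a * M c1 + 2 * of_real pi / ?a * M (- c1)
        - 2 * of_real pi / ?a * M c2 - 2 * of_real pi / ?a * M (- c2))) (at \<epsilon>)"
    by (intro DERIV_cmult DERIV_add DERIV_diff derL)
  also have "(\<lambda>e. - ?a / 4 * (L e c1 + L e (- c1) - L e c2 - L e (- c2))) = SS"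
    unfolding alt using a0 by simp
  finally have dSS: "deriv SS \<epsilon> = - of_real pi / 2 * (M c1 + M (- c1) - M c2 - M (- c2))"
    unfolding distrib_left[symmetric] right_diff_distrib[symmetric] using a0 by (simp add: DERIV_imp_deriv)
  define W where "W = (\<lambda>l. \<Sum>\<^sub>\<infinity>k. of_int k * lattice_fock p q \<epsilon> (- 1 / \<tau>) (2 * p * q * k + l))"
  have W: "W (n * p * q + l) = (M l - of_int (n * p * q + l) * L \<epsilon> l) / (2 * of_int p * of_int q)" for l
    unfolding W_def lattice_fock_weighted_sum(2)[OF pq \<tau>'] M_def L_def ..
  have cancel: "X = - 2 / of_real pi * (- of_real pi / 2 * X)" for X :: complex
    using pi0 by simp
  have "(\<Sum>\<^sub>\<infinity>j. of_int j * fock_quad p q \<epsilon> r s n (- 1 / \<tau>) j)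
      = - (W (n * p * q + c1) + W (n * p * q + (- c1)) - W (n * p * q + c2) - W (n * p * q + (- c2)))"
    unfolding infsum_fock_quad(2)[OF pq \<tau>'] c1_def[symmetric] c2_def[symmetric] W_def
    by (simp only: add_uminus_conv_diff)
  also have "\<dots> = - (M c1 + M (- c1) - M c2 - M (- c2)) / (2 * of_int p * of_int q)
      + (of_int (n * p * q) * (L \<epsilon> c1 + L \<epsilon> (- c1) - L \<epsilon> c2 - L \<epsilon> (- c2))
        + of_int c1 * (L \<epsilon> c1 - L \<epsilon> (- c1)) - of_int c2 * (L \<epsilon> c2 - L \<epsilon> (- c2))) / (2 * of_int p * of_int q)"
    unfolding W by (simp add: add_divide_distrib diff_divide_distrib algebra_simps)
  also have "M c1 + M (- c1) - M c2 - M (- c2) = - 2 / of_real pi * deriv SS \<epsilon>"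
    unfolding dSS by (rule cancel)
  also have "- (- 2 / of_real pi * deriv SS \<epsilon>) / (2 * of_int p * of_int q)
      + (of_int (n * p * q) * (L \<epsilon> c1 + L \<epsilon> (- c1) - L \<epsilon> c2 - L \<epsilon> (- c2))
        + of_int c1 * (L \<epsilon> c1 - L \<epsilon> (- c1)) - of_int c2 * (L \<epsilon> c2 - L \<epsilon> (- c2))) / (2 * of_int p * of_int q)
      = 1 / (of_real pi * of_int p * of_int q) * deriv SS \<epsilon>
      - 2 * of_int n / ?a * SS \<epsilon>
      + 2 * of_int r * \<i> / of_int p * (1 / ?a) * CS
      + 2 * of_int s * \<i> / of_int q * (1 / ?a) * SC"
    unfolding alt skew1 skew2 unfolding c1_def c2_def using a0 p0 pi0 by (simp add: field_simps)
  finally show ?thesis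
    unfolding Y_corr_def SS_def CS_def SC_def .
qed

section \<open>The half-lattice sum as an integral\<close>

text \<open>
  Both \<open>\<i> / \<tau>\<close> and \<open>- \<i> * \<tau>\<close> have positive real part, so the principal branch is multiplicative here.
\<close>

lemma csqrt_i_div:
  assumes \<tau>: "Im \<tau> > 0"
  shows "csqrt (\<i> / \<tau>) * csqrt (- \<i> * \<tau>) = 1" and "csqrt (- \<i> * \<tau>) \<noteq> 0"
proof -
  define z where "z = csqrt (- \<i> * \<tau>)"
  have t0: "\<tau> \<noteq> 0"
    using \<tau> by auto
  have z2: "z\<^sup>2 = - \<i> * \<tau>"
    by (simp add: z_def)
  have z0: "z \<noteq> 0"
    using z2 t0 by auto
  have "Re z > 0"
  proof -
    have "Re z \<noteq> 0"
    proof
      assume "Re z = 0"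
      then have "Re (z\<^sup>2) \<le> 0"
        by (simp add: power2_eq_square)
      then show False
        unfolding z2 using \<tau> by simp
    qed
    then show ?thesis
      using Re_csqrt[of "- \<i> * \<tau>"] by (simp add: z_def)
  qed
  then have "Re (inverse z) > 0"
    unfolding inverse_complex.sel by (intro divide_pos_pos add_pos_nonneg) auto
  moreover have "(inverse z)\<^sup>2 = \<i> / \<tau>"
    unfolding power_inverse z2 using t0 by (simp add: field_simps)
  ultimately have "csqrt (\<i> / \<tau>) = inverse z"
    by (intro csqrt_unique) auto
  then show "csqrt (\<i> / \<tau>) * csqrt (- \<i> * \<tau>) = 1" "csqrt (- \<i> * \<tau>) \<noteq> 0"
    using z0 by (simp_all add: z_def)
qed

text \<open>
  The Gaussian is its own Fourier transform; \<open>dedekind_eta_S\<close> cancels the square root. The shift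
  of \<open>x\<close> by \<open>\<i> \<epsilon>\<close> in the exponential is the constant factor \<open>exp (2 \<pi> \<epsilon> M / a)\<close>.
\<close>

lemma lattice_fock_S:
  assumes pq: "p \<ge> 1" "q \<ge> 1" and \<tau>: "Im \<tau> > 0"
  shows "integrable lborel (\<lambda>x. exp (- (2 * of_real pi * \<i> * of_int M / of_real (alpha p q) * (of_real x + \<i> * \<epsilon>))) * gauss_term \<tau> 0 (of_real x))"
    and "lattice_fock p q \<epsilon> (- 1 / \<tau>) M =
      (LINT x|lborel. exp (- (2 * of_real pi * \<i> * of_int M / of_real (alpha p q) * (of_real x + \<i> * \<epsilon>))) * gauss_term \<tau> 0 (of_real x)) / dedekind_eta \<tau>"
proof -
  let ?a = "complex_of_real (alpha p q)"
  define u where "u = of_int M / ?a"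
  have t0: "\<tau> \<noteq> 0"
    using \<tau> by auto
  have eq: "exp (- (2 * of_real pi * \<i> * of_int M / ?a * (of_real x + \<i> * \<epsilon>))) * gauss_term \<tau> 0 (of_real x)
      = exp (2 * of_real pi * u * \<epsilon>) * (gauss_term \<tau> 0 (of_real x) * exp (- (of_real (2 * pi) * \<i> * u * of_real x)))" for x
  proof -
    have "- (2 * of_real pi * \<i> * of_int M / ?a * (of_real x + \<i> * \<epsilon>)) = 2 * of_real pi * u * \<epsilon> + - (of_real (2 * pi) * \<i> * u * of_real x)"
      by (simp add: u_def algebra_simps add_divide_distrib diff_divide_distrib)
    then show ?thesis
      by (simp only: exp_add mult_ac)
  qed
  show "integrable lborel (\<lambda>x. exp (- (2 * of_real pi * \<i> * of_int M / ?a * (of_real x + \<i> * \<epsilon>))) * gauss_term \<tau> 0 (of_real x))"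
    unfolding eq by (intro integrable_mult_right fourier_gauss_term(1)[OF \<tau>])
  have "(LINT x|lborel. exp (- (2 * of_real pi * \<i> * of_int M / ?a * (of_real x + \<i> * \<epsilon>))) * gauss_term \<tau> 0 (of_real x))
      = exp (2 * of_real pi * u * \<epsilon>) * (exp (of_real (- pi) * \<i> * (u - 0)\<^sup>2 / \<tau>) / csqrt (- \<i> * \<tau>))"
    unfolding eq integral_mult_right_zero fourier_gauss_term(2)[OF \<tau>] ..
  moreover have "nome_pow (- 1 / \<tau>) ((of_int M)\<^sup>2 / (4 * of_int p * of_int q)) = exp (of_real (- pi) * \<i> * (u - 0)\<^sup>2 / \<tau>)"
    unfolding nome_pow_def u_def diff_zero power_divide alpha_squared[OF pq] by (simp add: mult_ac)
  moreover have "1 / dedekind_eta (- 1 / \<tau>) = 1 / csqrt (- \<i> * \<tau>) / dedekind_eta \<tau>"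
  proof -
    have "csqrt (\<i> / \<tau>) = 1 / csqrt (- \<i> * \<tau>)"
      using csqrt_i_div[OF \<tau>] by (metis nonzero_eq_divide_eq)
    then show ?thesis
      unfolding dedekind_eta_S[OF \<tau>] by simp
  qed
  moreover have "lattice_fock p q \<epsilon> (- 1 / \<tau>) M = exp (2 * of_real pi * u * \<epsilon>) *
      nome_pow (- 1 / \<tau>) ((of_int M)\<^sup>2 / (4 * of_int p * of_int q)) * (1 / dedekind_eta (- 1 / \<tau>))"
    by (simp add: lattice_fock_def u_def mult_ac)
  ultimately show "lattice_fock p q \<epsilon> (- 1 / \<tau>) M =
      (LINT x|lborel. exp (- (2 * of_real pi * \<i> * of_int M / ?a * (of_real x + \<i> * \<epsilon>))) * gauss_term \<tau> 0 (of_real x)) / dedekind_eta \<tau>"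
    by (simp only:) simp
qed

text \<open>
  The four plane waves have phases \<open>\<plusminus> (A + B)\<close> and \<open>\<plusminus> (A - B)\<close> around a common wave, so their
  alternating sum is \<open>2 cos (A + B) - 2 cos (A - B)\<close>.
\<close>

lemma fock_quad_S:
  fixes p q r s n j :: int and \<epsilon> \<tau> :: complex
  assumes pq: "p \<ge> 1" "q \<ge> 1" and \<tau>: "Im \<tau> > 0"
  defines "a \<equiv> complex_of_real (alpha p q)"
  defines "K \<equiv> \<lambda>x. - 4 * exp (- of_real pi * \<i> * of_int n * a * (of_real x + \<i> * \<epsilon>)) *
      (sin (2 * of_real pi * of_int r * of_int q * (of_real x + \<i> * \<epsilon>) / a) *
       sin (2 * of_real pi * of_int s * of_int p * (of_real x + \<i> * \<epsilon>) / a)) * gauss_term \<tau> 0 (of_real x)"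
  shows "integrable lborel (\<lambda>x. exp (of_int j * (2 * of_real pi * \<i> * a * (of_real x + \<i> * \<epsilon>))) * K x)"
    and "fock_quad p q \<epsilon> r s n (- 1 / \<tau>) j
      = (LINT x|lborel. exp (of_int j * (2 * of_real pi * \<i> * a * (of_real x + \<i> * \<epsilon>))) * K x) / dedekind_eta \<tau>"
proof -
  define f where "f = (\<lambda>M x. exp (- (2 * of_real pi * \<i> * of_int M / a * (of_real x + \<i> * \<epsilon>))) * gauss_term \<tau> 0 (of_real x))"
  have a0: "a \<noteq> 0"
    using alpha_pos[OF pq] by (simp add: a_def)
  have a2: "a * a = 2 * of_int p * of_int q"
    using alpha_squared[OF pq] by (simp add: power2_eq_square a_def)
  have intf: "integrable lborel (f M)" for M
    unfolding f_def a_def by (rule lattice_fock_S(1)[OF pq \<tau>])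
  have fock: "lattice_fock p q \<epsilon> (- 1 / \<tau>) M = (LINT x|lborel. f M x) / dedekind_eta \<tau>" for M
    unfolding f_def a_def by (rule lattice_fock_S(2)[OF pq \<tau>])
  define N where "N = (n - 2 * j) * p * q"
  let ?c1 = "r * q + s * p" and ?c2 = "r * q - s * p"
  have eq: "f (N + ?c1) x + f (N - ?c1) x - f (N + ?c2) x - f (N - ?c2) x
      = exp (of_int j * (2 * of_real pi * \<i> * a * (of_real x + \<i> * \<epsilon>))) * K x" for x
  proof -
    define y where "y = of_real x + \<i> * \<epsilon>"
    define A where "A = 2 * of_real pi * of_int r * of_int q * y / a"
    define B where "B = 2 * of_real pi * of_int s * of_int p * y / a"
    define E where "E = exp (of_int j * (2 * of_real pi * \<i> * a * y)) * exp (- of_real pi * \<i> * of_int n * a * y) * gauss_term \<tau> 0 (of_real x)"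
    have fN: "f (N + c) x = E * exp (- (2 * of_real pi * \<i> * of_int c * y / a))" for c
    proof -
      have "of_int N / a = (of_int n - 2 * of_int j) * a / 2"
      proof -
        have "complex_of_int N * 2 = (of_int n - 2 * of_int j) * (a * a)"
          unfolding a2 N_def by simp
        then show ?thesis
          using a0 by (simp add: field_simps)
      qed
      then have Nc: "complex_of_int (N + c) / a = (of_int n - 2 * of_int j) * a / 2 + of_int c / a"
        by (simp only: of_int_add add_divide_distrib)
      have "- (2 * of_real pi * \<i> * of_int (N + c) / a * y) = - (2 * of_real pi * \<i> * (of_int (N + c) / a) * y)"
        by (simp only: times_divide_eq_right)
      also have "\<dots>
        = - (2 * of_real pi * \<i> * ((of_int n - 2 * of_int j) * a / 2) * y) + - (2 * of_real pi * \<i> * of_int c * y / a)"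
        unfolding Nc by (simp add: distrib_left distrib_right)
      also have "- (2 * of_real pi * \<i> * ((of_int n - 2 * of_int j) * a / 2) * y)
        = of_int j * (2 * of_real pi * \<i> * a * y) + (- of_real pi * \<i> * of_int n * a * y)"
        by (simp add: field_simps)
      finally show ?thesis
        unfolding f_def y_def[symmetric] E_def by (simp only: exp_add mult_ac)
    qed
    have c: "2 * of_real pi * \<i> * of_int ?c1 * y / a = \<i> * (A + B)" "2 * of_real pi * \<i> * of_int (- ?c1) * y / a = - (\<i> * (A + B))"
      "2 * of_real pi * \<i> * of_int ?c2 * y / a = \<i> * (A - B)" "2 * of_real pi * \<i> * of_int (- ?c2) * y / a = - (\<i> * (A - B))"
      by (simp_all add: A_def B_def algebra_simps add_divide_distrib diff_divide_distrib)
    have "f (N + ?c1) x + f (N - ?c1) x - f (N + ?c2) x - f (N - ?c2) x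
      = f (N + ?c1) x + f (N + (- ?c1)) x - f (N + ?c2) x - f (N + (- ?c2)) x"
      by (simp only: add_uminus_conv_diff)
    also have "\<dots> = E * ((exp (\<i> * (A + B)) + exp (- (\<i> * (A + B)))) - (exp (\<i> * (A - B)) + exp (- (\<i> * (A - B)))))"
      unfolding fN c by (simp add: algebra_simps)
    also have "exp (\<i> * (A + B)) + exp (- (\<i> * (A + B))) = 2 * cos (A + B)"
      unfolding cos_exp_eq by simp
    also have "exp (\<i> * (A - B)) + exp (- (\<i> * (A - B))) = 2 * cos (A - B)"
      unfolding cos_exp_eq by simp
    also have "2 * cos (A + B) - 2 * cos (A - B) = - 4 * (sin A * sin B)"
      by (simp add: cos_add cos_diff)
    finally show ?thesis
      unfolding K_def y_def[symmetric] E_def A_def B_def by (simp only: mult_ac)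
  qed
  have "integrable lborel (\<lambda>x. f (N + ?c1) x + f (N - ?c1) x - f (N + ?c2) x - f (N - ?c2) x)"
    by (intro Bochner_Integration.integrable_add Bochner_Integration.integrable_diff intf)
  then show "integrable lborel (\<lambda>x. exp (of_int j * (2 * of_real pi * \<i> * a * (of_real x + \<i> * \<epsilon>))) * K x)"
    unfolding eq .
  have "fock_quad p q \<epsilon> r s n (- 1 / \<tau>) j = ((LINT x|lborel. f (N + ?c1) x) + (LINT x|lborel. f (N - ?c1) x)
      - (LINT x|lborel. f (N + ?c2) x) - (LINT x|lborel. f (N - ?c2) x)) / dedekind_eta \<tau>"
    unfolding fock_quad_def Let_def N_def[symmetric] fock by (simp only: add_divide_distrib diff_divide_distrib)
  also have "(LINT x|lborel. f (N + ?c1) x) + (LINT x|lborel. f (N - ?c1) x)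
      - (LINT x|lborel. f (N + ?c2) x) - (LINT x|lborel. f (N - ?c2) x)
      = (LINT x|lborel. f (N + ?c1) x + f (N - ?c1) x - f (N + ?c2) x - f (N - ?c2) x)"
    by (simp add: intf)
  finally show "fock_quad p q \<epsilon> r s n (- 1 / \<tau>) j
      = (LINT x|lborel. exp (of_int j * (2 * of_real pi * \<i> * a * (of_real x + \<i> * \<epsilon>))) * K x) / dedekind_eta \<tau>"
    unfolding eq .
qed

text \<open>
  With \<open>z = exp (2 \<i> \<phi>)\<close> the value \<open>z / (1 - z)\<^sup>2\<close> is invariant under \<open>z \<mapsto> 1 / z\<close>. This is why
  the same kernel serves both signs of \<open>Re \<epsilon>\<close>.
\<close>

lemma geometric_kernel:
  fixes \<phi> :: complex
  assumes "\<sigma> = 1 \<or> \<sigma> = - 1" and z: "norm (exp (of_int \<sigma> * (2 * \<i> * \<phi>))) < 1"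
  shows "(\<lambda>k. of_nat (k + 1) * exp (of_int (\<sigma> * (int k + 1)) * (2 * \<i> * \<phi>))) sums (- 1 / (4 * (sin \<phi>)\<^sup>2))"
proof -
  define z where "z = exp (of_int \<sigma> * (2 * \<i> * \<phi>))"
  define w where "w = exp (of_int \<sigma> * (\<i> * \<phi>))"
  have "of_int \<sigma> * (2 * \<i> * \<phi>) = of_int \<sigma> * (\<i> * \<phi>) + of_int \<sigma> * (\<i> * \<phi>)"
    by (simp add: algebra_simps)
  then have zw: "z = w * w"
    by (simp only: z_def w_def exp_add)
  have w0: "w \<noteq> 0"
    by (simp add: w_def)
  have "exp (of_int (\<sigma> * (int k + 1)) * (2 * \<i> * \<phi>)) = z ^ Suc k" for k
  proof -
    have "of_int (\<sigma> * (int k + 1)) * (2 * \<i> * \<phi>) = of_nat (Suc k) * (of_int \<sigma> * (2 * \<i> * \<phi>))"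
      by (simp add: algebra_simps)
    then show ?thesis
      by (simp only: z_def exp_of_nat_mult)
  qed
  moreover have "(\<lambda>k. z * (of_nat (Suc k) * z ^ k)) sums (z * (1 / (1 - z)\<^sup>2))"
    by (intro sums_mult geometric_deriv_sums) (use z in \<open>simp add: z_def\<close>)
  ultimately have "(\<lambda>k. of_nat (k + 1) * exp (of_int (\<sigma> * (int k + 1)) * (2 * \<i> * \<phi>))) sums (z * (1 / (1 - z)\<^sup>2))"
    by (simp add: mult_ac)
  moreover have "z * (1 / (1 - z)\<^sup>2) = - 1 / (4 * (sin \<phi>)\<^sup>2)"
  proof -
    have "norm z < 1"
      using assms(2) by (simp only: z_def)
    then have z1: "1 - z \<noteq> 0"
      by auto
    have "(sin \<phi>)\<^sup>2 = - ((w - 1 / w)\<^sup>2 / 4)"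
    proof -
      have "sin \<phi> = of_int \<sigma> * ((w - 1 / w) / (2 * \<i>))"
        using assms(1) unfolding sin_exp_eq w_def by (auto simp: exp_minus field_simps)
      moreover have "(of_int \<sigma> :: complex)\<^sup>2 = 1"
        using assms(1) by auto
      ultimately show ?thesis
        by (simp add: power_mult_distrib power_divide)
    qed
    moreover have "(w - 1 / w)\<^sup>2 = (1 - z)\<^sup>2 / z"
      unfolding zw using w0 by (simp add: power2_eq_square field_simps)
    ultimately show ?thesis
      using z1 w0 by (simp add: zw)
  qed
  ultimately show ?thesis
    by simp
qed

text \<open>
  The sign \<open>\<sigma>\<close> selects the half of the lattice on which \<open>exp (2 \<i> \<phi>) powi j\<close> decays. Its modulus \<open>\<rho>\<close> to
  the power \<open>|j|\<close> does not depend on \<open>x\<close>, so summation and integration can be interchanged.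
\<close>

theorem fock_quad_sum_S:
  assumes pq: "p \<ge> 1" "q \<ge> 1" and \<tau>: "Im \<tau> > 0" and \<sigma>: "\<sigma> = 1 \<or> \<sigma> = - 1" "of_int \<sigma> * Re \<epsilon> > 0"
  shows "(\<Sum>k. of_nat (k + 1) * fock_quad p q \<epsilon> r s n (- 1 / \<tau>) (\<sigma> * (int k + 1)))
    = (LINT x|lborel. S_kernel p q \<epsilon> r s n x * ch_Fock p q \<epsilon> (of_real (x + alpha_zero p q / 2)) \<tau>)"
proof -
  define a where "a = complex_of_real (alpha p q)"
  define y where "y = (\<lambda>x::real. of_real x + \<i> * \<epsilon>)"
  define K where "K = (\<lambda>x. - 4 * exp (- of_real pi * \<i> * of_int n * a * y x) *
      (sin (2 * of_real pi * of_int r * of_int q * y x / a) *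
       sin (2 * of_real pi * of_int s * of_int p * y x / a)) * gauss_term \<tau> 0 (of_real x))"
  define Z where "Z = (\<lambda>k x. exp (of_int (\<sigma> * (int k + 1)) * (2 * of_real pi * \<i> * a * y x)))"
  define \<rho> where "\<rho> = exp (- 2 * pi * alpha p q * (of_int \<sigma> * Re \<epsilon>))"
  have \<rho>: "0 < \<rho>" "\<rho> < 1"
    using \<sigma>(2) alpha_pos[OF pq] by (simp_all add: \<rho>_def)
  have nZ: "norm (Z k x) = \<rho> ^ Suc k" for k x
  proof -
    have "Re (of_int (\<sigma> * (int k + 1)) * (2 * of_real pi * \<i> * a * y x)) = real (Suc k) * (- 2 * pi * alpha p q * (of_int \<sigma> * Re \<epsilon>))"
      by (simp add: y_def a_def algebra_simps)
    then show ?thesis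
      unfolding Z_def norm_exp_eq_Re \<rho>_def by (simp only: exp_of_nat_mult)
  qed
  have quad: "integrable lborel (\<lambda>x. exp (of_int j * (2 * of_real pi * \<i> * a * y x)) * K x)"
    "fock_quad p q \<epsilon> r s n (- 1 / \<tau>) j
      = (LINT x|lborel. exp (of_int j * (2 * of_real pi * \<i> * a * y x)) * K x) / dedekind_eta \<tau>" for j
    unfolding a_def y_def K_def by (rule fock_quad_S[OF pq \<tau>])+
  define f where "f = (\<lambda>k x. of_nat (k + 1) * (Z k x * K x))"
  have intf: "integrable lborel (f k)" for k
    unfolding f_def Z_def by (intro integrable_mult_right quad(1))
  have intK: "integrable lborel K"
    using quad(1)[of 0] by simp
  have nf: "norm (f k x) = real (k + 1) * \<rho> ^ Suc k * norm (K x)" for k x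
    unfolding f_def norm_mult nZ by (simp add: norm_of_nat del: of_nat_Suc of_nat_add)
  have s\<rho>: "summable (\<lambda>k. real (k + 1) * \<rho> ^ Suc k)"
  proof -
    have "summable (\<lambda>k. \<rho> * (of_nat (Suc k) * \<rho> ^ k))"
      using \<rho> by (intro summable_mult sums_summable[OF geometric_deriv_sums]) auto
    then show ?thesis
      by (simp add: mult_ac)
  qed
  have "(LINT x|lborel. (\<Sum>k. f k x)) = (\<Sum>k. LINT x|lborel. f k x)"
  proof (rule integral_suminf[OF intf])
    show "AE x in lborel. summable (\<lambda>k. norm (f k x))"
      unfolding nf by (intro AE_I2 summable_mult2 s\<rho>)
    show "summable (\<lambda>k. LINT x|lborel. norm (f k x))"
      unfolding nf integral_mult_right_zero by (intro summable_mult2 s\<rho>)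
  qed
  moreover have "(LINT x|lborel. f k x) / dedekind_eta \<tau> = of_nat (k + 1) * fock_quad p q \<epsilon> r s n (- 1 / \<tau>) (\<sigma> * (int k + 1))" for k
    unfolding f_def integral_mult_right_zero Z_def quad(2) by simp
  moreover have "summable (\<lambda>k. LINT x|lborel. f k x)"
  proof (rule summable_norm_cancel, rule summable_comparison_test)
    show "summable (\<lambda>k. real (k + 1) * \<rho> ^ Suc k * (LINT x|lborel. norm (K x)))"
      by (intro summable_mult2 s\<rho>)
    have "norm (LINT x|lborel. f k x) \<le> real (k + 1) * \<rho> ^ Suc k * (LINT x|lborel. norm (K x))" for k
      using integral_norm_bound[of lborel "f k"] unfolding nf integral_mult_right_zero .
    then show "\<exists>N. \<forall>k\<ge>N. norm (norm (LINT x|lborel. f k x)) \<le> real (k + 1) * \<rho> ^ Suc k * (LINT x|lborel. norm (K x))"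
      by simp
  qed
  ultimately have "(\<Sum>k. of_nat (k + 1) * fock_quad p q \<epsilon> r s n (- 1 / \<tau>) (\<sigma> * (int k + 1)))
      = (LINT x|lborel. (\<Sum>k. f k x)) / dedekind_eta \<tau>"
    using suminf_divide[of "\<lambda>k. LINT x|lborel. f k x" "dedekind_eta \<tau>"] by simp
  also have "\<dots> = (LINT x|lborel. (\<Sum>k. f k x) / dedekind_eta \<tau>)"
    by simp
  also have "(\<lambda>x. (\<Sum>k. f k x) / dedekind_eta \<tau>)
      = (\<lambda>x. S_kernel p q \<epsilon> r s n x * ch_Fock p q \<epsilon> (of_real (x + alpha_zero p q / 2)) \<tau>)"
  proof
    fix x
    define \<phi> where "\<phi> = of_real pi * a * y x"
    have Z: "Z k x = exp (of_int (\<sigma> * (int k + 1)) * (2 * \<i> * \<phi>))" for k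
      unfolding Z_def \<phi>_def by (simp only: mult_ac)
    have "norm (exp (of_int \<sigma> * (2 * \<i> * \<phi>))) < 1"
      using nZ[of 0 x] \<rho> unfolding Z by simp
    from sums_mult2[OF geometric_kernel[OF \<sigma>(1) this], of "K x"]
    have "(\<lambda>k. f k x) sums (- 1 / (4 * (sin \<phi>)\<^sup>2) * K x)"
      unfolding f_def Z by (simp only: mult.assoc)
    then have "(\<Sum>k. f k x) = - 1 / (4 * (sin \<phi>)\<^sup>2) * K x"
      by (rule sums_unique[symmetric])
    also have "\<dots> / dedekind_eta \<tau> = S_kernel p q \<epsilon> r s n x * ch_Fock p q \<epsilon> (of_real (x + alpha_zero p q / 2)) \<tau>"
    proof -
      have 1: "complex_of_real (x + alpha_zero p q / 2) - of_real (alpha_zero p q) / 2 = of_real x"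
        by simp
      have 2: "nome_pow \<tau> ((of_real x)\<^sup>2 / 2) = gauss_term \<tau> 0 (of_real x)"
        by (simp add: nome_pow_def gauss_term_def mult_ac)
      have 3: "exp (- 2 * of_real pi * \<epsilon> * of_real x) * exp (2 * of_real pi * \<epsilon> * of_real x) = 1"
        by (simp add: exp_add[symmetric])
      define U where "U = exp (- 2 * of_real pi * \<epsilon> * of_real x)"
      define V where "V = exp (2 * of_real pi * \<epsilon> * of_real x)"
      have UV: "U * V = 1"
        using 3 by (simp only: U_def V_def)
      define E where "E = exp (- of_real pi * \<i> * of_int n * a * y x)"
      define T where "T = sin (2 * of_real pi * of_int r * of_int q * y x / a) * sin (2 * of_real pi * of_int s * of_int p * y x / a)"
      have "S_kernel p q \<epsilon> r s n x * ch_Fock p q \<epsilon> (of_real (x + alpha_zero p q / 2)) \<tau>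
        = (U * E * T / (sin \<phi>)\<^sup>2) * (V * gauss_term \<tau> 0 (of_real x) / dedekind_eta \<tau>)"
        unfolding S_kernel_def ch_Fock_def Let_def 1 2 a_def[symmetric] \<phi>_def U_def V_def E_def T_def y_def ..
      also have "\<dots> = (U * V) * (E * T * gauss_term \<tau> 0 (of_real x) / (sin \<phi>)\<^sup>2 / dedekind_eta \<tau>)"
        by simp
      also have "\<dots> = - 1 / (4 * (sin \<phi>)\<^sup>2) * K x / dedekind_eta \<tau>"
        unfolding UV K_def E_def[symmetric] T_def[symmetric] by simp
      finally show ?thesis
        by (rule sym)
    qed
    finally show "(\<Sum>k. f k x) / dedekind_eta \<tau> = S_kernel p q \<epsilon> r s n x * ch_Fock p q \<epsilon> (of_real (x + alpha_zero p q / 2)) \<tau>" .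
  qed
  finally show ?thesis .
qed

section \<open>The modular transformation\<close>

theorem theorem8:
  fixes p q r s n :: int and \<epsilon> \<tau> :: complex
  assumes "p \<ge> 1" and "q \<ge> 1" and "coprime p q" and "p \<noteq> q"
    and "Im \<tau> > 0"
    and "Re \<epsilon> \<noteq> 0"
    and "1 \<le> r" and "r \<le> p" and "1 \<le> s" and "s \<le> q"
  shows "ch_I p q \<epsilon> r s n (- 1 / \<tau>) =
      of_int n * of_bool (n \<ge> 0) *
        (\<Sum>(r', s')\<in>Kac_half p q. (-1) powi (n * (p * s' + q * r')) *
           of_real (S_Vir p q (r, s) (r', s')) * ch_L p q r' s' \<tau>)
      + (LINT x|lborel. S_kernel p q \<epsilon> r s n x *
           ch_Fock p q \<epsilon> (of_real (x + alpha_zero p q / 2)) \<tau>)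
      + (1 - of_real (sgn (Re \<epsilon>))) / 2 * Y_corr p q \<epsilon> r s n \<tau>"
proof -
  note pq = assms(1,2) and \<tau> = assms(5)
  have \<tau>': "Im (- 1 / \<tau>) > 0"
    by (rule Im_neg_inverse_pos[OF \<tau>])
  define V where "V = fock_quad p q \<epsilon> r s n (- 1 / \<tau>)"
  define I where "I = (LINT x|lborel. S_kernel p q \<epsilon> r s n x * ch_Fock p q \<epsilon> (of_real (x + alpha_zero p q / 2)) \<tau>)"
  have "(\<Sum>k. of_nat (k + 1) * V (int k + 1)) = I + (1 - of_real (sgn (Re \<epsilon>))) / 2 * Y_corr p q \<epsilon> r s n \<tau>"
  proof (cases "Re \<epsilon> > 0")
    case True
    then show ?thesis
      using fock_quad_sum_S[OF pq \<tau>, of 1 \<epsilon> r s n] by (simp add: V_def I_def)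
  next
    case False
    then have neg: "Re \<epsilon> < 0"
      using assms(6) by simp
    \<comment> \<open>The half with \<open>j \<ge> 1\<close> is the wanted sum, the half with \<open>j \<le> - 1\<close> is minus the integral.\<close>
    have "(\<Sum>\<^sub>\<infinity>j. of_int j * V j) = of_int 0 * V 0 + (\<Sum>k. of_int (int k + 1) * V (int k + 1))
        + (\<Sum>k. of_int (- (int k + 1)) * V (- (int k + 1)))"
      unfolding V_def by (rule infsum_int_split(3)[OF infsum_fock_quad(1)[OF pq \<tau>']])
    also have "(\<lambda>k. of_int (int k + 1) * V (int k + 1)) = (\<lambda>k. of_nat (k + 1) * V (int k + 1))"
      by (simp add: add.commute)
    also have "(\<lambda>k. of_int (- (int k + 1)) * V (- (int k + 1))) = (\<lambda>k. - (of_nat (k + 1) * V (- 1 * (int k + 1))))"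
      by (simp add: fun_eq_iff algebra_simps)
    also have "(\<Sum>k. - (of_nat (k + 1) * V (- 1 * (int k + 1)))) = - (\<Sum>k. of_nat (k + 1) * V (- 1 * (int k + 1)))"
    proof (rule suminf_minus)
      have "summable (\<lambda>k. of_int (- (int k + 1)) * V (- (int k + 1)))"
        unfolding V_def by (rule summable_norm_cancel, rule infsum_int_split(2)[OF infsum_fock_quad(1)[OF pq \<tau>']])
      then have "summable (\<lambda>k. - (of_int (- (int k + 1)) * V (- (int k + 1))))"
        by (rule summable_minus)
      then show "summable (\<lambda>k. of_nat (k + 1) * V (- 1 * (int k + 1)))"
        by (simp add: algebra_simps)
    qed
    also have "(\<Sum>k. of_nat (k + 1) * V (- 1 * (int k + 1))) = I"
      unfolding V_def I_def by (rule fock_quad_sum_S[OF pq \<tau>]) (use neg in auto)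
    also have "(\<Sum>\<^sub>\<infinity>j. of_int j * V j) = Y_corr p q \<epsilon> r s n \<tau>"
      unfolding V_def by (rule Y_corr_eq_infsum_fock_quad[OF pq \<tau>])
    finally show ?thesis
      using neg by simp
  qed
  then show ?thesis
    unfolding ch_I_uniform[OF pq \<tau>' assms(8,10)] vacuum_S[OF pq assms(3) \<tau>] V_def I_def
    by (simp only: add.assoc)
qed

end
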